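(* Let $\boldsymbol X(t)$, $t\in\mathcal T=\mathbb R^p$, be a $d$-dimensional max-stable process with index $\alpha>0$, Fréchet marginals, sample paths in $C$ and spectral process $\boldsymbol Z$ (with sample paths in $C$) such that $$\mathbb P\Bigl\{\sup_{t\in\mathcal T}\|\boldsymbol Z(t)\|>0\Bigr\}=1,\qquad \mathbb E\{\|\boldsymbol Z(t)\|^\alpha\}=1\quad\text{for all } t\in\mathcal T .$$ Then the stationarity of $\boldsymbol X$ (i.e. $B^h\boldsymbol X$ and $\boldsymbol X$ have the same law for every $h\in\mathcal T$) is equivalent to each one of the following three conditions: (i) For any $T_0$-valued random variable $W$ with probability mass function $p(t)>0$, $t\in T_0$, independent of everything else, the process $$\boldsymbol Z_W(t)=\frac{1}{\bigl(\sum_{s\in T_0}\|\boldsymbol\Theta(s-W)\|^\alpha p(s)\bigr)^{1/\alpha}}\ \boldsymbol\Theta(t-W),\qquad t\in\mathcal T,$$ is a spectral process for $\boldsymbol X$, where $\boldsymbol\Theta=\boldsymbol\Theta^{[0]}$ is the tilted process of $\boldsymbol Z$ at $0$. (ii) For all $h\in\mathcal T$, $\Gamma\in E_0$ and all positive integers $k\le d$, $$\mathbb E\{Z_k^\alpha(h)\,\Gamma(\boldsymbol Z)\}=\mathbb E\{Z_k^\alpha(0)\,\Gamma(B^h\boldsymbol Z)\}.$$ (iii) For all $h\in\mathcal T$ and all positive integers $k\le d$, the processes $\boldsymbol\Theta^{[h,k]}$ and $B^h\boldsymbol\Theta^{[0,k]}$ are equal in law, where $\boldsymbol\Theta^{[h,k]}=(\Theta^{[h,k]}_1,\ldots,\Theta^{[h,k]}_d)$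 is defined by $$\mathbb P\{\boldsymbol\Theta^{[h,k]}\in A\}=\mathbb E\Bigl\{\frac{Z_k^\alpha(h)}{\mathbb E\{Z_k^\alpha(h)\}}\,\mathbb I(\boldsymbol Z/Z_k(h)\in A)\Bigr\},\qquad A\in\mathcal C,$$ with $\boldsymbol\Theta^{[h,k]}(t)$, $t\in\mathcal T$, set equal to $(1,\ldots,1)\in\mathbb R^d$ if $\mathbb E\{Z_k^\alpha(h)\}=0$.
   Context: Here $d,p$ are positive integers, $\mathcal T=\mathbb R^p$, $T_0=\mathbb Q^p$, and $\|\cdot\|$ is a fixed norm on $\mathbb R^d$. $C$ is the space of all continuous functions $f:\mathcal T\to[0,\infty)^d$, equipped with the $\sigma$-field $\mathcal C$ generated by the projection maps $f\mapsto f(t)$, $t\in T_0$ (this is the Borel $\sigma$-field of a Polish topology on $C$). The shift is $B^hf(t)=f(t-h)$, $h,t\in\mathcal T$. Max-stable process and spectral process: let $\alpha>0$ and let $\boldsymbol Z(t)=(Z_1(t),\ldots,Z_d(t))$, $t\in\mathcal T$, be a random process with sample paths in $C$. $\boldsymbol Z$ is called a spectral process of (or for) the max-stable process $\boldsymbol X$ with index $\alpha$ if $\boldsymbol X$ has the same law as $$\max_{i\ge1}\Gamma_i^{-1/\alpha}\boldsymbol Z^{(i)}(t),\quad t\in\mathcal T\quad(\text{componentwise maximum}),$$ where $\Gamma_i=\sum_{k=1}^iE_k$ with $E_k$, $k\ge1$, independent unit exponential random variables, independent of $\boldsymbol Z^{(i)}$, $i\ge1$, which are independent copies of $\boldsymbol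 Z$. Fréchet marginals means that each $X_k(t)$ has distribution function $x\mapsto\exp(-a x^{-\alpha})$, $x>0$, with $a=\mathbb E\{Z_k^\alpha(t)\}\in(0,\infty)$. $E_0$ is the class of all measurable maps $\Gamma:C\to[0,\infty]$ that are $0$-homogeneous, i.e. $\Gamma(cf)=\Gamma(f)$ for all $c>0$, $f\in C$. Tilted process: $\boldsymbol\Theta^{[h]}$, $h\in\mathcal T$, is a random process with sample paths in $C$ whose law is $$\mathbb P\{\boldsymbol\Theta^{[h]}\in A\}=\frac{1}{\mathbb E\{\|\boldsymbol Z(h)\|^\alpha\}}\mathbb E\bigl\{\|\boldsymbol Z(h)\|^\alpha\,\mathbb I(\boldsymbol Z/\|\boldsymbol Z(h)\|\in A)\bigr\},\quad A\in\mathcal C,$$ where $\mathbb I$ denotes the indicator function. Expressions multiplied by $\|\boldsymbol Z(h)\|^\alpha$ (respectively $Z_k^\alpha(h)$) are taken as $0$ when $\|\boldsymbol Z(h)\|=0$ (respectively $Z_k(h)=0$). In (i), $W$ is independent of $\boldsymbol\Theta$. *)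

theory Defs
  imports "HOL-Probability.Probability"
begin

text \<open>
  Time is \<open>real ^ 'p\<close>, states are \<open>real ^ 'd\<close>; a process on \<open>M\<close> is a map
  \<open>\<omega> \<mapsto> (t \<mapsto> X \<omega> t)\<close>.
\<close>

definition is_norm :: "(real ^ 'd \<Rightarrow> real) \<Rightarrow> bool" where
  "is_norm nrm \<longleftrightarrow>
     (\<forall>x. 0 \<le> nrm x) \<and> (\<forall>x. nrm x = 0 \<longleftrightarrow> x = 0) \<and>
     (\<forall>c x. nrm (c *\<^sub>R x) = \<bar>c\<bar> * nrm x) \<and>
     (\<forall>x y. nrm (x + y) \<le> nrm x + nrm y)"

definition T0 :: "(real ^ 'p) set" where
  "T0 = {t. \<forall>i. t $ i \<in> \<rat>}"

definition Cpaths :: "(real ^ 'p \<Rightarrow> real ^ 'd) set" where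
  "Cpaths = {f. continuous_on UNIV f \<and> (\<forall>t k. 0 \<le> f t $ k)}"

definition Cspace :: "(real ^ 'p \<Rightarrow> real ^ 'd) measure" where
  "Cspace = sigma Cpaths {{f \<in> Cpaths. f t \<in> B} | t B. t \<in> T0 \<and> B \<in> sets borel}"

definition Bshift :: "real ^ 'p \<Rightarrow> (real ^ 'p \<Rightarrow> real ^ 'd) \<Rightarrow> (real ^ 'p \<Rightarrow> real ^ 'd)" where
  "Bshift h f = (\<lambda>t. f (t - h))"

definition stationary :: "'a measure \<Rightarrow> ('a \<Rightarrow> real ^ 'p \<Rightarrow> real ^ 'd) \<Rightarrow> bool" where
  "stationary M X \<longleftrightarrow>
     (\<forall>h. distr M Cspace (\<lambda>\<omega>. Bshift h (X \<omega>)) = distr M Cspace X)"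

text \<open>
  Joint law of independent unit exponentials \<open>E\<close> and independent copies \<open>Zs\<close> of \<open>Z\<close>,
  the two sequences being independent of each other.  Both are indexed from 0.
\<close>

definition dehaan_space ::
    "'b measure \<Rightarrow> ('b \<Rightarrow> real ^ 'p \<Rightarrow> real ^ 'd) \<Rightarrow>
     ((nat \<Rightarrow> real) \<times> (nat \<Rightarrow> real ^ 'p \<Rightarrow> real ^ 'd)) measure" where
  "dehaan_space N Z =
     (\<Pi>\<^sub>M i\<in>UNIV. density lborel (exponential_density 1)) \<Otimes>\<^sub>M
     (\<Pi>\<^sub>M i\<in>UNIV. distr N Cspace Z)"

text \<open>
  The maximum is a supremum in \<open>[0, \<infinity>]\<close>, so that it is meaningful (and measurable at each
  time) without knowing in advance that it is finite or has continuous paths.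
\<close>

definition dehaan_max ::
    "real \<Rightarrow> (nat \<Rightarrow> real) \<times> (nat \<Rightarrow> real ^ 'p \<Rightarrow> real ^ 'd) \<Rightarrow> real ^ 'p \<Rightarrow> 'd \<Rightarrow> ennreal" where
  "dehaan_max \<alpha> = (\<lambda>(E, Zs) t k.
     SUP i. ennreal ((\<Sum>j\<le>i. E j) powr (- 1 / \<alpha>) * Zs i t $ k))"

text \<open>
  Law of a \<open>[0, \<infinity>]\<close>-valued family indexed by time and component on the product
  \<open>\<sigma>\<close>-algebra: equality of such laws is equality of all finite-dimensional distributions.
\<close>

definition process_law ::
    "'a measure \<Rightarrow> ('a \<Rightarrow> real ^ 'p \<Rightarrow> 'd \<Rightarrow> ennreal) \<Rightarrow> ((real ^ 'p) \<times> 'd \<Rightarrow> ennreal) measure" where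
  "process_law M Y = distr M (\<Pi>\<^sub>M tk\<in>UNIV. borel) (\<lambda>\<omega> (t, k). Y \<omega> t k)"

text \<open>\<open>Z\<close> (defined on \<open>N\<close>) is a spectral process for \<open>X\<close> (defined on \<open>M\<close>) with index \<open>\<alpha>\<close>.\<close>

definition spectral_process ::
    "real \<Rightarrow> 'a measure \<Rightarrow> ('a \<Rightarrow> real ^ 'p \<Rightarrow> real ^ 'd) \<Rightarrow>
     'b measure \<Rightarrow> ('b \<Rightarrow> real ^ 'p \<Rightarrow> real ^ 'd) \<Rightarrow> bool" where
  "spectral_process \<alpha> M X N Z \<longleftrightarrow>
     prob_space N \<and> Z \<in> measurable N Cspace \<and>
     process_law M (\<lambda>\<omega> t k. ennreal (X \<omega> t $ k)) =
     process_law (dehaan_space N Z) (dehaan_max \<alpha>)"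

definition frechet_marginals ::
    "real \<Rightarrow> 'a measure \<Rightarrow> ('a \<Rightarrow> real ^ 'p \<Rightarrow> real ^ 'd) \<Rightarrow>
     'b measure \<Rightarrow> ('b \<Rightarrow> real ^ 'p \<Rightarrow> real ^ 'd) \<Rightarrow> bool" where
  "frechet_marginals \<alpha> M X N Z \<longleftrightarrow>
     (\<forall>t k. \<exists>a>0. (\<integral>\<^sup>+\<omega>. ennreal ((Z \<omega> t $ k) powr \<alpha>) \<partial>N) = ennreal a \<and>
        (\<forall>x>0. cdf (distr M borel (\<lambda>\<omega>. X \<omega> t $ k)) x = exp (- a * x powr (- \<alpha>))))"

definition E0 :: "((real ^ 'p \<Rightarrow> real ^ 'd) \<Rightarrow> ennreal) set" where
  "E0 = {\<Gamma> \<in> borel_measurable Cspace. \<forall>c>0. \<forall>f\<in>Cpaths. \<Gamma> (\<lambda>t. c *\<^sub>R f t) = \<Gamma> f}"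

text \<open>
  Laws of the tilted processes.  Where the normalising value \<open>nrm (Z \<omega> h)\<close> (or \<open>Z \<omega> h $ k\<close>) is 0,
  the density is \<open>0 powr \<alpha> = 0\<close> and the rescaled path is the zero path, which is in \<open>Cpaths\<close>.
\<close>

definition tilted_law ::
    "(real ^ 'd \<Rightarrow> real) \<Rightarrow> real \<Rightarrow> 'b measure \<Rightarrow> ('b \<Rightarrow> real ^ 'p \<Rightarrow> real ^ 'd) \<Rightarrow>
     real ^ 'p \<Rightarrow> (real ^ 'p \<Rightarrow> real ^ 'd) measure" where
  "tilted_law nrm \<alpha> N Z h =
     distr
       (density N (\<lambda>\<omega>. ennreal (nrm (Z \<omega> h) powr \<alpha>) /
                       (\<integral>\<^sup>+\<omega>'. ennreal (nrm (Z \<omega>' h) powr \<alpha>) \<partial>N)))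
       Cspace (\<lambda>\<omega> t. Z \<omega> t /\<^sub>R nrm (Z \<omega> h))"

definition tilted_comp_law ::
    "real \<Rightarrow> 'b measure \<Rightarrow> ('b \<Rightarrow> real ^ 'p \<Rightarrow> real ^ 'd) \<Rightarrow>
     real ^ 'p \<Rightarrow> 'd \<Rightarrow> (real ^ 'p \<Rightarrow> real ^ 'd) measure" where
  "tilted_comp_law \<alpha> N Z h k =
     (if (\<integral>\<^sup>+\<omega>. ennreal ((Z \<omega> h $ k) powr \<alpha>) \<partial>N) = 0
      then return Cspace (\<lambda>t. \<chi> i. 1)
      else distr
             (density N (\<lambda>\<omega>. ennreal ((Z \<omega> h $ k) powr \<alpha>) /
                             (\<integral>\<^sup>+\<omega>'. ennreal ((Z \<omega>' h $ k) powr \<alpha>) \<partial>N)))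
             Cspace (\<lambda>\<omega> t. Z \<omega> t /\<^sub>R (Z \<omega> h $ k)))"

text \<open>
  The path of \<open>Z\<^sub>W\<close> built from a value \<open>w\<close> of \<open>W\<close> and a path \<open>\<theta>\<close> of \<open>\<Theta>\<close>.  If the series
  diverges, \<open>infsum\<close> is 0 and the result is the zero path, in agreement with \<open>1 / \<infinity> = 0\<close>.
\<close>

definition Z_W ::
    "(real ^ 'd \<Rightarrow> real) \<Rightarrow> real \<Rightarrow> (real ^ 'p) pmf \<Rightarrow>
     (real ^ 'p) \<times> (real ^ 'p \<Rightarrow> real ^ 'd) \<Rightarrow> real ^ 'p \<Rightarrow> real ^ 'd" where
  "Z_W nrm \<alpha> W = (\<lambda>(w, \<theta>) t.
     \<theta> (t - w) /\<^sub>R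
       (\<Sum>\<^sub>\<infinity>s\<in>T0. nrm (\<theta> (s - w)) powr \<alpha> * pmf W s) powr (1 / \<alpha>))"

end

theory Submission
  imports Defs
begin

text \<open>
  Exceedances of a Poisson process: the probability that all points \<open>\<Gamma>\<^sub>i\<^bsup>-1/\<alpha>\<^esup> Z\<^sup>(\<^sup>i\<^sup>)\<close> stay below a
  level is \<open>exp (- E V)\<close>, where \<open>V\<close> is a weighted maximum of finitely many
  \<open>Z\<^sub>k(t)\<^sup>\<alpha>\<close>.  So the law of \<open>X\<close> and the expectations of these maxima determine each other.
  Differentiating \<open>E max (c Z\<^sub>k(h)\<^sup>\<alpha>, V)\<close> in \<open>c\<close> shows that they also determine
  \<open>E (Z\<^sub>k(h)\<^sup>\<alpha> \<Gamma>(Z))\<close> for all 0-homogeneous \<open>\<Gamma>\<close>, which turns stationarity into (ii);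
  conversely a maximum is the sum of its terms weighted by 0-homogeneous argmax indicators.

  (iii) differs from (ii) by the normalising constants \<open>E Z\<^sub>k(h)\<^sup>\<alpha>\<close>.  They do not depend on \<open>h\<close>:
  by (iii) their ratios form a locally multiplicative function of \<open>h\<close>, and this function is bounded
  because all norms on a finite-dimensional space are equivalent.

  For (i), tilting at \<open>0\<close>, shifting by \<open>W\<close> and dividing by the normaliser cancel in expectation when (ii) holds.
  Conversely, replacing \<open>W\<close> by \<open>W + q\<close> with rational \<open>q\<close> shifts \<open>Z\<^sub>W\<close> by \<open>q\<close>, so the expected maxima
  are invariant under rational shifts; being lower semicontinuous in the shift, they are invariant under all.
\<close>

section \<open>Exceedances over exponential partial sums\<close>

text \<open>Every condition is rewritten as a property of the law P of Z on path space, so that X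
  disappears. Expected maxima are finite-dimensional data, while (ii) concerns every measurable
  0-homogeneous functional. The link is that the right derivative of E max(c a, V) at c = 1 is E(a;
  V \<le> a): with a = Z_k(h)^\<alpha> this is the mass that the law tilted by a gives to a box of
  rescaled paths, and boxes generate the \<sigma>-field. In (iii) the obstacle is that Z_k may
  vanish: the events of being positive at two distant times can be disjoint, which leaves nothing to
  compare. For nearby times continuity of the paths forces an overlap, whence multiplicativity is
  local. Boundedness then rules out exponential growth in any direction. In (i), only rational
  translations preserve the support of W. No majorant over shifts near h is at hand, so Fatou gives
  one inequality only; the other comes from applying it near 0 instead of near h. The hypothesis on
  the supremum of the norm of Z enters here: it keeps the normaliser from vanishing.\<close>

abbreviation unit_exp :: "real measure" where
  "unit_exp \<equiv> density lborel (exponential_density 1)"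

lemma prob_space_unit_exp: "prob_space unit_exp"
  by (rule prob_space_exponential_density) simp

lemma AE_unit_exp_pos: "AE e in unit_exp. 0 < e"
proof -
  have "AE e in lborel. e \<noteq> (0::real)"
    by (rule AE_lborel_singleton)
  then show ?thesis
    by (subst AE_density) (auto simp: exponential_density_def)
qed

lemma emeasure_unit_exp_less:
  assumes "0 \<le> S"
  shows "emeasure unit_exp {..<S} \<le> ennreal (1 - exp (- S))"
proof -
  have "emeasure unit_exp {..<S} \<le> emeasure unit_exp {..S}"
    by (rule emeasure_mono) auto
  also have "\<dots> = ennreal (1 - exp (- S))"
    using emeasure_erlang_density[of 1 0 S] assms by (simp add: erlang_CDF_def)
  finally show ?thesis .
qed

text \<open>
  Let \<open>V\<^sub>i\<close> be independent with law \<open>p\<close> on the finite set \<open>A\<close>, and let \<open>u n s\<close> be the probability that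
  \<open>V\<^sub>i \<le> s + \<Gamma>\<^sub>i\<close> for all \<open>i < n\<close>.  Conditioning on the first exponential gives \<open>u (n + 1) = T (u n)\<close>
  with \<open>T g s = E (F (s + e) g (s + e))\<close>.  The function \<open>v s = exp (- E max (V - s, 0))\<close> is a fixed point of
  \<open>T\<close>, and \<open>T\<close> contracts towards it because \<open>v = 1\<close> beyond the largest atom \<open>S\<close>, where no error
  remains, and \<open>e < S\<close> only has probability \<open>1 - exp (- S)\<close>.
\<close>

context
  fixes A :: "real set" and p :: "real \<Rightarrow> real"
  assumes fin: "finite A" and p_nonneg: "\<And>x. 0 \<le> p x" and p_sum: "(\<Sum>x\<in>A. p x) = 1"
begin

private definition F where "F y = (\<Sum>x\<in>A. p x * of_bool (x \<le> y))"
private definition v where "v s = exp (- (\<Sum>x\<in>A. p x * max (x - s) 0))"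

private lemma F_bounds: "0 \<le> F y" "F y \<le> 1"
proof -
  show "0 \<le> F y" unfolding F_def by (intro sum_nonneg) (simp add: p_nonneg)
  have "F y \<le> (\<Sum>x\<in>A. p x)" unfolding F_def by (intro sum_mono) (simp add: p_nonneg)
  then show "F y \<le> 1" by (simp add: p_sum)
qed

private lemma v_bounds: "0 < v y" "v y \<le> 1"
  unfolding v_def by (simp_all add: sum_nonneg p_nonneg)

private lemma F_measurable [measurable]: "F \<in> borel_measurable borel"
  unfolding F_def by measurable

private lemma v_measurable [measurable]: "v \<in> borel_measurable borel"
  unfolding v_def by measurable

private lemma continuous_v: "continuous_on UNIV v"
  unfolding v_def by (intro continuous_intros)

text \<open>Each hinge \<open>max (x - s) 0\<close> has slope -1 to the left of x and 0 to the
  right. The weights of the atoms above y add up to \<open>1 - F y\<close>.\<close>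

private lemma v_deriv:
  assumes "y \<notin> A"
  shows "(v has_real_derivative ((1 - F y) * v y)) (at y)"
proof -
  have *: "((\<lambda>s. p x * max (x - s) 0) has_real_derivative (- p x * of_bool (y < x))) (at y)"
    if "x \<in> A" for x
  proof (cases "y < x")
    case True
    have "((\<lambda>s. p x * (x - s)) has_real_derivative (- p x * of_bool (y < x))) (at y)"
      using True by (auto intro!: derivative_eq_intros)
    moreover have "\<forall>\<^sub>F s in nhds y. s < x"
      using True by (rule order_tendstoD(2)[OF filterlim_ident])
    then have "\<forall>\<^sub>F s in nhds y. p x * (x - s) = p x * max (x - s) 0"
      by eventually_elim simp
    ultimately show ?thesis
      by (rule DERIV_cong_ev[OF refl _ refl, THEN iffD1, rotated])
  next
    case False
    with that assms have "x < y" by (metis linorder_neqE_linordered_idom)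
    have "((\<lambda>s. 0) has_real_derivative (- p x * of_bool (y < x))) (at y)"
      using False by (auto intro!: derivative_eq_intros)
    moreover have "\<forall>\<^sub>F s in nhds y. x < s"
      using \<open>x < y\<close> by (rule order_tendstoD(1)[OF filterlim_ident])
    then have "\<forall>\<^sub>F s in nhds y. p x * max (x - s) 0 = 0"
      by eventually_elim simp
    ultimately show ?thesis
      by (subst DERIV_cong_ev[OF refl _ refl])
  qed
  have "((\<lambda>s. - (\<Sum>x\<in>A. p x * max (x - s) 0)) has_real_derivative
      - (\<Sum>x\<in>A. - p x * of_bool (y < x))) (at y)"
    by (intro DERIV_minus DERIV_sum *)
  also have "- (\<Sum>x\<in>A. - p x * of_bool (y < x)) = (\<Sum>x\<in>A. p x) - F y"
    unfolding F_def sum_negf[symmetric] sum_subtractf[symmetric]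
    by (intro sum.cong) auto
  finally show ?thesis
    using DERIV_fun_exp unfolding v_def p_sum by (fastforce simp: mult.commute)
qed

text \<open>By \<open>v_deriv\<close> the integrand against the exponential density is the
  derivative of \<open>- exp (- y) * v (s + y)\<close>, which runs from \<open>- v s\<close> at 0 to
  0 at infinity.\<close>

private lemma v_fixed_point: "(\<integral>\<^sup>+e. ennreal (F (s + e) * v (s + e)) \<partial>unit_exp) = ennreal (v s)"
proof -
  let ?\<Phi> = "\<lambda>y. - exp (- y) * v (s + y)"
  let ?f = "\<lambda>y. exp (- y) * (F (s + y) * v (s + y))"
  \<comment> \<open>F jumps at the atoms, so the antiderivative is differentiable only off the
    finitely many shifted atoms, where its continuity is enough.\<close>
  have fin': "finite ((\<lambda>x. x - s) ` A)" using fin by simp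
  have hi: "(?f has_integral (?\<Phi> b - ?\<Phi> 0)) {0..b}" if "0 \<le> b" for b
  proof (rule fundamental_theorem_of_calculus_strong[OF fin' that])
    fix y assume "y \<in> {0..b} - (\<lambda>x. x - s) ` A"
    then have "s + y \<notin> A" by force
    then have "((\<lambda>y. v (s + y)) has_real_derivative ((1 - F (s + y)) * v (s + y))) (at y)"
      using v_deriv[of "s + y"] DERIV_shift[of v _ y s] by (simp add: add.commute[of s])
    then have "(?\<Phi> has_real_derivative ?f y) (at y)"
      by (auto intro!: derivative_eq_intros simp: algebra_simps)
    then show "(?\<Phi> has_vector_derivative ?f y) (at y)"
      by (simp add: has_real_derivative_iff_has_vector_derivative)
  next
    show "continuous_on {0..b} ?\<Phi>"
      by (intro continuous_intros continuous_on_compose2[OF continuous_v]) auto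
  qed
  have nn: "(\<integral>\<^sup>+y. ennreal (?f y) * indicator {0..real n} y \<partial>lborel) = ennreal (?\<Phi> n - ?\<Phi> 0)" for n
    using hi[of "real n"]
    by (intro nn_integral_has_integral_lebesgue') (auto simp: F_bounds less_imp_le[OF v_bounds(1)])
  have inc: "incseq (\<lambda>n y. ennreal (?f y) * indicator {0..real n} y)"
    by (auto simp: incseq_def le_fun_def indicator_def)
  have sup: "(SUP n. ennreal (?f y) * indicator {0..real n} y) = ennreal (?f y) * indicator {0..} y" for y
  proof (rule antisym)
    show "(SUP n. ennreal (?f y) * indicator {0..real n} y) \<le> ennreal (?f y) * indicator {0..} y"
      by (intro SUP_least) (auto simp: indicator_def)
    obtain n where "y \<le> real n" using real_arch_simple by blast
    then show "ennreal (?f y) * indicator {0..} y \<le> (SUP n. ennreal (?f y) * indicator {0..real n} y)"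
      by (intro SUP_upper2[of n]) (auto simp: indicator_def)
  qed
  have "(\<integral>\<^sup>+e. ennreal (F (s + e) * v (s + e)) \<partial>unit_exp)
      = (\<integral>\<^sup>+y. ennreal (?f y) * indicator {0..} y \<partial>lborel)"
    by (subst nn_integral_density)
      (auto intro!: nn_integral_cong simp: exponential_density_def indicator_def ennreal_mult'[symmetric])
  also have "\<dots> = (SUP n. \<integral>\<^sup>+y. ennreal (?f y) * indicator {0..real n} y \<partial>lborel)"
    unfolding sup[symmetric] by (intro nn_integral_monotone_convergence_SUP inc) measurable
  also have "\<dots> = (SUP n. ennreal (?\<Phi> (real n) - ?\<Phi> 0))"
    by (simp only: nn)
  also have "\<dots> = ennreal (v s)"
  proof (rule LIMSEQ_unique)
    have "incseq (\<lambda>n. \<integral>\<^sup>+y. ennreal (?f y) * indicator {0..real n} y \<partial>lborel)"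
      using inc by (auto simp: incseq_def le_fun_def intro!: nn_integral_mono)
    then have "incseq (\<lambda>n. ennreal (?\<Phi> (real n) - ?\<Phi> 0))"
      by (simp only: nn)
    then show "(\<lambda>n. ennreal (?\<Phi> (real n) - ?\<Phi> 0)) \<longlonglongrightarrow> (SUP n. ennreal (?\<Phi> (real n) - ?\<Phi> 0))"
      by (rule LIMSEQ_SUP)
    have "(\<lambda>n. exp (- real n) * v (s + real n)) \<longlonglongrightarrow> 0"
    proof (rule tendsto_sandwich[OF _ _ tendsto_const])
      show "(\<lambda>n. exp (- real n)) \<longlonglongrightarrow> 0"
        by (rule filterlim_compose[OF exp_at_bot])
          (simp add: filterlim_uminus_at_bot filterlim_real_sequentially)
    qed (auto simp: less_imp_le[OF v_bounds(1)] v_bounds(2) mult_left_le)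
    from tendsto_diff[OF tendsto_const[of "v s"] this]
    show "(\<lambda>n. ennreal (?\<Phi> (real n) - ?\<Phi> 0)) \<longlonglongrightarrow> ennreal (v s)"
      by (intro tendsto_ennrealI) simp
  qed
  finally show ?thesis .
qed

private definition u where
  "u n s = (\<integral>\<^sup>+E. (\<Prod>i<n. ennreal (F (s + (\<Sum>j\<le>i. E j)))) \<partial>(\<Pi>\<^sub>M i\<in>(UNIV::nat set). unit_exp))"

private lemma u_measurable [measurable]: "u n \<in> borel_measurable borel"
proof -
  interpret sequence_space unit_exp
    by (simp add: sequence_space_def product_prob_space_def product_sigma_finite_def
        product_prob_space_axioms_def prob_space_unit_exp prob_space_imp_sigma_finite)
  show ?thesis
    unfolding u_def by measurable
qed

text \<open>\<open>PiM_iter\<close> splits off the first exponential e. It occurs in every partial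
  sum, so for the remaining ones it only moves the start from s to \<open>s + e\<close>.\<close>

private lemma u_Suc: "u (Suc n) s = (\<integral>\<^sup>+e. ennreal (F (s + e)) * u n (s + e) \<partial>unit_exp)"
proof -
  interpret sequence_space unit_exp
    by (simp add: sequence_space_def product_prob_space_def product_sigma_finite_def
        product_prob_space_axioms_def prob_space_unit_exp prob_space_imp_sigma_finite)
  have "u (Suc n) s = (\<integral>\<^sup>+E. (\<Prod>i<Suc n. ennreal (F (s + (\<Sum>j\<le>i. E j))))
      \<partial>distr (unit_exp \<Otimes>\<^sub>M S) S (\<lambda>(s, \<omega>). case_nat s \<omega>))"
    unfolding u_def PiM_iter ..
  also have "\<dots> = (\<integral>\<^sup>+x. (\<Prod>i<Suc n. ennreal (F (s + (\<Sum>j\<le>i. case_nat (fst x) (snd x) j))))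
      \<partial>(unit_exp \<Otimes>\<^sub>M S))"
    by (subst nn_integral_distr) (auto simp: case_prod_beta)
  also have "\<dots> = (\<integral>\<^sup>+e. \<integral>\<^sup>+E. (\<Prod>i<Suc n. ennreal (F (s + (\<Sum>j\<le>i. case_nat e E j)))) \<partial>S \<partial>unit_exp)"
    by (subst nn_integral_fst[symmetric]) (auto simp: case_prod_beta cong: nat.case_cong)
  also have "\<dots> = (\<integral>\<^sup>+e. ennreal (F (s + e)) * u n (s + e) \<partial>unit_exp)"
    unfolding u_def prod.lessThan_Suc_shift
    by (subst nn_integral_cmult[symmetric])
      (auto simp: sum.atMost_Suc_shift add.assoc simp del: sum.atMost_Suc)
  finally show ?thesis .
qed

private lemma u_le_1: "u n s \<le> 1"
proof -
  interpret E: prob_space "\<Pi>\<^sub>M i\<in>(UNIV::nat set). unit_exp"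
    by (intro prob_space_PiM prob_space_unit_exp)
  have "u n s \<le> (\<integral>\<^sup>+E. 1 \<partial>(\<Pi>\<^sub>M i\<in>(UNIV::nat set). unit_exp))"
    unfolding u_def by (intro nn_integral_mono prod_le_1) (simp add: F_bounds)
  then show ?thesis by (simp add: E.emeasure_space_1)
qed

text \<open>The iteration starts from the constant 1, which dominates v, and the operator is
  monotone with v as a fixed point.\<close>

private lemma v_le_u: "ennreal (v s) \<le> u n s"
proof (induction n arbitrary: s)
  case 0
  interpret E: prob_space "\<Pi>\<^sub>M i\<in>(UNIV::nat set). unit_exp"
    by (intro prob_space_PiM prob_space_unit_exp)
  show ?case by (simp add: u_def E.emeasure_space_1 v_bounds)
next
  case (Suc n)
  show ?case
    unfolding u_Suc v_fixed_point[symmetric]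
    by (intro nn_integral_mono) (auto simp: ennreal_mult F_bounds less_imp_le[OF v_bounds(1)] intro!: mult_left_mono Suc)
qed

private lemma u_le_v:
  assumes S: "\<And>x. x \<in> A \<Longrightarrow> x \<le> S" "0 \<le> S" and "0 \<le> s"
  shows "u n s \<le> ennreal (v s) + ennreal ((1 - exp (- S)) ^ n)"
  using \<open>0 \<le> s\<close>
proof (induction n arbitrary: s)
  case 0
  show ?case using u_le_1[of 0 s] by (simp add: order_trans)
next
  case (Suc n)
  have v1: "v y = 1" if "S \<le> y" for y
    using S(1) that unfolding v_def by (force intro!: sum.neutral)
  let ?q = "1 - exp (- S)"
  have "?q \<ge> 0" using S by simp
  have "u (Suc n) s \<le> (\<integral>\<^sup>+e. ennreal (F (s + e) * v (s + e)) + ennreal (?q ^ n) * indicator {..<S} e \<partial>unit_exp)"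
    unfolding u_Suc
  \<comment> \<open>The induction hypothesis needs a nonnegative starting point
    \<open>s + e\<close>, which is available only for almost every e.\<close>
  proof (rule nn_integral_mono_AE)
    show "AE e in unit_exp. ennreal (F (s + e)) * u n (s + e)
        \<le> ennreal (F (s + e) * v (s + e)) + ennreal (?q ^ n) * indicator {..<S} e"
      using AE_unit_exp_pos
    proof eventually_elim
      case (elim e)
      have "u n (s + e) \<le> ennreal (v (s + e)) + ennreal (?q ^ n) * indicator {..<S} e"
      proof (cases "e < S")
        case True
        then show ?thesis using Suc.IH[of "s + e"] Suc.prems elim by simp
      next
        case False
        then show ?thesis using u_le_1[of n "s + e"] v1[of "s + e"] Suc.prems by simp
      qed
      then have "ennreal (F (s + e)) * u n (s + e)
          \<le> ennreal (F (s + e)) * (ennreal (v (s + e)) + ennreal (?q ^ n) * indicator {..<S} e)"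
        by (rule mult_left_mono) simp
      also have "\<dots> \<le> ennreal (F (s + e)) * ennreal (v (s + e)) + 1 * (ennreal (?q ^ n) * indicator {..<S} e)"
        unfolding distrib_left by (intro add_left_mono mult_right_mono) (auto simp: F_bounds)
      finally show ?case by (simp add: ennreal_mult F_bounds less_imp_le[OF v_bounds(1)])
    qed
  qed
  also have "\<dots> = ennreal (v s) + ennreal (?q ^ n) * emeasure unit_exp {..<S}"
    by (subst nn_integral_add) (auto simp: v_fixed_point nn_integral_cmult_indicator)
  also have "\<dots> \<le> ennreal (v s) + ennreal (?q ^ n) * ennreal ?q"
    by (intro add_left_mono mult_left_mono emeasure_unit_exp_less S) simp
  also have "\<dots> = ennreal (v s) + ennreal (?q ^ Suc n)"
    using \<open>?q \<ge> 0\<close> by (simp add: ennreal_mult[symmetric] mult.commute)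
  finally show ?case .
qed

lemma exp_partial_sums_limit:
  assumes "\<And>x. x \<in> A \<Longrightarrow> 0 \<le> x"
  shows "(\<lambda>n. \<integral>\<^sup>+E. (\<Prod>i<n. ennreal (\<Sum>x\<in>A. p x * of_bool (x \<le> (\<Sum>j\<le>i. E j))))
      \<partial>(\<Pi>\<^sub>M i\<in>(UNIV::nat set). unit_exp)) \<longlonglongrightarrow> ennreal (exp (- (\<Sum>x\<in>A. p x * x)))"
proof -
  define S where "S = Max (insert 0 A)"
  have S: "\<And>x. x \<in> A \<Longrightarrow> x \<le> S" "0 \<le> S"
    using fin by (auto simp: S_def)
  have "(\<lambda>n. u n 0) \<longlonglongrightarrow> ennreal (v 0)"
  proof (rule tendsto_sandwich[OF _ _ tendsto_const])
    have "(\<lambda>n. (1 - exp (- S)) ^ n) \<longlonglongrightarrow> 0"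
      using S by (intro LIMSEQ_power_zero) simp
    then have "(\<lambda>n. ennreal (v 0) + ennreal ((1 - exp (- S)) ^ n)) \<longlonglongrightarrow> ennreal (v 0) + ennreal 0"
      by (intro tendsto_add tendsto_const tendsto_ennrealI)
    then show "(\<lambda>n. ennreal (v 0) + ennreal ((1 - exp (- S)) ^ n)) \<longlonglongrightarrow> ennreal (v 0)"
      by simp
  qed (auto simp: v_le_u u_le_v[OF S])
  moreover have "v 0 = exp (- (\<Sum>x\<in>A. p x * x))"
    unfolding v_def using assms by (auto intro!: sum.cong)
  ultimately show ?thesis
    by (simp add: u_def F_def)
qed

end

section \<open>From finitely many values to arbitrary spectral functionals\<close>

text \<open>exp(-a) for a in [0, \<infinity>]. The infinite case matters because an arbitrary
  candidate for a spectral process need not have finite moments. Injectivity is what lets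
  probabilities of boxes determine expected maxima.\<close>

definition exp_neg :: "ennreal \<Rightarrow> ennreal" where
  "exp_neg a = (if a = \<top> then 0 else ennreal (exp (- enn2real a)))"

lemma exp_neg_inject: "exp_neg a = exp_neg b \<longleftrightarrow> a = b"
proof
  assume eq: "exp_neg a = exp_neg b"
  show "a = b"
  proof (cases "a = \<top> \<or> b = \<top>")
    case True
    then show ?thesis using eq by (auto simp: exp_neg_def split: if_splits)
  next
    case False
    then have "enn2real a = enn2real b" using eq by (simp add: exp_neg_def)
    then show ?thesis using False by (metis ennreal_enn2real less_top)
  qed
qed simp

lemma exp_neg_tendsto_SUP:
  assumes "incseq a" and fin: "\<And>m. a m < \<top>"
  shows "(\<lambda>m. exp_neg (a m)) \<longlonglongrightarrow> exp_neg (SUP m. a m)"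
proof -
  have lim: "a \<longlonglongrightarrow> (SUP m. a m)" using assms(1) by (rule LIMSEQ_SUP)
  have e: "exp_neg (a m) = ennreal (exp (- enn2real (a m)))" for m
    using fin[of m] by (simp add: exp_neg_def)
  show ?thesis
  proof (cases "(SUP m. a m) = \<top>")
    case False
    have "(\<lambda>m. enn2real (a m)) \<longlonglongrightarrow> enn2real (SUP m. a m)"
    proof (rule tendsto_enn2real)
      show "a \<longlonglongrightarrow> ennreal (enn2real (SUP m. a m))" using lim False by (subst ennreal_enn2real) (simp_all only: less_top not_False_eq_True)
    qed simp
    then show ?thesis
      unfolding e using False by (auto simp: exp_neg_def intro!: tendsto_ennrealI tendsto_intros)
  next
    case True
    have "filterlim (\<lambda>m. enn2real (a m)) at_top sequentially"
      unfolding filterlim_at_top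
    proof
      fix Z :: real
      have "\<forall>\<^sub>F m in sequentially. ennreal Z < a m"
        by (rule order_tendstoD(1)[OF lim]) (simp only: True ennreal_less_top)
      then show "\<forall>\<^sub>F m in sequentially. Z \<le> enn2real (a m)"
      proof eventually_elim
        case (elim m)
        then have "ennreal Z \<le> ennreal (enn2real (a m))" using fin[of m] by simp
        then show ?case using enn2real_nonneg[of "a m"] by (auto simp: ennreal_le_iff2 simp del: enn2real_nonneg)
      qed
    qed
    then have "(\<lambda>m. exp (- enn2real (a m))) \<longlonglongrightarrow> 0"
      by (intro filterlim_compose[OF exp_at_bot]) (simp add: filterlim_uminus_at_bot)
    from tendsto_ennrealI[OF this] show ?thesis
      unfolding e True by (simp add: exp_neg_def)
  qed
qed

text \<open>Once the exponentials are fixed, the constraints concern separate independent copies, so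
  the probability factorises; Fubini does the rest.\<close>

lemma (in prob_space) exp_partial_sums_finite:
  fixes V :: "'a \<Rightarrow> ennreal"
  assumes [measurable]: "V \<in> borel_measurable M"
  defines "PE \<equiv> (\<Pi>\<^sub>M i\<in>(UNIV::nat set). unit_exp)" and "PM \<equiv> (\<Pi>\<^sub>M i\<in>(UNIV::nat set). M)"
  shows "emeasure (PE \<Otimes>\<^sub>M PM) {x \<in> space (PE \<Otimes>\<^sub>M PM). \<forall>i<n. V (snd x i) \<le> ennreal (\<Sum>j\<le>i. fst x j)}
    = (\<integral>\<^sup>+E. (\<Prod>i<n. emeasure M {z \<in> space M. V z \<le> ennreal (\<Sum>j\<le>i. E j)}) \<partial>PE)"
proof -
  interpret PM: product_prob_space "\<lambda>_. M" "UNIV :: nat set"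
    by unfold_locales
  have [measurable]: "(\<lambda>x. snd x i) \<in> measurable (PE \<Otimes>\<^sub>M PM) M" for i :: nat
    unfolding PM_def by measurable
  have [measurable]: "(\<lambda>x. fst x i) \<in> borel_measurable (PE \<Otimes>\<^sub>M PM)" for i :: nat
  proof -
    have "(\<lambda>x. x i) \<in> measurable PE unit_exp" unfolding PE_def by measurable
    then have "(\<lambda>x. x i) \<in> borel_measurable PE" by (simp cong: measurable_cong_sets)
    then show ?thesis by measurable
  qed
  interpret P: prob_space PM
    unfolding PM_def by (intro prob_space_PiM prob_space_axioms)
  let ?X = "{x \<in> space (PE \<Otimes>\<^sub>M PM). \<forall>i<n. V (snd x i) \<le> ennreal (\<Sum>j\<le>i. fst x j)}"
  have "emeasure (PE \<Otimes>\<^sub>M PM) ?X = (\<integral>\<^sup>+E. emeasure PM (Pair E -` ?X) \<partial>PE)"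
    by (rule P.emeasure_pair_measure_alt) measurable
  also have "\<dots> = (\<integral>\<^sup>+E. (\<Prod>i<n. emeasure M {z \<in> space M. V z \<le> ennreal (\<Sum>j\<le>i. E j)}) \<partial>PE)"
  proof (rule nn_integral_cong)
    fix E assume E: "E \<in> space PE"
    have "Pair E -` ?X = {x \<in> space PM. \<forall>i\<in>{..<n}. x i \<in> {z \<in> space M. V z \<le> ennreal (\<Sum>j\<le>i. E j)}}"
      using E by (auto simp: space_pair_measure PM_def space_PiM)
    then show "emeasure PM (Pair E -` ?X) = (\<Prod>i<n. emeasure M {z \<in> space M. V z \<le> ennreal (\<Sum>j\<le>i. E j)})"
      unfolding PM_def by (subst PM.emeasure_PiM_Collect[symmetric]) auto
  qed
  finally show ?thesis .
qed

lemma AE_PiM_unit_exp_sum_pos: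
  "AE E in (\<Pi>\<^sub>M i\<in>(UNIV::nat set). unit_exp). \<forall>i. 0 < (\<Sum>j\<le>i. E j)"
proof -
  have "AE E in (\<Pi>\<^sub>M i\<in>(UNIV::nat set). unit_exp). \<forall>i. 0 < E i"
    unfolding AE_all_countable
    by (intro allI AE_PiM_component prob_space_unit_exp AE_unit_exp_pos) simp
  then show ?thesis
    by eventually_elim (auto intro!: sum_pos)
qed

text \<open>A simple V has a law with finitely many atoms A and weights p, to which
  \<open>exp_partial_sums_limit\<close> applies. The full event is the decreasing limit of the
  events with n constraints.\<close>

lemma (in prob_space) exp_partial_sums_simple:
  fixes V :: "'a \<Rightarrow> ennreal"
  assumes simple: "simple_function M V" and fin: "\<And>z. V z < \<top>"
  shows "emeasure ((\<Pi>\<^sub>M i\<in>(UNIV::nat set). unit_exp) \<Otimes>\<^sub>M (\<Pi>\<^sub>M i\<in>(UNIV::nat set). M))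
      {x \<in> space ((\<Pi>\<^sub>M i\<in>(UNIV::nat set). unit_exp) \<Otimes>\<^sub>M (\<Pi>\<^sub>M i\<in>(UNIV::nat set). M)).
        \<forall>i. V (snd x i) \<le> ennreal (\<Sum>j\<le>i. fst x j)}
    = exp_neg (\<integral>\<^sup>+z. V z \<partial>M)"
    (is "emeasure (?PE \<Otimes>\<^sub>M ?PM) ?X = _")
proof -
  have [measurable]: "V \<in> borel_measurable M"
    using simple by (rule borel_measurable_simple_function)
  have [measurable]: "(\<lambda>x. fst x i) \<in> borel_measurable (?PE \<Otimes>\<^sub>M ?PM)" for i :: nat
  proof -
    have "(\<lambda>x. x i) \<in> measurable ?PE unit_exp" by measurable
    then have "(\<lambda>x. x i) \<in> borel_measurable ?PE" by (simp cong: measurable_cong_sets)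
    then show ?thesis by measurable
  qed
  interpret PP: pair_prob_space ?PE ?PM
    unfolding pair_prob_space_def pair_sigma_finite_def
    by (intro conjI prob_space_imp_sigma_finite prob_space_PiM prob_space_unit_exp prob_space_axioms)
  define A where "A = enn2real ` V ` space M"
  define p where "p x = measure M {z \<in> space M. V z = ennreal x}" for x
  have finA: "finite A" using simple unfolding A_def by (auto dest: simple_functionD)
  have A_nonneg: "x \<ge> 0" if "x \<in> A" for x using that by (auto simp: A_def)
  have V_A: "enn2real (V z) \<in> A" if "z \<in> space M" for z using that by (auto simp: A_def)
  have V_eq: "V z = ennreal x \<longleftrightarrow> x = enn2real (V z)" if "x \<in> A" for x z
    using fin[of z] A_nonneg[OF that] by auto
  have V_le: "V z \<le> ennreal y \<longleftrightarrow> enn2real (V z) \<le> y" if "0 \<le> y" for y z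
  proof -
    have "V z \<le> ennreal y \<longleftrightarrow> ennreal (enn2real (V z)) \<le> ennreal y" using fin[of z] by simp
    then show ?thesis using that by (simp add: ennreal_le_iff)
  qed
  \<comment> \<open>The change of variables to the finite law of V. With g = 1, a step function and
    the identity it gives total mass, distribution function and mean.\<close>
  have sum_p: "(\<Sum>x\<in>A. ennreal (g x) * ennreal (p x)) = (\<integral>\<^sup>+z. ennreal (g (enn2real (V z))) \<partial>M)"
    for g :: "real \<Rightarrow> real"
  proof -
    have "(\<integral>\<^sup>+z. ennreal (g (enn2real (V z))) \<partial>M)
        = (\<integral>\<^sup>+z. (\<Sum>x\<in>A. ennreal (g x) * indicator {z \<in> space M. V z = ennreal x} z) \<partial>M)"
    proof (rule nn_integral_cong)
      fix z assume z: "z \<in> space M"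
      have "(\<Sum>x\<in>A. ennreal (g x) * indicator {z \<in> space M. V z = ennreal x} z)
          = (\<Sum>x\<in>A. if x = enn2real (V z) then ennreal (g x) else 0)"
        using z by (intro sum.cong) (auto simp: V_eq indicator_def)
      then show "ennreal (g (enn2real (V z))) = (\<Sum>x\<in>A. ennreal (g x) * indicator {z \<in> space M. V z = ennreal x} z)"
        using finA V_A[OF z] by simp
    qed
    also have "\<dots> = (\<Sum>x\<in>A. \<integral>\<^sup>+z. ennreal (g x) * indicator {z \<in> space M. V z = ennreal x} z \<partial>M)"
      by (rule nn_integral_sum) measurable
    also have "\<dots> = (\<Sum>x\<in>A. ennreal (g x) * ennreal (p x))"
      by (intro sum.cong refl) (simp add: nn_integral_cmult_indicator p_def emeasure_eq_measure)
    finally show ?thesis ..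
  qed
  have p1: "(\<Sum>x\<in>A. p x) = 1"
  proof -
    have "ennreal (\<Sum>x\<in>A. p x) = 1"
      using sum_p[of "\<lambda>_. 1"] by (simp add: p_def emeasure_space_1)
    then show ?thesis by (simp add: p_def sum_nonneg)
  qed
  have F: "emeasure M {z \<in> space M. V z \<le> ennreal y} = ennreal (\<Sum>x\<in>A. p x * of_bool (x \<le> y))"
    if "0 \<le> y" for y
  proof -
    have "emeasure M {z \<in> space M. V z \<le> ennreal y} = (\<integral>\<^sup>+z. indicator {z \<in> space M. V z \<le> ennreal y} z \<partial>M)"
      by simp
    also have "\<dots> = (\<integral>\<^sup>+z. ennreal (of_bool (enn2real (V z) \<le> y)) \<partial>M)"
      by (intro nn_integral_cong) (simp add: indicator_def V_le[OF that])
    also have "\<dots> = (\<Sum>x\<in>A. ennreal (of_bool (x \<le> y)) * ennreal (p x))"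
      by (rule sum_p[symmetric])
    also have "\<dots> = ennreal (\<Sum>x\<in>A. p x * of_bool (x \<le> y))"
      by (subst sum_ennreal[symmetric]) (auto simp: p_def ennreal_mult'[symmetric] mult.commute intro!: sum.cong)
    finally show ?thesis .
  qed
  have int: "(\<integral>\<^sup>+z. V z \<partial>M) = ennreal (\<Sum>x\<in>A. p x * x)"
  proof -
    have "(\<integral>\<^sup>+z. V z \<partial>M) = (\<integral>\<^sup>+z. ennreal (enn2real (V z)) \<partial>M)"
      using fin by (intro nn_integral_cong) simp
    also have "\<dots> = (\<Sum>x\<in>A. ennreal x * ennreal (p x))"
      by (rule sum_p[of "\<lambda>x. x", symmetric])
    also have "\<dots> = ennreal (\<Sum>x\<in>A. p x * x)"
      by (subst sum_ennreal[symmetric])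
        (auto simp: p_def ennreal_mult'[symmetric] mult.commute A_nonneg intro!: sum.cong)
    finally show ?thesis .
  qed
  let ?X' = "\<lambda>n. {x \<in> space (?PE \<Otimes>\<^sub>M ?PM). \<forall>i<n. V (snd x i) \<le> ennreal (\<Sum>j\<le>i. fst x j)}"
  have "emeasure (?PE \<Otimes>\<^sub>M ?PM) (?X' n)
      = (\<integral>\<^sup>+E. (\<Prod>i<n. ennreal (\<Sum>x\<in>A. p x * of_bool (x \<le> (\<Sum>j\<le>i. E j)))) \<partial>?PE)" for n
    unfolding exp_partial_sums_finite[OF \<open>V \<in> borel_measurable M\<close>]
  proof (rule nn_integral_cong_AE)
    \<comment> \<open>The formula F for the distribution function holds only at nonnegative levels,
      since \<open>ennreal\<close> truncates negative ones at 0; the partial sums are almost surely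
      positive.\<close>
    show "AE E in ?PE. (\<Prod>i<n. emeasure M {z \<in> space M. V z \<le> ennreal (\<Sum>j\<le>i. E j)})
        = (\<Prod>i<n. ennreal (\<Sum>x\<in>A. p x * of_bool (x \<le> (\<Sum>j\<le>i. E j))))"
      using AE_PiM_unit_exp_sum_pos
      by eventually_elim (auto intro!: prod.cong F less_imp_le)
  qed
  then have "(\<lambda>n. emeasure (?PE \<Otimes>\<^sub>M ?PM) (?X' n)) \<longlonglongrightarrow> ennreal (exp (- (\<Sum>x\<in>A. p x * x)))"
    using exp_partial_sums_limit[OF finA _ p1] A_nonneg by (simp add: p_def)
  moreover have "(\<lambda>n. emeasure (?PE \<Otimes>\<^sub>M ?PM) (?X' n)) \<longlonglongrightarrow> emeasure (?PE \<Otimes>\<^sub>M ?PM) (\<Inter>n. ?X' n)"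
    by (intro Lim_emeasure_decseq) (auto simp: decseq_def)
  moreover have "(\<Inter>n. ?X' n) = ?X" by auto
  moreover have "0 \<le> (\<Sum>x\<in>A. p x * x)"
    by (intro sum_nonneg) (simp add: p_def A_nonneg)
  ultimately show ?thesis
    by (auto simp: exp_neg_def int dest: LIMSEQ_unique)
qed

text \<open>Simple functions increasing to V give events decreasing to the event of V, because a
  supremum lies below a level exactly when all its members do. The means increase by monotone
  convergence, possibly to \<infinity>.\<close>

lemma (in prob_space) exp_partial_sums_exceed:
  fixes V :: "'a \<Rightarrow> ennreal"
  assumes V [measurable]: "V \<in> borel_measurable M"
  shows "emeasure ((\<Pi>\<^sub>M i\<in>(UNIV::nat set). unit_exp) \<Otimes>\<^sub>M (\<Pi>\<^sub>M i\<in>(UNIV::nat set). M))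
      {x \<in> space ((\<Pi>\<^sub>M i\<in>(UNIV::nat set). unit_exp) \<Otimes>\<^sub>M (\<Pi>\<^sub>M i\<in>(UNIV::nat set). M)).
        \<forall>i. V (snd x i) \<le> ennreal (\<Sum>j\<le>i. fst x j)}
    = exp_neg (\<integral>\<^sup>+z. V z \<partial>M)"
    (is "emeasure (?PE \<Otimes>\<^sub>M ?PM) ?X = _")
proof -
  have [measurable]: "(\<lambda>x. fst x i) \<in> borel_measurable (?PE \<Otimes>\<^sub>M ?PM)" for i :: nat
  proof -
    have "(\<lambda>x. x i) \<in> measurable ?PE unit_exp" by measurable
    then have "(\<lambda>x. x i) \<in> borel_measurable ?PE" by (simp cong: measurable_cong_sets)
    then show ?thesis by measurable
  qed
  interpret PP: pair_prob_space ?PE ?PM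
    unfolding pair_prob_space_def pair_sigma_finite_def
    by (intro conjI prob_space_imp_sigma_finite prob_space_PiM prob_space_unit_exp prob_space_axioms)
  obtain U where U: "\<And>m. simple_function M (U m)" "incseq U" "\<And>m z. U m z < \<top>"
    and sup: "\<And>z. (SUP m. U m z) = V z"
    using borel_measurable_implies_simple_function_sequence'[OF V] by blast
  have [measurable]: "U m \<in> borel_measurable M" for m
    using U(1) by (rule borel_measurable_simple_function)
  let ?Y = "\<lambda>m. {x \<in> space (?PE \<Otimes>\<^sub>M ?PM). \<forall>i. U m (snd x i) \<le> ennreal (\<Sum>j\<le>i. fst x j)}"
  have "(\<lambda>m. emeasure (?PE \<Otimes>\<^sub>M ?PM) (?Y m)) \<longlonglongrightarrow> emeasure (?PE \<Otimes>\<^sub>M ?PM) (\<Inter>m. ?Y m)"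
  proof (intro Lim_emeasure_decseq)
    show "decseq ?Y"
      using U(2) by (fastforce simp: decseq_def incseq_def le_fun_def intro: order_trans)
  qed auto
  moreover have "(\<Inter>m. ?Y m) = ?X"
    by (auto simp: sup[symmetric] SUP_le_iff)
  moreover have "(\<lambda>m. emeasure (?PE \<Otimes>\<^sub>M ?PM) (?Y m)) \<longlonglongrightarrow> exp_neg (\<integral>\<^sup>+z. V z \<partial>M)"
  proof -
    have "(\<integral>\<^sup>+z. U m z \<partial>M) < \<top>" for m
    proof -
      have "finite (U m ` space M)" using U(1) by (rule simple_functionD)
      then have "(\<integral>\<^sup>+z. U m z \<partial>M) \<le> (\<integral>\<^sup>+z. Max (insert 0 (U m ` space M)) \<partial>M)"
        by (intro nn_integral_mono) auto
      also have "\<dots> < \<top>"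
        using \<open>finite (U m ` space M)\<close> U(3) by (simp add: emeasure_space_1)
      finally show ?thesis .
    qed
    moreover have "incseq (\<lambda>m. \<integral>\<^sup>+z. U m z \<partial>M)"
      using U(2) by (auto simp: incseq_def le_fun_def intro!: nn_integral_mono)
    moreover have "(\<integral>\<^sup>+z. V z \<partial>M) = (SUP m. \<integral>\<^sup>+z. U m z \<partial>M)"
      unfolding sup[symmetric] by (intro nn_integral_monotone_convergence_SUP U) measurable
    ultimately show ?thesis
      unfolding exp_partial_sums_simple[OF U(1,3)] by (simp add: exp_neg_tendsto_SUP)
  qed
  ultimately show ?thesis
    by (auto dest: LIMSEQ_unique)
qed

section \<open>The path space\<close>

lemma space_Cspace [simp]: "space Cspace = Cpaths"
  unfolding Cspace_def by (rule space_measure_of) auto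

lemma countable_T0: "countable (T0 :: (real ^ 'p) set)"
proof -
  have "(T0 :: (real ^ 'p) set) = vec_lambda ` (\<Pi>\<^sub>E i\<in>(UNIV :: 'p set). \<rat>)"
  proof (intro set_eqI iffI)
    fix t :: "real ^ 'p" assume "t \<in> T0"
    then have "t = vec_lambda (vec_nth t)" "vec_nth t \<in> (\<Pi>\<^sub>E i\<in>(UNIV :: 'p set). \<rat>)"
      by (auto simp: T0_def)
    then show "t \<in> vec_lambda ` (\<Pi>\<^sub>E i\<in>(UNIV :: 'p set). \<rat>)" by (rule image_eqI)
  qed (auto simp: T0_def)
  then show ?thesis
    by (metis countable_image countable_PiE countable_rat finite_class.finite)
qed

lemma borel_measurable_vecI:
  fixes f :: "'a \<Rightarrow> real ^ 'n"
  assumes "\<And>k. (\<lambda>x. f x $ k) \<in> borel_measurable M"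
  shows "f \<in> borel_measurable M"
proof (subst borel_measurable_euclidean_space, rule ballI)
  fix b :: "real ^ 'n" assume "b \<in> Basis"
  then obtain k where "b = axis k 1" by (auto simp: Basis_vec_def)
  then show "(\<lambda>x. f x \<bullet> b) \<in> borel_measurable M"
    using assms[of k] by (simp add: inner_axis)
qed

lemma borel_measurable_vec_nth' [measurable (raw)]:
  fixes f :: "'a \<Rightarrow> real ^ 'n"
  assumes "f \<in> borel_measurable M"
  shows "(\<lambda>x. f x $ k) \<in> borel_measurable M"
  using assms by (rule borel_measurable_continuous_on[rotated]) (intro continuous_intros)

lemma measurable_eval_T0:
  assumes "t \<in> T0"
  shows "(\<lambda>f. f t) \<in> borel_measurable (Cspace :: (real ^ 'p \<Rightarrow> real ^ 'd) measure)"
proof (rule measurableI)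
  fix B :: "(real ^ 'd) set" assume "B \<in> sets borel"
  with assms show "(\<lambda>f. f t) -` B \<inter> space (Cspace :: (real ^ 'p \<Rightarrow> real ^ 'd) measure) \<in> sets Cspace"
    unfolding space_Cspace unfolding Cspace_def
    by (intro in_measure_of) auto
qed simp

lemma measurable_CspaceI:
  fixes X :: "'a \<Rightarrow> real ^ 'p \<Rightarrow> real ^ 'd"
  assumes "\<And>\<omega>. \<omega> \<in> space M \<Longrightarrow> X \<omega> \<in> Cpaths"
    and "\<And>t. t \<in> T0 \<Longrightarrow> (\<lambda>\<omega>. X \<omega> t) \<in> borel_measurable M"
  shows "X \<in> measurable M Cspace"
  unfolding Cspace_def
proof (rule measurable_measure_of)
  fix A assume "A \<in> {{f \<in> Cpaths. f t \<in> B} | t (B :: (real ^ 'd) set). t \<in> (T0 :: (real ^ 'p) set) \<and> B \<in> sets borel}"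
  then obtain t and B :: "(real ^ 'd) set" where tB: "A = {f \<in> Cpaths. f t \<in> B}" "t \<in> T0" "B \<in> sets borel"
    by blast
  have "X -` A \<inter> space M = (\<lambda>\<omega>. X \<omega> t) -` B \<inter> space M"
    using assms(1) by (auto simp: tB)
  with measurable_sets[OF assms(2)[OF tB(2)] tB(3)] show "X -` A \<inter> space M \<in> sets M" by simp
qed (use assms(1) in auto)

text \<open>Rounding down to multiples of \<open>1 / Suc n\<close>. The \<sigma>-field on paths
  knows only rational times; these countably-valued approximations of the time extend measurability
  to all times by continuity, and later carry rational shifts to real ones.\<close>

definition grid :: "nat \<Rightarrow> real ^ 'p \<Rightarrow> real ^ 'p" where
  "grid n t = (\<chi> i. of_int \<lfloor>real (Suc n) * t $ i\<rfloor> / real (Suc n))"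

lemma grid_in_T0: "grid n t \<in> T0"
  by (simp add: grid_def T0_def)

lemma grid_tendsto: "(\<lambda>n. grid n t) \<longlonglongrightarrow> t"
proof (rule vec_tendstoI)
  fix i
  have "(\<lambda>n. t $ i - 1 / real (Suc n)) \<longlonglongrightarrow> t $ i - 0"
    by (intro tendsto_diff tendsto_const LIMSEQ_Suc lim_1_over_n)
  then have lower: "(\<lambda>n. t $ i - 1 / real (Suc n)) \<longlonglongrightarrow> t $ i" by simp
  show "(\<lambda>n. grid n t $ i) \<longlonglongrightarrow> t $ i"
  proof (rule tendsto_sandwich[OF _ _ lower tendsto_const])
    show "\<forall>\<^sub>F n in sequentially. t $ i - 1 / real (Suc n) \<le> grid n t $ i"
    proof (rule always_eventually, rule allI)
      fix n
      have "real (Suc n) * t $ i - 1 \<le> of_int \<lfloor>real (Suc n) * t $ i\<rfloor>" by linarith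
      then have "(real (Suc n) * t $ i - 1) / real (Suc n) \<le> of_int \<lfloor>real (Suc n) * t $ i\<rfloor> / real (Suc n)"
        by (intro divide_right_mono) auto
      then show "t $ i - 1 / real (Suc n) \<le> grid n t $ i"
        by (simp add: grid_def diff_divide_distrib del: of_nat_Suc)
    qed
    show "\<forall>\<^sub>F n in sequentially. grid n t $ i \<le> t $ i"
    proof (rule always_eventually, rule allI)
      fix n
      have "of_int \<lfloor>real (Suc n) * t $ i\<rfloor> \<le> real (Suc n) * t $ i" by linarith
      then show "grid n t $ i \<le> t $ i"
        by (simp add: grid_def divide_le_eq mult.commute del: of_nat_Suc)
    qed
  qed
qed

lemma grid_measurable: "grid n \<in> measurable borel (count_space (T0 :: (real ^ 'p) set))"
  unfolding measurable_count_space_eq_countable[OF countable_T0]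
proof (intro conjI ballI)
  have [measurable]: "grid n \<in> borel_measurable borel"
    unfolding grid_def by (rule borel_measurable_vecI) simp
  fix a :: "real ^ 'p" assume "a \<in> T0"
  have "grid n -` {a} \<inter> space borel \<in> sets borel"
    by (rule measurable_sets[of _ _ borel]) auto
  then show "grid n -` {a} \<inter> space borel \<in> sets borel" .
qed (simp add: grid_in_T0)

text \<open>Evaluation at a grid point takes countably many times and is therefore jointly
  measurable; continuous paths are its pointwise limits. Joint measurability is needed because times
  become random through W.\<close>

lemma measurable_eval_pair:
  "(\<lambda>x. snd x (fst x)) \<in> borel_measurable (borel \<Otimes>\<^sub>M (Cspace :: (real ^ 'p \<Rightarrow> real ^ 'd) measure))"
proof (rule borel_measurable_LIMSEQ_metric)
  fix n
  show "(\<lambda>x. snd x (grid n (fst x))) \<in> borel_measurable (borel \<Otimes>\<^sub>M (Cspace :: (real ^ 'p \<Rightarrow> real ^ 'd) measure))"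
  proof (rule measurable_compose_countable'[where I = T0 and f = "\<lambda>t x. snd x t" and g = "\<lambda>x. grid n (fst x)"])
    show "(\<lambda>x. snd x t) \<in> borel_measurable (borel \<Otimes>\<^sub>M (Cspace :: (real ^ 'p \<Rightarrow> real ^ 'd) measure))"
      if "t \<in> T0" for t
      by (rule measurable_compose[OF measurable_snd measurable_eval_T0[OF that]])
    show "(\<lambda>x. grid n (fst x)) \<in> measurable (borel \<Otimes>\<^sub>M (Cspace :: (real ^ 'p \<Rightarrow> real ^ 'd) measure)) (count_space T0)"
      by (rule measurable_compose[OF measurable_fst grid_measurable])
  qed (rule countable_T0)
next
  fix x :: "(real ^ 'p) \<times> (real ^ 'p \<Rightarrow> real ^ 'd)"
  assume "x \<in> space (borel \<Otimes>\<^sub>M (Cspace :: (real ^ 'p \<Rightarrow> real ^ 'd) measure))"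
  then have "continuous_on UNIV (snd x)"
    by (auto simp: space_pair_measure Cpaths_def)
  then have "isCont (snd x) (fst x)" by (simp add: continuous_on_eq_continuous_at)
  then show "(\<lambda>n. snd x (grid n (fst x))) \<longlonglongrightarrow> snd x (fst x)"
    by (rule isCont_tendsto_compose[OF _ grid_tendsto])
qed

lemma measurable_eval_compose [measurable (raw)]:
  assumes "X \<in> measurable M Cspace" "\<tau> \<in> borel_measurable M"
  shows "(\<lambda>\<omega>. X \<omega> (\<tau> \<omega>)) \<in> borel_measurable M"
  using measurable_compose[OF measurable_Pair[OF assms(2,1)] measurable_eval_pair] by simp

lemma measurable_eval [measurable]: "(\<lambda>f. f t) \<in> borel_measurable Cspace"
  by (rule measurable_eval_compose) auto

lemma Cpaths_continuous: "f \<in> Cpaths \<Longrightarrow> continuous_on UNIV f"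
  and Cpaths_nonneg: "f \<in> Cpaths \<Longrightarrow> 0 \<le> f t $ k"
  by (auto simp: Cpaths_def)

lemma Cpaths_scale: "f \<in> Cpaths \<Longrightarrow> 0 \<le> c \<Longrightarrow> (\<lambda>t. c *\<^sub>R f t) \<in> Cpaths"
  by (auto simp: Cpaths_def intro!: continuous_intros)

lemma Cpaths_Bshift: "f \<in> Cpaths \<Longrightarrow> Bshift h f \<in> Cpaths"
  by (auto simp: Cpaths_def Bshift_def intro!: continuous_on_compose2[of UNIV f] continuous_intros)

lemma Bshift_measurable [measurable]: "Bshift h \<in> measurable Cspace Cspace"
  by (rule measurable_CspaceI) (auto simp: Cpaths_Bshift, simp add: Bshift_def)

lemma measurable_scale [measurable (raw)]:
  assumes [measurable]: "X \<in> measurable M Cspace" "c \<in> borel_measurable M"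
    and "\<And>\<omega>. \<omega> \<in> space M \<Longrightarrow> 0 \<le> c \<omega>"
  shows "(\<lambda>\<omega> t. c \<omega> *\<^sub>R X \<omega> t) \<in> measurable M Cspace"
  using measurable_space[OF assms(1)] assms(3)
  by (intro measurable_CspaceI) (auto simp: Cpaths_scale)

lemma Bshift_Bshift: "Bshift g (Bshift h f) = Bshift (g + h) f"
  by (auto simp: Bshift_def algebra_simps)

lemma Bshift_0 [simp]: "Bshift 0 f = f"
  by (auto simp: Bshift_def)

section \<open>Uniqueness of measures from coordinate boxes\<close>

text \<open>The boxes form an intersection-stable generator. Levels are strictly positive because
  the exceedance formula involves \<open>x i powr (- \<alpha>)\<close>. The hypothesis
  \<open>gen\<close> says that the maps \<open>c i\<close> generate the \<sigma>-field of P, in a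
  form that fits both path space and product space.\<close>

lemma measure_eqI_boxes:
  fixes c :: "'i \<Rightarrow> 'a \<Rightarrow> ennreal"
  assumes "finite_measure P" and sets: "sets Q = sets P"
    and gen: "\<And>N. space N = space P \<Longrightarrow> (\<And>i. i \<in> I \<Longrightarrow> c i \<in> borel_measurable N) \<Longrightarrow> sets P \<subseteq> sets N"
    and meas: "\<And>i. i \<in> I \<Longrightarrow> c i \<in> borel_measurable P"
    and eq: "\<And>J x. finite J \<Longrightarrow> J \<subseteq> I \<Longrightarrow> (\<And>i. 0 < x i) \<Longrightarrow>
      emeasure P {\<omega> \<in> space P. \<forall>i\<in>J. c i \<omega> \<le> ennreal (x i)} =
      emeasure Q {\<omega> \<in> space P. \<forall>i\<in>J. c i \<omega> \<le> ennreal (x i)}"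
  shows "P = Q"
proof -
  interpret P: finite_measure P by fact
  define box where "box J x = {\<omega> \<in> space P. \<forall>i\<in>J. c i \<omega> \<le> ennreal (x i)}" for J and x :: "'i \<Rightarrow> real"
  define G where "G = {box J x | J x. finite J \<and> J \<subseteq> I \<and> (\<forall>i. 0 < x i)}"
  have G: "G \<subseteq> Pow (space P)" by (auto simp: G_def box_def)
  have box_G: "box J x \<in> G" if "finite J" "J \<subseteq> I" "\<And>i. 0 < x i" for J x
    using that by (auto simp: G_def)
  have G_sets: "G \<subseteq> sets P"
  proof
    fix A assume "A \<in> G"
    then obtain J x where A: "A = box J x" "finite J" "J \<subseteq> I" by (auto simp: G_def)
    have [measurable]: "i \<in> J \<Longrightarrow> c i \<in> borel_measurable P" for i using meas A(3) by auto
    show "A \<in> sets P" unfolding A box_def using A(2) by measurable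
  qed
  have "sets P \<subseteq> sets (sigma (space P) G)"
  proof (rule gen)
    show "space (sigma (space P) G) = space P" using G by (rule space_measure_of)
    fix i assume i: "i \<in> I"
    have le: "{\<omega> \<in> space P. c i \<omega> \<le> ennreal r} \<in> sets (sigma (space P) G)" if "0 < r" for r
    proof -
      have "{\<omega> \<in> space P. c i \<omega> \<le> ennreal r} = box {i} (\<lambda>_. r)" by (auto simp: box_def)
      then show ?thesis using box_G[of "{i}" "\<lambda>_. r"] i that G by (simp add: in_measure_of)
    qed
    show "c i \<in> borel_measurable (sigma (space P) G)"
    proof (rule borel_measurableI_le)
      fix y
      show "{\<omega> \<in> space (sigma (space P) G). c i \<omega> \<le> y} \<in> sets (sigma (space P) G)"
      proof (cases y)
        case (real r)
        \<comment> \<open>The level y may be 0, where no box is available, so it is approached from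
          above.\<close>
        have "c i \<omega> \<le> y \<longleftrightarrow> (\<forall>n. c i \<omega> \<le> ennreal (r + 1 / real (Suc n)))" for \<omega>
        proof
          assume "\<forall>n. c i \<omega> \<le> ennreal (r + 1 / real (Suc n))"
          moreover have "(\<lambda>n. ennreal (r + 1 / real (Suc n))) \<longlonglongrightarrow> ennreal (r + 0)"
            by (intro tendsto_ennrealI tendsto_add tendsto_const LIMSEQ_Suc lim_1_over_n)
          ultimately show "c i \<omega> \<le> y"
            unfolding real by (intro LIMSEQ_le_const[of _ "ennreal r"]) auto
        next
          assume "c i \<omega> \<le> y"
          moreover have "ennreal r \<le> ennreal (r + 1 / real (Suc n))" for n
            by (intro ennreal_leI) simp
          ultimately show "\<forall>n. c i \<omega> \<le> ennreal (r + 1 / real (Suc n))"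
            unfolding real by (blast intro: order_trans)
        qed
        then have "{\<omega> \<in> space (sigma (space P) G). c i \<omega> \<le> y} =
            (\<Inter>n. {\<omega> \<in> space P. c i \<omega> \<le> ennreal (r + 1 / real (Suc n))})"
          using G by (auto simp: space_measure_of)
        also have "\<dots> \<in> sets (sigma (space P) G)"
        proof (rule sets.countable_INT')
          have "{\<omega> \<in> space P. c i \<omega> \<le> ennreal (r + 1 / real (Suc n))} \<in> sets (sigma (space P) G)" for n
            by (rule le) (use real in \<open>auto intro: add_nonneg_pos\<close>)
          then show "(\<lambda>n. {\<omega> \<in> space P. c i \<omega> \<le> ennreal (r + 1 / real (Suc n))}) ` UNIV
              \<subseteq> sets (sigma (space P) G)" by blast
        qed auto
        finally show ?thesis .
      next
        case top
        then have "{\<omega> \<in> space (sigma (space P) G). c i \<omega> \<le> y} = space (sigma (space P) G)" by auto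
        then show ?thesis by (metis sets.top)
      qed
    qed
  qed
  with G_sets have sets_P: "sets P = sigma_sets (space P) G"
    using G by (auto simp: sets_measure_of intro: sets.sigma_sets_subset[THEN subsetD])
  show ?thesis
  proof (rule measure_eqI_generator_eq[where \<Omega> = "space P" and E = G and A = "\<lambda>_. space P"])
    show "Int_stable G"
    proof (rule Int_stableI)
      fix A B assume "A \<in> G" "B \<in> G"
      then obtain J x J' x' where A: "A = box J x" "finite J" "J \<subseteq> I" "\<And>i. 0 < x i"
        and B: "B = box J' x'" "finite J'" "J' \<subseteq> I" "\<And>i. 0 < x' i" by (auto simp: G_def)
      define z where "z i = (if i \<in> J then if i \<in> J' then min (x i) (x' i) else x i else x' i)" for i
      have min: "a \<le> ennreal (min r s) \<longleftrightarrow> a \<le> ennreal r \<and> a \<le> ennreal s" for a r s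
        by (cases "r \<le> s") (auto simp: min_def intro: order_trans[OF _ ennreal_leI])
      have "c i \<omega> \<le> ennreal (z i) \<longleftrightarrow> (i \<in> J \<longrightarrow> c i \<omega> \<le> ennreal (x i)) \<and> (i \<in> J' \<longrightarrow> c i \<omega> \<le> ennreal (x' i))"
        if "i \<in> J \<union> J'" for i \<omega>
        using that by (auto simp: z_def min)
      then have "A \<inter> B = box (J \<union> J') z"
        unfolding A B box_def by blast
      then show "A \<inter> B \<in> G"
        using A B box_G[of "J \<union> J'" z] by (auto simp: z_def)
    qed
    show "emeasure P A = emeasure Q A" if "A \<in> G" for A
      using that eq by (auto simp: G_def box_def)
    show "range (\<lambda>_. space P) \<subseteq> G"
      using box_G[of "{}" "\<lambda>_. 1"] by (auto simp: box_def)
  qed (use G sets_P sets in auto)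
qed

abbreviation coord :: "(real ^ 'p \<Rightarrow> real ^ 'd) \<Rightarrow> (real ^ 'p) \<times> 'd \<Rightarrow> real" where
  "coord f i \<equiv> f (fst i) $ snd i"

lemma Cspace_measure_eqI:
  fixes P Q :: "(real ^ 'p \<Rightarrow> real ^ 'd) measure"
  assumes "finite_measure P" and sP: "sets P = sets Cspace" and sQ: "sets Q = sets Cspace"
    and eq: "\<And>J x. finite J \<Longrightarrow> (\<And>i. 0 < x i) \<Longrightarrow>
      emeasure P {f \<in> Cpaths. \<forall>i\<in>J. coord f i \<le> x i} =
      emeasure Q {f \<in> Cpaths. \<forall>i\<in>J. coord f i \<le> x i}"
  shows "P = Q"
proof (rule measure_eqI_boxes[where I = UNIV and c = "\<lambda>i f. ennreal (coord f i)"])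
  have space: "space P = Cpaths" using sets_eq_imp_space_eq[OF sP] by simp
  show "sets P \<subseteq> sets N" if sp: "space N = space P"
    and m: "\<And>i. i \<in> UNIV \<Longrightarrow> (\<lambda>f. ennreal (coord f i)) \<in> borel_measurable N" for N
  proof -
    have "(\<lambda>f. f) \<in> measurable N (Cspace :: (real ^ 'p \<Rightarrow> real ^ 'd) measure)"
    proof (rule measurable_CspaceI)
      fix t
      have "(\<lambda>f. enn2real (ennreal (f t $ k))) \<in> borel_measurable N" for k
        using m[of "(t, k)"] by simp
      then have "(\<lambda>f. f t $ k) \<in> borel_measurable N" for k
        by (rule measurable_cong[THEN iffD1, rotated]) (simp add: sp space Cpaths_nonneg)
      then show "(\<lambda>f. f t) \<in> borel_measurable N" by (rule borel_measurable_vecI)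
    qed (simp add: sp space)
    from measurable_sets[OF this] have "A \<inter> space N \<in> sets N" if "A \<in> sets P" for A
      using that sP by simp
    then show ?thesis
      using sets.sets_into_space[of _ P] sp by (metis inf.orderE subsetI)
  qed
  show "(\<lambda>f. ennreal (coord f i)) \<in> borel_measurable P" for i
    unfolding measurable_cong_sets[OF sP refl] by measurable
  show "emeasure P {\<omega> \<in> space P. \<forall>i\<in>J. ennreal (coord \<omega> i) \<le> ennreal (x i)} =
      emeasure Q {\<omega> \<in> space P. \<forall>i\<in>J. ennreal (coord \<omega> i) \<le> ennreal (x i)}"
    if "finite J" "\<And>i. 0 < x i" for J x
    using eq[OF that] that(2) by (simp add: space ennreal_le_iff less_imp_le)
qed (use assms in auto)

lemma PiM_ennreal_measure_eqI:
  fixes P Q :: "('i \<Rightarrow> ennreal) measure"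
  assumes "finite_measure P" and sP: "sets P = sets (\<Pi>\<^sub>M i\<in>UNIV. borel)"
    and sQ: "sets Q = sets (\<Pi>\<^sub>M i\<in>UNIV. borel)"
    and eq: "\<And>J x. finite J \<Longrightarrow> (\<And>i. 0 < x i) \<Longrightarrow>
      emeasure P {f. \<forall>i\<in>J. f i \<le> ennreal (x i)} = emeasure Q {f. \<forall>i\<in>J. f i \<le> ennreal (x i)}"
  shows "P = Q"
proof (rule measure_eqI_boxes[where I = UNIV and c = "\<lambda>i f. f i"])
  have space: "space P = UNIV" using sets_eq_imp_space_eq[OF sP] by (simp add: space_PiM)
  show "sets P \<subseteq> sets N" if sp: "space N = space P"
    and m: "\<And>i. i \<in> UNIV \<Longrightarrow> (\<lambda>f. f i) \<in> borel_measurable N" for N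
  proof -
    have "(\<lambda>f. f) \<in> measurable N (\<Pi>\<^sub>M i\<in>(UNIV :: 'i set). (borel :: ennreal measure))"
      using m by (intro measurable_PiM_single') auto
    from measurable_sets[OF this] show ?thesis
      using sP sp space by auto
  qed
  show "(\<lambda>f. f i) \<in> borel_measurable P" for i
    unfolding measurable_cong_sets[OF sP refl] by measurable
qed (use assms eq sets_eq_imp_space_eq[OF sP] in \<open>auto simp: space_PiM\<close>)

section \<open>Finite-dimensional laws of the max-stable process\<close>

text \<open>The functional V of the exceedance formula: with
  \<open>y i = x i powr (- \<alpha>)\<close> the n-th point of the series stays below the levels x
  on J exactly when \<open>max_fun\<close> of the n-th path is at most the n-th partial sum. For
  empty J it is 0.\<close>

definition max_fun ::
    "real \<Rightarrow> ((real ^ 'p) \<times> 'd \<Rightarrow> real) \<Rightarrow> ((real ^ 'p) \<times> 'd) set \<Rightarrow> (real ^ 'p \<Rightarrow> real ^ 'd) \<Rightarrow> ennreal" where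
  "max_fun \<alpha> y J f = (SUP i\<in>J. ennreal (y i * coord f i powr \<alpha>))"

lemma max_fun_measurable [measurable]:
  "finite J \<Longrightarrow> max_fun \<alpha> y J \<in> borel_measurable Cspace"
  unfolding max_fun_def by (intro borel_measurable_SUP countable_finite) measurable

lemma le_powr_iff:
  fixes x z \<gamma> \<alpha> :: real
  assumes "0 < \<alpha>" "0 < x" "0 \<le> z" "0 < \<gamma>"
  shows "\<gamma> powr (- 1 / \<alpha>) * z \<le> x \<longleftrightarrow> x powr (- \<alpha>) * z powr \<alpha> \<le> \<gamma>"
proof -
  have "\<gamma> powr (- 1 / \<alpha>) * z \<le> x \<longleftrightarrow> (\<gamma> powr (- 1 / \<alpha>) * z) powr \<alpha> \<le> x powr \<alpha>"
    using powr_mono2[of \<alpha> "\<gamma> powr (- 1 / \<alpha>) * z" x] powr_less_mono2[of \<alpha> x "\<gamma> powr (- 1 / \<alpha>) * z"] assms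
    by (auto simp: not_le[symmetric])
  also have "(\<gamma> powr (- 1 / \<alpha>) * z) powr \<alpha> = \<gamma> powr (- 1) * z powr \<alpha>"
    using assms by (simp add: powr_mult powr_powr)
  also have "\<dots> = z powr \<alpha> / \<gamma>"
    using assms by (simp add: powr_minus field_simps)
  also have "z powr \<alpha> / \<gamma> \<le> x powr \<alpha> \<longleftrightarrow> x powr (- \<alpha>) * z powr \<alpha> \<le> \<gamma>"
    using assms by (simp add: powr_minus field_simps)
  finally show ?thesis .
qed

lemma dehaan_max_le_iff:
  assumes "0 < \<alpha>" "\<And>i. 0 < x i" "\<And>i. Zs i \<in> Cpaths" "\<And>i. 0 < (\<Sum>j\<le>i. E j)"
  shows "(\<forall>i\<in>J. dehaan_max \<alpha> (E, Zs) (fst i) (snd i) \<le> ennreal (x i)) \<longleftrightarrow>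
    (\<forall>n. max_fun \<alpha> (\<lambda>i. x i powr (- \<alpha>)) J (Zs n) \<le> ennreal (\<Sum>j\<le>n. E j))"
proof -
  have "ennreal ((\<Sum>j\<le>n. E j) powr (- 1 / \<alpha>) * coord (Zs n) i) \<le> ennreal (x i) \<longleftrightarrow>
      ennreal (x i powr (- \<alpha>) * coord (Zs n) i powr \<alpha>) \<le> ennreal (\<Sum>j\<le>n. E j)" for i n
    using le_powr_iff[OF assms(1) assms(2)[of i] Cpaths_nonneg[OF assms(3)[of n]] assms(4)[of n], of "fst i" "snd i"]
    by (simp add: ennreal_le_iff less_imp_le[OF assms(2)] less_imp_le[OF assms(4)])
  then show ?thesis
    unfolding dehaan_max_def max_fun_def by (auto simp: SUP_le_iff)
qed

lemma measurable_fst_unit_exp [measurable]: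
  "(\<lambda>x. fst x i) \<in> borel_measurable ((\<Pi>\<^sub>M i\<in>(UNIV::nat set). unit_exp) \<Otimes>\<^sub>M P)"
proof -
  have "(\<lambda>x. x i) \<in> measurable (\<Pi>\<^sub>M i\<in>(UNIV::nat set). unit_exp) unit_exp" by measurable
  then have "(\<lambda>x. x i) \<in> borel_measurable (\<Pi>\<^sub>M i\<in>(UNIV::nat set). unit_exp)"
    by (simp cong: measurable_cong_sets)
  then show ?thesis by measurable
qed

lemma dehaan_max_measurable:
  fixes Z :: "'b \<Rightarrow> real ^ 'p \<Rightarrow> real ^ 'd"
  shows "(\<lambda>\<omega> (t, k). dehaan_max \<alpha> \<omega> t k) \<in> measurable (dehaan_space N Z) (\<Pi>\<^sub>M tk\<in>UNIV. borel)"
proof (rule measurable_PiM_single')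
  fix i :: "(real ^ 'p) \<times> 'd"
  have [measurable]: "(\<lambda>x. snd x n) \<in> measurable (dehaan_space N Z) Cspace" for n
  proof -
    have "(\<lambda>x. x n) \<in> measurable (\<Pi>\<^sub>M i\<in>UNIV. distr N Cspace Z) (distr N Cspace Z)" by measurable
    then have "(\<lambda>x. x n) \<in> measurable (\<Pi>\<^sub>M i\<in>UNIV. distr N Cspace Z) Cspace"
      by (simp cong: measurable_cong_sets)
    then show ?thesis unfolding dehaan_space_def by measurable
  qed
  have [measurable]: "(\<lambda>x. fst x n) \<in> borel_measurable (dehaan_space N Z)" for n
    unfolding dehaan_space_def by measurable
  show "(\<lambda>\<omega>. case i of (t, k) \<Rightarrow> dehaan_max \<alpha> \<omega> t k) \<in> borel_measurable (dehaan_space N Z)"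
    unfolding dehaan_max_def by (cases i) (simp add: case_prod_beta)
qed auto

lemma emeasure_dehaan_le:
  fixes Z :: "'b \<Rightarrow> real ^ 'p \<Rightarrow> real ^ 'd"
  assumes "0 < \<alpha>" and N: "prob_space N" and Z [measurable]: "Z \<in> measurable N Cspace"
    and J: "finite J" and x: "\<And>i. 0 < x i"
  shows "emeasure (process_law (dehaan_space N Z) (dehaan_max \<alpha>)) {f. \<forall>i\<in>J. f i \<le> ennreal (x i)}
    = exp_neg (\<integral>\<^sup>+\<omega>. max_fun \<alpha> (\<lambda>i. x i powr (- \<alpha>)) J (Z \<omega>) \<partial>N)"
proof -
  let ?D = "distr N Cspace Z"
  let ?PE = "\<Pi>\<^sub>M i\<in>(UNIV::nat set). unit_exp"
  let ?PD = "\<Pi>\<^sub>M i\<in>(UNIV::nat set). ?D"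
  let ?V = "max_fun \<alpha> (\<lambda>i. x i powr (- \<alpha>)) J"
  interpret D: prob_space ?D using N Z by (rule prob_space.prob_space_distr)
  interpret PP: pair_prob_space ?PE ?PD
    unfolding pair_prob_space_def pair_sigma_finite_def
    by (intro conjI prob_space_imp_sigma_finite prob_space_PiM prob_space_unit_exp D.prob_space_axioms)
  have [measurable]: "?V \<in> borel_measurable ?D"
    using J by simp
  have A: "{f. \<forall>i\<in>J. f i \<le> ennreal (x i)} \<in> sets (\<Pi>\<^sub>M tk\<in>UNIV. borel)"
  proof -
    have "{f \<in> space (\<Pi>\<^sub>M tk\<in>(UNIV :: ((real ^ 'p) \<times> 'd) set). borel). \<forall>i\<in>J. f i \<le> ennreal (x i)}
        \<in> sets (\<Pi>\<^sub>M tk\<in>(UNIV :: ((real ^ 'p) \<times> 'd) set). borel)"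
      using J by measurable
    then show ?thesis by (simp add: space_PiM)
  qed
  have "emeasure (process_law (dehaan_space N Z) (dehaan_max \<alpha>)) {f. \<forall>i\<in>J. f i \<le> ennreal (x i)}
      = emeasure (dehaan_space N Z)
        {\<omega> \<in> space (dehaan_space N Z). \<forall>i\<in>J. dehaan_max \<alpha> \<omega> (fst i) (snd i) \<le> ennreal (x i)}"
    unfolding process_law_def emeasure_distr[OF dehaan_max_measurable A]
    by (intro arg_cong[where f = "emeasure _"]) (auto simp: case_prod_beta)
  also have "\<dots> = emeasure (?PE \<Otimes>\<^sub>M ?PD)
      {\<omega> \<in> space (?PE \<Otimes>\<^sub>M ?PD). \<forall>n. ?V (snd \<omega> n) \<le> ennreal (\<Sum>j\<le>n. fst \<omega> j)}"
    unfolding dehaan_space_def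
  proof (rule emeasure_eq_AE)
    \<comment> \<open>Inverting the power needs positive partial sums, so the two events agree only
      up to a null set.\<close>
    have "AE E in ?PE. AE Zs in ?PD. \<forall>i. 0 < (\<Sum>j\<le>i. E j)"
      using AE_PiM_unit_exp_sum_pos by eventually_elim simp
    then have "AE \<omega> in ?PE \<Otimes>\<^sub>M ?PD. \<forall>i. 0 < (\<Sum>j\<le>i. fst \<omega> j)"
      by (intro PP.AE_pair_measure) auto
    then show "AE \<omega> in ?PE \<Otimes>\<^sub>M ?PD.
        (\<omega> \<in> {\<omega> \<in> space (?PE \<Otimes>\<^sub>M ?PD). \<forall>i\<in>J. dehaan_max \<alpha> \<omega> (fst i) (snd i) \<le> ennreal (x i)}) =
        (\<omega> \<in> {\<omega> \<in> space (?PE \<Otimes>\<^sub>M ?PD). \<forall>n. ?V (snd \<omega> n) \<le> ennreal (\<Sum>j\<le>n. fst \<omega> j)})"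
    proof eventually_elim
      case (elim \<omega>)
      show ?case
      proof (cases "\<omega> \<in> space (?PE \<Otimes>\<^sub>M ?PD)")
        case True
        then have "snd \<omega> n \<in> Cpaths" for n
          by (auto simp: space_pair_measure space_PiM)
        then show ?thesis
          using dehaan_max_le_iff[OF assms(1) x, of "snd \<omega>" "fst \<omega>" J] elim True by simp
      qed simp
    qed
    have [measurable]: "(\<lambda>\<omega>. dehaan_max \<alpha> \<omega> (fst i) (snd i)) \<in> borel_measurable (?PE \<Otimes>\<^sub>M ?PD)" for i
      using measurable_compose[OF dehaan_max_measurable measurable_component_singleton[OF UNIV_I], of \<alpha> i]
      by (simp add: case_prod_beta dehaan_space_def)
    show "{\<omega> \<in> space (?PE \<Otimes>\<^sub>M ?PD). \<forall>i\<in>J. dehaan_max \<alpha> \<omega> (fst i) (snd i) \<le> ennreal (x i)}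
        \<in> sets (?PE \<Otimes>\<^sub>M ?PD)"
      using J by measurable
    have [measurable]: "(\<lambda>\<omega>. ?V (snd \<omega> n)) \<in> borel_measurable (?PE \<Otimes>\<^sub>M ?PD)" for n
    proof (rule measurable_compose[OF _ \<open>?V \<in> borel_measurable ?D\<close>])
      show "(\<lambda>\<omega>. snd \<omega> n) \<in> measurable (?PE \<Otimes>\<^sub>M ?PD) ?D"
        by (rule measurable_compose[OF measurable_snd measurable_component_singleton]) simp
    qed
    show "{\<omega> \<in> space (?PE \<Otimes>\<^sub>M ?PD). \<forall>n. ?V (snd \<omega> n) \<le> ennreal (\<Sum>j\<le>n. fst \<omega> j)}
        \<in> sets (?PE \<Otimes>\<^sub>M ?PD)"
      by measurable
  qed
  also have "\<dots> = exp_neg (\<integral>\<^sup>+f. ?V f \<partial>?D)"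
    by (rule D.exp_partial_sums_exceed) measurable
  also have "(\<integral>\<^sup>+f. ?V f \<partial>?D) = (\<integral>\<^sup>+\<omega>. ?V (Z \<omega>) \<partial>N)"
    using J by (subst nn_integral_distr) auto
  finally show ?thesis .
qed

lemma process_law_X_measurable:
  fixes X :: "'a \<Rightarrow> real ^ 'p \<Rightarrow> real ^ 'd"
  assumes [measurable]: "X \<in> measurable M Cspace"
  shows "(\<lambda>\<omega> (t, k). ennreal (X \<omega> t $ k)) \<in> measurable M (\<Pi>\<^sub>M tk\<in>UNIV. borel)"
  by (rule measurable_PiM_single') (auto simp: case_prod_beta)

lemma emeasure_process_law_le:
  fixes X :: "'a \<Rightarrow> real ^ 'p \<Rightarrow> real ^ 'd"
  assumes X [measurable]: "X \<in> measurable M Cspace" and J: "finite J" and x: "\<And>i. 0 < x i"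
  shows "emeasure (process_law M (\<lambda>\<omega> t k. ennreal (X \<omega> t $ k))) {f. \<forall>i\<in>J. f i \<le> ennreal (x i)}
    = emeasure M {\<omega> \<in> space M. \<forall>i\<in>J. coord (X \<omega>) i \<le> x i}"
proof -
  have A: "{f. \<forall>i\<in>J. f i \<le> ennreal (x i)} \<in> sets (\<Pi>\<^sub>M tk\<in>UNIV. borel)"
  proof -
    have "{f \<in> space (\<Pi>\<^sub>M tk\<in>(UNIV :: ((real ^ 'p) \<times> 'd) set). borel). \<forall>i\<in>J. f i \<le> ennreal (x i)}
        \<in> sets (\<Pi>\<^sub>M tk\<in>(UNIV :: ((real ^ 'p) \<times> 'd) set). borel)"
      using J by measurable
    then show ?thesis by (simp add: space_PiM)
  qed
  show ?thesis
    unfolding process_law_def emeasure_distr[OF process_law_X_measurable[OF X] A]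
    by (intro arg_cong[where f = "emeasure _"])
      (auto simp: case_prod_beta ennreal_le_iff less_imp_le[OF x])
qed

text \<open>Boxes determine the law of a [0, \<infinity>]-valued family, and both processes have
  explicit box probabilities: that of X by definition, that of the series by
  \<open>emeasure_dehaan_le\<close>.\<close>

lemma spectral_process_iff:
  fixes X :: "'a \<Rightarrow> real ^ 'p \<Rightarrow> real ^ 'd" and Z :: "'b \<Rightarrow> real ^ 'p \<Rightarrow> real ^ 'd"
  assumes "0 < \<alpha>" and M: "prob_space M" and X: "X \<in> measurable M Cspace"
  shows "spectral_process \<alpha> M X N Z \<longleftrightarrow>
    prob_space N \<and> Z \<in> measurable N Cspace \<and>
    (\<forall>J x. finite J \<longrightarrow> (\<forall>i. 0 < x i) \<longrightarrow>
      emeasure M {\<omega> \<in> space M. \<forall>i\<in>J. coord (X \<omega>) i \<le> x i}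
      = exp_neg (\<integral>\<^sup>+\<omega>. max_fun \<alpha> (\<lambda>i. x i powr (- \<alpha>)) J (Z \<omega>) \<partial>N))"
  (is "_ \<longleftrightarrow> _ \<and> _ \<and> ?box")
proof -
  have "process_law M (\<lambda>\<omega> t k. ennreal (X \<omega> t $ k)) = process_law (dehaan_space N Z) (dehaan_max \<alpha>) \<longleftrightarrow> ?box"
    if N: "prob_space N" "Z \<in> measurable N Cspace"
  proof
    assume eq: "process_law M (\<lambda>\<omega> t k. ennreal (X \<omega> t $ k)) = process_law (dehaan_space N Z) (dehaan_max \<alpha>)"
    show ?box
    proof (intro allI impI)
      fix J :: "((real ^ 'p) \<times> 'd) set" and x :: "(real ^ 'p) \<times> 'd \<Rightarrow> real" assume J: "finite J" and x: "\<forall>i. 0 < x i"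
      show "emeasure M {\<omega> \<in> space M. \<forall>i\<in>J. coord (X \<omega>) i \<le> x i}
          = exp_neg (\<integral>\<^sup>+\<omega>. max_fun \<alpha> (\<lambda>i. x i powr (- \<alpha>)) J (Z \<omega>) \<partial>N)"
        using emeasure_process_law_le[OF X J x[rule_format]] emeasure_dehaan_le[OF assms(1) N J x[rule_format]]
        by (simp add: eq)
    qed
  next
    assume ?box
    show "process_law M (\<lambda>\<omega> t k. ennreal (X \<omega> t $ k)) = process_law (dehaan_space N Z) (dehaan_max \<alpha>)"
    proof (rule PiM_ennreal_measure_eqI)
      show "finite_measure (process_law M (\<lambda>\<omega> t k. ennreal (X \<omega> t $ k)))"
        unfolding process_law_def
        using prob_space.prob_space_distr[OF M process_law_X_measurable[OF X]]
        by (rule prob_space.finite_measure)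
    next
      fix J :: "((real ^ 'p) \<times> 'd) set" and x :: "(real ^ 'p) \<times> 'd \<Rightarrow> real" assume "finite J" "\<And>i. 0 < x i"
      then show "emeasure (process_law M (\<lambda>\<omega> t k. ennreal (X \<omega> t $ k))) {f. \<forall>i\<in>J. f i \<le> ennreal (x i)}
        = emeasure (process_law (dehaan_space N Z) (dehaan_max \<alpha>)) {f. \<forall>i\<in>J. f i \<le> ennreal (x i)}"
        using \<open>?box\<close> by (simp add: emeasure_process_law_le[OF X] emeasure_dehaan_le[OF assms(1) N])
    qed (simp_all add: process_law_def)
  qed
  then show ?thesis
    unfolding spectral_process_def by blast
qed

text \<open>Since X already has the spectral process Z, a candidate only has to reproduce the
  expected maxima of Z: \<open>exp_neg\<close> is injective, and levels and weights correspond
  through the bijection \<open>x powr (- \<alpha>)\<close> of the positive reals.\<close>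

lemma spectral_process_iff_max_fun:
  fixes X :: "'a \<Rightarrow> real ^ 'p \<Rightarrow> real ^ 'd" and Z :: "'b \<Rightarrow> real ^ 'p \<Rightarrow> real ^ 'd"
    and Z' :: "'c \<Rightarrow> real ^ 'p \<Rightarrow> real ^ 'd"
  assumes "0 < \<alpha>" and "prob_space M" and "X \<in> measurable M Cspace" and "spectral_process \<alpha> M X N Z"
  shows "spectral_process \<alpha> M X N' Z' \<longleftrightarrow>
    prob_space N' \<and> Z' \<in> measurable N' Cspace \<and>
    (\<forall>J y. finite J \<longrightarrow> (\<forall>i. 0 < y i) \<longrightarrow>
      (\<integral>\<^sup>+\<omega>. max_fun \<alpha> y J (Z' \<omega>) \<partial>N') = (\<integral>\<^sup>+\<omega>. max_fun \<alpha> y J (Z \<omega>) \<partial>N))"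
proof -
  have y_x: "(\<lambda>i. (y i powr (- 1 / \<alpha>)) powr (- \<alpha>)) = y" if "\<forall>i. 0 < y i" for y :: "(real ^ 'p) \<times> 'd \<Rightarrow> real"
    using that \<open>0 < \<alpha>\<close> by (auto simp: powr_powr less_imp_le)
  have law_Z: "emeasure M {\<omega> \<in> space M. \<forall>i\<in>J. coord (X \<omega>) i \<le> x i}
      = exp_neg (\<integral>\<^sup>+\<omega>. max_fun \<alpha> (\<lambda>i. x i powr (- \<alpha>)) J (Z \<omega>) \<partial>N)"
    if "finite J" "\<forall>i. 0 < x i" for J x
    using assms(4) that unfolding spectral_process_iff[OF assms(1-3)] by blast
  show ?thesis
    unfolding spectral_process_iff[OF assms(1-3), of N' Z']
  proof (intro conj_cong refl iffI allI impI)
    fix J :: "((real ^ 'p) \<times> 'd) set" and y :: "(real ^ 'p) \<times> 'd \<Rightarrow> real"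
    assume eq: "\<forall>J x. finite J \<longrightarrow> (\<forall>i. 0 < x i) \<longrightarrow>
        emeasure M {\<omega> \<in> space M. \<forall>i\<in>J. coord (X \<omega>) i \<le> x i}
        = exp_neg (\<integral>\<^sup>+\<omega>. max_fun \<alpha> (\<lambda>i. x i powr (- \<alpha>)) J (Z' \<omega>) \<partial>N')"
      and J: "finite J" and y: "\<forall>i. 0 < y i"
    have pos: "\<forall>i. 0 < y i powr (- 1 / \<alpha>)" using y by (metis less_irrefl powr_gt_zero)
    have "exp_neg (\<integral>\<^sup>+\<omega>. max_fun \<alpha> (\<lambda>i. (y i powr (- 1 / \<alpha>)) powr (- \<alpha>)) J (Z' \<omega>) \<partial>N')
        = exp_neg (\<integral>\<^sup>+\<omega>. max_fun \<alpha> (\<lambda>i. (y i powr (- 1 / \<alpha>)) powr (- \<alpha>)) J (Z \<omega>) \<partial>N)"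
      using eq[rule_format, OF J pos[rule_format]] law_Z[OF J pos] by (rule subst)
    then show "(\<integral>\<^sup>+\<omega>. max_fun \<alpha> y J (Z' \<omega>) \<partial>N') = (\<integral>\<^sup>+\<omega>. max_fun \<alpha> y J (Z \<omega>) \<partial>N)"
      unfolding y_x[OF y] exp_neg_inject .
  next
    fix J :: "((real ^ 'p) \<times> 'd) set" and x :: "(real ^ 'p) \<times> 'd \<Rightarrow> real"
    assume eq: "\<forall>J y. finite J \<longrightarrow> (\<forall>i. 0 < y i) \<longrightarrow>
        (\<integral>\<^sup>+\<omega>. max_fun \<alpha> y J (Z' \<omega>) \<partial>N') = (\<integral>\<^sup>+\<omega>. max_fun \<alpha> y J (Z \<omega>) \<partial>N)"
      and J: "finite J" and x: "\<forall>i. 0 < x i"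
    have pos: "\<forall>i. 0 < x i powr (- \<alpha>)" using x by (metis less_irrefl powr_gt_zero)
    show "emeasure M {\<omega> \<in> space M. \<forall>i\<in>J. coord (X \<omega>) i \<le> x i}
        = exp_neg (\<integral>\<^sup>+\<omega>. max_fun \<alpha> (\<lambda>i. x i powr (- \<alpha>)) J (Z' \<omega>) \<partial>N')"
      unfolding law_Z[OF J x] using eq J pos by simp
  qed
qed

text \<open>A shifted path lies below levels on J exactly when the original path lies below the
  translated levels on the translated index set. Hence the box formula for X also serves the shifted
  process, with shifted spectral paths.\<close>

lemma stationary_iff_max_fun:
  fixes X :: "'a \<Rightarrow> real ^ 'p \<Rightarrow> real ^ 'd" and Z :: "'b \<Rightarrow> real ^ 'p \<Rightarrow> real ^ 'd"
  assumes "0 < \<alpha>" and M: "prob_space M" and X: "X \<in> measurable M Cspace" and "spectral_process \<alpha> M X N Z"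
  shows "stationary M X \<longleftrightarrow>
    (\<forall>h J y. finite J \<longrightarrow> (\<forall>i. 0 < y i) \<longrightarrow>
      (\<integral>\<^sup>+\<omega>. max_fun \<alpha> y J (Bshift h (Z \<omega>)) \<partial>N) = (\<integral>\<^sup>+\<omega>. max_fun \<alpha> y J (Z \<omega>) \<partial>N))"
proof -
  have N: "prob_space N" and Z [measurable]: "Z \<in> measurable N Cspace"
    using assms(4) by (auto simp: spectral_process_def)
  have law_box: "emeasure M {\<omega> \<in> space M. \<forall>i\<in>J. coord (X \<omega>) i \<le> x i}
      = exp_neg (\<integral>\<^sup>+\<omega>. max_fun \<alpha> (\<lambda>i. x i powr (- \<alpha>)) J (Z \<omega>) \<partial>N)"
    if "finite J" "\<And>i. 0 < x i" for J x
    using assms(4) that unfolding spectral_process_iff[OF assms(1-3)] by blast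
  have shift_box: "emeasure M {\<omega> \<in> space M. \<forall>i\<in>J. coord (Bshift h (X \<omega>)) i \<le> x i}
      = exp_neg (\<integral>\<^sup>+\<omega>. max_fun \<alpha> (\<lambda>i. x i powr (- \<alpha>)) J (Bshift h (Z \<omega>)) \<partial>N)"
    if J: "finite J" and x: "\<And>i. 0 < x i" for h J x
  proof -
    let ?s = "\<lambda>i. (fst i - h, snd i)" and ?s' = "\<lambda>i. (fst i + h, snd i)"
    have "emeasure M {\<omega> \<in> space M. \<forall>i\<in>J. coord (Bshift h (X \<omega>)) i \<le> x i}
        = emeasure M {\<omega> \<in> space M. \<forall>i\<in>?s ` J. coord (X \<omega>) i \<le> x (?s' i)}"
      by (intro arg_cong[where f = "emeasure _"]) (auto simp: Bshift_def)
    also have "\<dots> = exp_neg (\<integral>\<^sup>+\<omega>. max_fun \<alpha> (\<lambda>i. x (?s' i) powr (- \<alpha>)) (?s ` J) (Z \<omega>) \<partial>N)"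
      using J x by (intro law_box) auto
    also have "(\<lambda>\<omega>. max_fun \<alpha> (\<lambda>i. x (?s' i) powr (- \<alpha>)) (?s ` J) (Z \<omega>))
        = (\<lambda>\<omega>. max_fun \<alpha> (\<lambda>i. x i powr (- \<alpha>)) J (Bshift h (Z \<omega>)))"
      by (simp add: max_fun_def Bshift_def image_image)
    finally show ?thesis .
  qed
  have y_x: "(\<lambda>i. (y i powr (- 1 / \<alpha>)) powr (- \<alpha>)) = y" if "\<forall>i. 0 < y i" for y :: "(real ^ 'p) \<times> 'd \<Rightarrow> real"
    using that \<open>0 < \<alpha>\<close> by (auto simp: powr_powr less_imp_le)
  have distr_box: "emeasure (distr M Cspace Y) {f \<in> Cpaths. \<forall>i\<in>J. coord f i \<le> x i}
      = emeasure M {\<omega> \<in> space M. \<forall>i\<in>J. coord (Y \<omega>) i \<le> x i}"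
    if J: "finite J" and Y [measurable]: "Y \<in> measurable M Cspace" for Y :: "'a \<Rightarrow> real ^ 'p \<Rightarrow> real ^ 'd" and J x
  proof -
    have "{f \<in> space Cspace. \<forall>i\<in>J. coord f i \<le> x i} \<in> sets (Cspace :: (real ^ 'p \<Rightarrow> real ^ 'd) measure)"
      using J by measurable
    then show ?thesis
      using measurable_space[OF Y]
      by (subst emeasure_distr) (auto intro!: arg_cong[where f = "emeasure _"])
  qed
  have XB: "(\<lambda>\<omega>. Bshift h (X \<omega>)) \<in> measurable M Cspace" for h
    using X by measurable
  show ?thesis
  proof (intro iffI allI impI)
    fix h :: "real ^ 'p" and J :: "((real ^ 'p) \<times> 'd) set" and y :: "(real ^ 'p) \<times> 'd \<Rightarrow> real"
    assume st: "stationary M X" and J: "finite J" and y: "\<forall>i. 0 < y i"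
    have eq: "distr M Cspace (\<lambda>\<omega>. Bshift h (X \<omega>)) = distr M Cspace X"
      using st by (simp add: stationary_def)
    have pos: "\<And>i. 0 < y i powr (- 1 / \<alpha>)" using y by (metis less_irrefl powr_gt_zero)
    have "exp_neg (\<integral>\<^sup>+\<omega>. max_fun \<alpha> (\<lambda>i. (y i powr (- 1 / \<alpha>)) powr (- \<alpha>)) J (Bshift h (Z \<omega>)) \<partial>N)
        = exp_neg (\<integral>\<^sup>+\<omega>. max_fun \<alpha> (\<lambda>i. (y i powr (- 1 / \<alpha>)) powr (- \<alpha>)) J (Z \<omega>) \<partial>N)"
      unfolding shift_box[OF J pos, symmetric] law_box[OF J pos, symmetric]
        distr_box[OF J XB, symmetric] distr_box[OF J X, symmetric] eq by (rule refl)
    then show "(\<integral>\<^sup>+\<omega>. max_fun \<alpha> y J (Bshift h (Z \<omega>)) \<partial>N) = (\<integral>\<^sup>+\<omega>. max_fun \<alpha> y J (Z \<omega>) \<partial>N)"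
      unfolding y_x[OF y] exp_neg_inject .
  next
    assume eq: "\<forall>h J y. finite J \<longrightarrow> (\<forall>i. 0 < y i) \<longrightarrow>
      (\<integral>\<^sup>+\<omega>. max_fun \<alpha> y J (Bshift h (Z \<omega>)) \<partial>N) = (\<integral>\<^sup>+\<omega>. max_fun \<alpha> y J (Z \<omega>) \<partial>N)"
    show "stationary M X"
      unfolding stationary_def
    proof
      fix h
      show "distr M Cspace (\<lambda>\<omega>. Bshift h (X \<omega>)) = distr M Cspace X"
      proof (rule Cspace_measure_eqI)
        show "finite_measure (distr M Cspace (\<lambda>\<omega>. Bshift h (X \<omega>)))"
          using prob_space.prob_space_distr[OF M XB] by (rule prob_space.finite_measure)
        fix J :: "((real ^ 'p) \<times> 'd) set" and x :: "(real ^ 'p) \<times> 'd \<Rightarrow> real" assume J: "finite J" and x: "\<And>i. 0 < x i"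
        have "\<forall>i. 0 < x i powr (- \<alpha>)" using x by (metis less_irrefl powr_gt_zero)
        then show "emeasure (distr M Cspace (\<lambda>\<omega>. Bshift h (X \<omega>))) {f \<in> Cpaths. \<forall>i\<in>J. coord f i \<le> x i}
          = emeasure (distr M Cspace X) {f \<in> Cpaths. \<forall>i\<in>J. coord f i \<le> x i}"
          unfolding distr_box[OF J XB] distr_box[OF J X] shift_box[OF J x] law_box[OF J x]
          using eq J by simp
      qed simp_all
    qed
  qed
qed

section \<open>Tilting and homogeneous functionals\<close>

text \<open>Covers both tilts, by the norm at a time and by one component. There is no normalising
  constant, so the total mass is the mean of \<open>r f powr \<alpha>\<close> and different base
  laws can be compared directly.\<close>

definition tilt ::
    "real \<Rightarrow> (real ^ 'p \<Rightarrow> real ^ 'd) measure \<Rightarrow> ((real ^ 'p \<Rightarrow> real ^ 'd) \<Rightarrow> real) \<Rightarrow> (real ^ 'p \<Rightarrow> real ^ 'd) measure" where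
  "tilt \<alpha> P r = distr (density P (\<lambda>f. ennreal (r f powr \<alpha>))) Cspace (\<lambda>f t. f t /\<^sub>R r f)"

lemma sets_tilt [simp, measurable_cong]: "sets (tilt \<alpha> P r) = sets Cspace"
  and space_tilt [simp]: "space (tilt \<alpha> P r) = Cpaths"
  by (simp_all add: tilt_def)

lemma normalise_measurable:
  assumes [measurable]: "r \<in> borel_measurable Cspace" and "\<And>f. f \<in> Cpaths \<Longrightarrow> 0 \<le> r f"
  shows "(\<lambda>f t. f t /\<^sub>R r f) \<in> measurable Cspace Cspace"
  using assms(2) by (intro measurable_scale) auto

lemma nn_integral_tilt:
  assumes P [measurable_cong]: "sets P = sets Cspace"
    and r [measurable]: "r \<in> borel_measurable Cspace" and nonneg: "\<And>f. f \<in> Cpaths \<Longrightarrow> 0 \<le> r f"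
    and g [measurable]: "g \<in> borel_measurable Cspace"
  shows "(\<integral>\<^sup>+f. g f \<partial>tilt \<alpha> P r) = (\<integral>\<^sup>+f. ennreal (r f powr \<alpha>) * g (\<lambda>t. f t /\<^sub>R r f) \<partial>P)"
proof -
  note [measurable] = normalise_measurable[OF r nonneg]
  show ?thesis
    unfolding tilt_def by (simp add: nn_integral_distr nn_integral_density)
qed

lemma E0_measurable [measurable_dest]: "\<Gamma> \<in> E0 \<Longrightarrow> \<Gamma> \<in> borel_measurable Cspace"
  and E0_scale: "\<Gamma> \<in> E0 \<Longrightarrow> 0 < c \<Longrightarrow> f \<in> Cpaths \<Longrightarrow> \<Gamma> (\<lambda>t. c *\<^sub>R f t) = \<Gamma> f"
  by (auto simp: E0_def)

lemma E0_Bshift: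
  assumes "\<Gamma> \<in> E0"
  shows "(\<lambda>f. \<Gamma> (Bshift h f)) \<in> E0"
proof -
  have [measurable]: "\<Gamma> \<in> borel_measurable Cspace" using assms by (rule E0_measurable)
  have "Bshift h (\<lambda>t. c *\<^sub>R f t) = (\<lambda>t. c *\<^sub>R Bshift h f t)" for c and f :: "real ^ 'a \<Rightarrow> real ^ 'b"
    by (simp add: Bshift_def)
  then show ?thesis
    using E0_scale[OF assms _ Cpaths_Bshift] by (simp add: E0_def)
qed

text \<open>A homogeneous functional does not see the rescaling by r, so that only the density of
  the tilt survives; where r vanishes, the density does too.\<close>

lemma nn_integral_tilt_E0:
  assumes P: "sets P = sets Cspace"
    and r: "r \<in> borel_measurable Cspace" and nonneg: "\<And>f. f \<in> Cpaths \<Longrightarrow> 0 \<le> r f"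
    and \<Gamma>: "\<Gamma> \<in> E0"
  shows "(\<integral>\<^sup>+f. \<Gamma> f \<partial>tilt \<alpha> P r) = (\<integral>\<^sup>+f. ennreal (r f powr \<alpha>) * \<Gamma> f \<partial>P)"
proof (subst nn_integral_tilt[OF P r _ E0_measurable[OF \<Gamma>]], fact nonneg, rule nn_integral_cong)
  fix f assume "f \<in> space P"
  then have f: "f \<in> Cpaths" using sets_eq_imp_space_eq[OF P] by simp
  show "ennreal (r f powr \<alpha>) * \<Gamma> (\<lambda>t. f t /\<^sub>R r f) = ennreal (r f powr \<alpha>) * \<Gamma> f"
    using nonneg[OF f] E0_scale[OF \<Gamma> _ f, of "inverse (r f)"] by (cases "r f = 0") auto
qed

lemma max_fun_finite: "finite J \<Longrightarrow> max_fun \<alpha> y J f < \<top>"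
  unfolding max_fun_def by (induction J rule: finite_induct) (auto simp: sup_max bot_ennreal)

lemma nn_integral_max_fun_finite:
  assumes P [measurable_cong]: "sets P = sets Cspace" and J: "finite J"
    and fin: "\<And>i. (\<integral>\<^sup>+f. ennreal (coord f i powr \<alpha>) \<partial>P) < \<top>"
  shows "(\<integral>\<^sup>+f. max_fun \<alpha> y J f \<partial>P) < \<top>"
proof -
  have "(\<integral>\<^sup>+f. max_fun \<alpha> y J f \<partial>P) \<le> (\<integral>\<^sup>+f. (\<Sum>i\<in>J. ennreal (y i) * ennreal (coord f i powr \<alpha>)) \<partial>P)"
  proof (rule nn_integral_mono)
    fix f
    have "ennreal (y i * coord f i powr \<alpha>) \<le> (\<Sum>i\<in>J. ennreal (y i) * ennreal (coord f i powr \<alpha>))"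
      if "i \<in> J" for i
      using member_le_sum[of i J "\<lambda>i. ennreal (y i) * ennreal (coord f i powr \<alpha>)"] that J
      by (simp add: ennreal_mult'')
    then show "max_fun \<alpha> y J f \<le> (\<Sum>i\<in>J. ennreal (y i) * ennreal (coord f i powr \<alpha>))"
      unfolding max_fun_def by (rule SUP_least)
  qed
  also have "\<dots> = (\<Sum>i\<in>J. ennreal (y i) * (\<integral>\<^sup>+f. ennreal (coord f i powr \<alpha>) \<partial>P))"
    by (subst nn_integral_sum, measurable, intro sum.cong refl nn_integral_cmult) measurable
  also have "\<dots> < \<top>"
    using fin J by (simp add: ennreal_mult_less_top)
  finally show ?thesis .
qed

section \<open>Recovering tilted measures from expected maxima\<close>

text \<open>The right derivative of max(c a, m) in c at 1. Approaching from the right makes a tie m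
  = a count fully, which matches boxes defined by weak inequalities.\<close>

lemma max_slope_tendsto:
  fixes a m :: real
  assumes "0 \<le> a"
  shows "(\<lambda>n. real (Suc n) * (max ((1 + 1 / real (Suc n)) * a) m - max a m)) \<longlonglongrightarrow> (if m \<le> a then a else 0)"
    (is "?s \<longlonglongrightarrow> _")
proof (cases "m \<le> a")
  case True
  have "?s n = a" for n
  proof -
    have "a \<le> (1 + 1 / real (Suc n)) * a" using assms by (simp add: algebra_simps)
    then have "max ((1 + 1 / real (Suc n)) * a) m = (1 + 1 / real (Suc n)) * a" using True by simp
    then show ?thesis using True by (simp add: field_simps)
  qed
  then show ?thesis using True by simp
next
  case False
  have "(\<lambda>n. (1 + 1 / real (Suc n)) * a) \<longlonglongrightarrow> (1 + 0) * a"
    by (intro tendsto_intros LIMSEQ_Suc lim_1_over_n)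
  then have "\<forall>\<^sub>F n in sequentially. (1 + 1 / real (Suc n)) * a < m"
    by (rule order_tendstoD(2)) (use False in simp)
  then have "\<forall>\<^sub>F n in sequentially. ?s n = 0"
    by eventually_elim (use False in simp)
  then show ?thesis using False by (auto intro: tendsto_eventually)
qed

text \<open>After division by its value at i0 a path lies in the box exactly when the i0-term
  dominates the weighted maximum over J. The right-hand side is thus a slope as in
  \<open>max_slope_tendsto\<close>, integrated over P.\<close>

lemma emeasure_tilt_box:
  assumes "0 < \<alpha>" and P [measurable_cong]: "sets P = sets Cspace" and J: "finite J" and x: "\<And>i. 0 < x i"
  shows "emeasure (tilt \<alpha> P (\<lambda>f. coord f i0)) {f \<in> Cpaths. \<forall>i\<in>J. coord f i \<le> x i}
    = (\<integral>\<^sup>+f. (if max_fun \<alpha> (\<lambda>i. x i powr (- \<alpha>)) J f \<le> ennreal (coord f i0 powr \<alpha>)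
        then ennreal (coord f i0 powr \<alpha>) else 0) \<partial>P)"
proof -
  let ?B = "{f \<in> Cpaths. \<forall>i\<in>J. coord f i \<le> x i}"
  have B: "?B \<in> sets Cspace"
  proof -
    have "{f \<in> space Cspace. \<forall>i\<in>J. coord f i \<le> x i} \<in> sets Cspace" using J by measurable
    then show ?thesis by simp
  qed
  have "emeasure (tilt \<alpha> P (\<lambda>f. coord f i0)) ?B = (\<integral>\<^sup>+f. indicator ?B f \<partial>tilt \<alpha> P (\<lambda>f. coord f i0))"
    using B by simp
  also have "\<dots> = (\<integral>\<^sup>+f. ennreal (coord f i0 powr \<alpha>) * indicator ?B (\<lambda>t. f t /\<^sub>R coord f i0) \<partial>P)"
    using B by (intro nn_integral_tilt P) (auto simp: Cpaths_nonneg)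
  also have "\<dots> = (\<integral>\<^sup>+f. (if max_fun \<alpha> (\<lambda>i. x i powr (- \<alpha>)) J f \<le> ennreal (coord f i0 powr \<alpha>)
        then ennreal (coord f i0 powr \<alpha>) else 0) \<partial>P)"
  proof (rule nn_integral_cong)
    fix f assume "f \<in> space P"
    then have f: "f \<in> Cpaths" using sets_eq_imp_space_eq[OF P] by simp
    define v where "v = coord f i0"
    have "v \<ge> 0" using f by (simp add: v_def Cpaths_nonneg)
    show "ennreal (coord f i0 powr \<alpha>) * indicator ?B (\<lambda>t. f t /\<^sub>R coord f i0) =
      (if max_fun \<alpha> (\<lambda>i. x i powr (- \<alpha>)) J f \<le> ennreal (coord f i0 powr \<alpha>)
        then ennreal (coord f i0 powr \<alpha>) else 0)"
    proof (cases "v = 0")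
      case False
      with \<open>v \<ge> 0\<close> have v: "0 < v" by simp
      have "(\<lambda>t. f t /\<^sub>R v) \<in> Cpaths" using Cpaths_scale[OF f, of "inverse v"] v by simp
      moreover have "coord (\<lambda>t. f t /\<^sub>R v) i \<le> x i \<longleftrightarrow>
          ennreal (x i powr (- \<alpha>) * coord f i powr \<alpha>) \<le> ennreal (v powr \<alpha>)" for i
      proof -
        \<comment> \<open>\<open>le_powr_iff\<close> again, now with \<open>v powr \<alpha>\<close>
          in the place of the partial sum.\<close>
        have "coord (\<lambda>t. f t /\<^sub>R v) i \<le> x i \<longleftrightarrow> (v powr \<alpha>) powr (- 1 / \<alpha>) * coord f i \<le> x i"
          using v \<open>0 < \<alpha>\<close> by (simp add: powr_powr powr_minus)
        also have "\<dots> \<longleftrightarrow> x i powr (- \<alpha>) * coord f i powr \<alpha> \<le> v powr \<alpha>"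
          using v by (intro le_powr_iff assms(1) x Cpaths_nonneg[OF f]) simp
        finally show ?thesis by (simp add: ennreal_le_iff)
      qed
      ultimately show ?thesis
        unfolding v_def[symmetric] by (auto simp: max_fun_def SUP_le_iff indicator_def)
    qed (simp add: v_def)
  qed
  finally show ?thesis .
qed

lemma nn_integral_max_slope:
  fixes P :: "(real ^ 'p \<Rightarrow> real ^ 'd) measure" and i0 :: "(real ^ 'p) \<times> 'd"
  assumes "0 < \<alpha>" and P [measurable_cong]: "sets P = sets Cspace" and J: "finite J" and y: "\<And>i. 0 < y i"
    and fin: "\<And>i. (\<integral>\<^sup>+f. ennreal (coord f i powr \<alpha>) \<partial>P) < \<top>"
    \<comment> \<open>\<open>G c\<close> is the maximum of \<open>c\<close> times the \<open>i0\<close>-term and the terms in \<open>J\<close>, with \<open>i0 \<in> J\<close> allowed.\<close>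
  defines "G c \<equiv> max_fun \<alpha> (\<lambda>i. if i = i0 then if i0 \<in> J then max c (y i0) else c else y i) (insert i0 J)"
  shows "(\<lambda>n. ennreal (real (Suc n)) * ((\<integral>\<^sup>+f. G (1 + 1 / real (Suc n)) f \<partial>P) - (\<integral>\<^sup>+f. G 1 f \<partial>P)))
    \<longlonglongrightarrow> (\<integral>\<^sup>+f. (if max_fun \<alpha> y J f \<le> ennreal (coord f i0 powr \<alpha>)
        then ennreal (coord f i0 powr \<alpha>) else 0) \<partial>P)"
proof -
  define a where "a f = coord f i0 powr \<alpha>" for f
  define m where "m f = enn2real (max_fun \<alpha> y J f)" for f
  have m: "max_fun \<alpha> y J f = ennreal (m f)" for f
    using max_fun_finite[OF J, of \<alpha> y f] by (simp add: m_def)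
  have a_nonneg: "0 \<le> a f" and m_nonneg: "0 \<le> m f" for f by (simp_all add: a_def m_def)
  have [measurable]: "a \<in> borel_measurable Cspace" unfolding a_def by measurable
  have [measurable]: "G c \<in> borel_measurable Cspace" for c
    unfolding G_def using J by simp
  have [measurable]: "max_fun \<alpha> y J \<in> borel_measurable Cspace" using J by simp
  \<comment> \<open>If i0 already belongs to J, its weight \<open>max c (y i0)\<close> contributes
    the larger of the new term \<open>c * a f\<close> and the old one, and the old one is part of
    \<open>m f\<close> anyway.\<close>
  have G: "G c f = ennreal (max (c * a f) (m f))" if "0 < c" for c f
  proof -
    have "G c f = sup (ennreal ((if i0 \<in> J then max c (y i0) else c) * a f))
        (SUP i\<in>J. ennreal ((if i = i0 then max c (y i0) else y i) * coord f i powr \<alpha>))"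
      unfolding G_def max_fun_def a_def by (auto intro!: arg_cong2[where f = sup] SUP_cong)
    also have "\<dots> = sup (ennreal (c * a f)) (SUP i\<in>J. ennreal (y i * coord f i powr \<alpha>))"
    proof (rule antisym)
      have "ennreal (max c (y i0) * a f) \<le> sup (ennreal (c * a f)) (ennreal (y i0 * a f))"
        by (cases "c \<le> y i0") (auto simp: max_def)
      then have "ennreal (max c (y i0) * a f) \<le> sup (ennreal (c * a f)) (SUP i\<in>J. ennreal (y i * coord f i powr \<alpha>))"
        if "i0 \<in> J"
        using that by (elim order_trans) (auto intro!: le_supI2 SUP_upper2[of i0] simp: a_def)
      then show "sup (ennreal ((if i0 \<in> J then max c (y i0) else c) * a f))
          (SUP i\<in>J. ennreal ((if i = i0 then max c (y i0) else y i) * coord f i powr \<alpha>))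
        \<le> sup (ennreal (c * a f)) (SUP i\<in>J. ennreal (y i * coord f i powr \<alpha>))" (is "_ \<le> ?R")
      proof (intro sup_least SUP_least)
        fix i assume "i \<in> J"
        then show "ennreal ((if i = i0 then max c (y i0) else y i) * coord f i powr \<alpha>) \<le> ?R"
          using \<open>i0 \<in> J \<Longrightarrow> _\<close> by (cases "i = i0") (auto simp: a_def intro!: le_supI2 SUP_upper)
      qed simp
      have "ennreal (y i * coord f i powr \<alpha>)
          \<le> (SUP i\<in>J. ennreal ((if i = i0 then max c (y i0) else y i) * coord f i powr \<alpha>))" if "i \<in> J" for i
        using that by (intro SUP_upper2[of i]) (auto intro!: ennreal_leI mult_right_mono)
      then show "sup (ennreal (c * a f)) (SUP i\<in>J. ennreal (y i * coord f i powr \<alpha>))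
        \<le> sup (ennreal ((if i0 \<in> J then max c (y i0) else c) * a f))
          (SUP i\<in>J. ennreal ((if i = i0 then max c (y i0) else y i) * coord f i powr \<alpha>))"
        using a_nonneg by (intro sup.mono SUP_least) (auto intro!: ennreal_leI mult_right_mono)
    qed
    also have "\<dots> = ennreal (max (c * a f) (m f))"
      unfolding max_fun_def[symmetric] m using a_nonneg m_nonneg \<open>0 < c\<close>
      by (simp add: sup_max ennreal_max_0 max_def ennreal_le_iff)
    finally show ?thesis .
  qed
  have G_diff: "ennreal (real (Suc n)) * (G (1 + 1 / real (Suc n)) f - G 1 f)
      = ennreal (real (Suc n) * (max ((1 + 1 / real (Suc n)) * a f) (m f) - max (a f) (m f)))" for n f
  proof -
    have pos: "0 < 1 + 1 / real (Suc n)" by (intro add_pos_nonneg) auto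
    show ?thesis
      unfolding G[OF pos] G[OF zero_less_one] mult_1_left
      using a_nonneg[of f] by (subst ennreal_minus) (auto simp: ennreal_mult' max_def)
  qed
  \<comment> \<open>Subtraction in [0, \<infinity>] commutes with the integral only if the
    subtracted integral is finite.\<close>
  have G1_fin: "(\<integral>\<^sup>+f. G 1 f \<partial>P) < \<top>"
    unfolding G_def using J by (intro nn_integral_max_fun_finite P fin) simp
  \<comment> \<open>Raising c from 1 by 1/(n+1) raises the maximum by at most a/(n+1), so the
    difference quotients are dominated by a, which is integrable by \<open>fin\<close>.\<close>
  have "(\<lambda>n. \<integral>\<^sup>+f. ennreal (real (Suc n)) * (G (1 + 1 / real (Suc n)) f - G 1 f) \<partial>P)
    \<longlonglongrightarrow> (\<integral>\<^sup>+f. (if max_fun \<alpha> y J f \<le> ennreal (a f) then ennreal (a f) else 0) \<partial>P)"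
  proof (rule nn_integral_dominated_convergence[where w = "\<lambda>f. ennreal (a f)"])
    show "(\<integral>\<^sup>+f. ennreal (a f) \<partial>P) < \<infinity>" using fin[of i0] by (simp add: a_def)
    show "AE f in P. ennreal (real (Suc n)) * (G (1 + 1 / real (Suc n)) f - G 1 f) \<le> ennreal (a f)" for n
    proof (rule AE_I2)
      fix f
      have "0 \<le> a f / real (Suc n)" "(1 + 1 / real (Suc n)) * a f = a f + a f / real (Suc n)"
        using a_nonneg[of f] by (simp_all add: distrib_right)
      then have "max ((1 + 1 / real (Suc n)) * a f) (m f) - max (a f) (m f) \<le> a f / real (Suc n)"
        by linarith
      from mult_left_mono[OF this, of "real (Suc n)"]
      have "real (Suc n) * (max ((1 + 1 / real (Suc n)) * a f) (m f) - max (a f) (m f)) \<le> a f"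
        by simp
      then show "ennreal (real (Suc n)) * (G (1 + 1 / real (Suc n)) f - G 1 f) \<le> ennreal (a f)"
        unfolding G_diff by (rule ennreal_leI)
    qed
    show "AE f in P. (\<lambda>n. ennreal (real (Suc n)) * (G (1 + 1 / real (Suc n)) f - G 1 f))
        \<longlonglongrightarrow> (if max_fun \<alpha> y J f \<le> ennreal (a f) then ennreal (a f) else 0)"
    proof (rule AE_I2)
      fix f
      have "(if max_fun \<alpha> y J f \<le> ennreal (a f) then ennreal (a f) else 0) = ennreal (if m f \<le> a f then a f else 0)"
        using a_nonneg[of f] by (simp add: m ennreal_le_iff)
      then show "(\<lambda>n. ennreal (real (Suc n)) * (G (1 + 1 / real (Suc n)) f - G 1 f))
          \<longlonglongrightarrow> (if max_fun \<alpha> y J f \<le> ennreal (a f) then ennreal (a f) else 0)"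
        unfolding G_diff using tendsto_ennrealI[OF max_slope_tendsto[OF a_nonneg[of f], of "m f"]] by (simp only:)
    qed
  qed measurable
  moreover have "(\<integral>\<^sup>+f. ennreal (real (Suc n)) * (G (1 + 1 / real (Suc n)) f - G 1 f) \<partial>P)
      = ennreal (real (Suc n)) * ((\<integral>\<^sup>+f. G (1 + 1 / real (Suc n)) f \<partial>P) - (\<integral>\<^sup>+f. G 1 f \<partial>P))" for n
  proof -
    have "G 1 f \<le> G (1 + 1 / real (Suc n)) f" for f
    proof -
      have pos: "0 < 1 + 1 / real (Suc n)" by (intro add_pos_nonneg) auto
      have "a f \<le> (1 + 1 / real (Suc n)) * a f" using a_nonneg[of f] by (simp add: algebra_simps)
      then show ?thesis unfolding G[OF pos] G[OF zero_less_one] by (intro ennreal_leI) auto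
    qed
    then have "(\<integral>\<^sup>+f. G (1 + 1 / real (Suc n)) f - G 1 f \<partial>P)
        = (\<integral>\<^sup>+f. G (1 + 1 / real (Suc n)) f \<partial>P) - (\<integral>\<^sup>+f. G 1 f \<partial>P)"
      using G1_fin by (intro nn_integral_diff AE_I2) (auto simp: less_top)
    then show ?thesis
      by (subst nn_integral_cmult) simp_all
  qed
  ultimately show ?thesis unfolding a_def by (simp only:)
qed

text \<open>Box masses of the tilts are right derivatives at c = 1 of expected maxima. The latter
  agree under P and Q for every positive c, hence so do the derivatives, and boxes determine the
  measure.\<close>

lemma tilt_eqI:
  assumes "0 < \<alpha>" and P [measurable_cong]: "sets P = sets Cspace" and Q [measurable_cong]: "sets Q = sets Cspace"
    and fin: "\<And>i. (\<integral>\<^sup>+f. ennreal (coord f i powr \<alpha>) \<partial>P) < \<top>"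
    and eq: "\<And>J y. finite J \<Longrightarrow> (\<And>i. 0 < y i) \<Longrightarrow> (\<integral>\<^sup>+f. max_fun \<alpha> y J f \<partial>P) = (\<integral>\<^sup>+f. max_fun \<alpha> y J f \<partial>Q)"
  shows "tilt \<alpha> P (\<lambda>f. coord f i0) = tilt \<alpha> Q (\<lambda>f. coord f i0)"
proof -
  \<comment> \<open>A single moment is the expected maximum over one index with weight 1, so
    finiteness passes from P to Q.\<close>
  have finQ: "(\<integral>\<^sup>+f. ennreal (coord f i powr \<alpha>) \<partial>Q) < \<top>" for i
    using fin[of i] eq[of "{i}" "\<lambda>_. 1"] by (simp add: max_fun_def)
  have total: "emeasure (tilt \<alpha> P (\<lambda>f. coord f i0)) Cpaths = (\<integral>\<^sup>+f. ennreal (coord f i0 powr \<alpha>) \<partial>P)"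
  proof -
    have "(\<integral>\<^sup>+f. 1 \<partial>tilt \<alpha> P (\<lambda>f. coord f i0)) = (\<integral>\<^sup>+f. ennreal (coord f i0 powr \<alpha>) * 1 \<partial>P)"
      by (rule nn_integral_tilt[OF P]) (auto simp: Cpaths_nonneg)
    then show ?thesis by simp
  qed
  show ?thesis
  proof (rule Cspace_measure_eqI)
    show "finite_measure (tilt \<alpha> P (\<lambda>f. coord f i0))"
      using fin[of i0] total by (intro finite_measureI) simp
  next
    fix J :: "((real ^ 'a) \<times> 'b) set" and x :: "(real ^ 'a) \<times> 'b \<Rightarrow> real"
    assume J: "finite J" and x: "\<And>i. 0 < x i"
    define y where "y i = x i powr (- \<alpha>)" for i
    have y: "0 < y i" for i unfolding y_def using x[of i] by simp
    have int: "(\<integral>\<^sup>+f. max_fun \<alpha> (\<lambda>i. if i = i0 then if i0 \<in> J then max c (y i0) else c else y i) (insert i0 J) f \<partial>P)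
        = (\<integral>\<^sup>+f. max_fun \<alpha> (\<lambda>i. if i = i0 then if i0 \<in> J then max c (y i0) else c else y i) (insert i0 J) f \<partial>Q)"
      if "0 < c" for c
      using J y that by (intro eq) (auto simp: less_max_iff_disj)
    have pos: "0 < 1 + 1 / real (Suc n)" for n by (intro add_pos_nonneg) auto
    have "(\<integral>\<^sup>+f. (if max_fun \<alpha> y J f \<le> ennreal (coord f i0 powr \<alpha>)
          then ennreal (coord f i0 powr \<alpha>) else 0) \<partial>P)
        = (\<integral>\<^sup>+f. (if max_fun \<alpha> y J f \<le> ennreal (coord f i0 powr \<alpha>)
          then ennreal (coord f i0 powr \<alpha>) else 0) \<partial>Q)"
      using nn_integral_max_slope[of \<alpha> P J y i0, OF assms(1) P J y fin]
        nn_integral_max_slope[of \<alpha> Q J y i0, OF assms(1) Q J y finQ]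
      unfolding int[OF pos] int[OF zero_less_one] by (rule LIMSEQ_unique)
    then show "emeasure (tilt \<alpha> P (\<lambda>f. coord f i0)) {f \<in> Cpaths. \<forall>i\<in>J. coord f i \<le> x i}
      = emeasure (tilt \<alpha> Q (\<lambda>f. coord f i0)) {f \<in> Cpaths. \<forall>i\<in>J. coord f i \<le> x i}"
      unfolding emeasure_tilt_box[OF assms(1) P J x] emeasure_tilt_box[OF assms(1) Q J x] y_def .
  qed simp_all
qed

section \<open>Invariance of expected maxima and the shift identity\<close>

text \<open>Stationarity of X as seen by the spectral law alone; see
  \<open>stationary_iff_max_fun\<close>.\<close>

definition max_fun_stationary :: "real \<Rightarrow> (real ^ 'p \<Rightarrow> real ^ 'd) measure \<Rightarrow> bool" where
  "max_fun_stationary \<alpha> P \<longleftrightarrow> (\<forall>h J y. finite J \<longrightarrow> (\<forall>i. 0 < y i) \<longrightarrow>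
    (\<integral>\<^sup>+f. max_fun \<alpha> y J (Bshift h f) \<partial>P) = (\<integral>\<^sup>+f. max_fun \<alpha> y J f \<partial>P))"

text \<open>Condition (ii) as a property of the spectral law.\<close>

definition shift_identity :: "real \<Rightarrow> (real ^ 'p \<Rightarrow> real ^ 'd) measure \<Rightarrow> bool" where
  "shift_identity \<alpha> P \<longleftrightarrow> (\<forall>h k. \<forall>\<Gamma>\<in>E0.
    (\<integral>\<^sup>+f. ennreal (f h $ k powr \<alpha>) * \<Gamma> f \<partial>P) = (\<integral>\<^sup>+f. ennreal (f 0 $ k powr \<alpha>) * \<Gamma> (Bshift h f) \<partial>P))"

text \<open>P and its image under the shift by h have the same expected maxima, hence the same tilt
  by component k at time h. For the image law, the value at h is the value at 0 of the unshifted
  path.\<close>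

lemma max_fun_stationary_imp_shift_identity:
  assumes "0 < \<alpha>" and P [measurable_cong]: "sets P = sets Cspace"
    and fin: "\<And>i. (\<integral>\<^sup>+f. ennreal (coord f i powr \<alpha>) \<partial>P) < \<top>"
    and st: "max_fun_stationary \<alpha> P"
  shows "shift_identity \<alpha> P"
  unfolding shift_identity_def
proof (intro allI ballI)
  fix h k and \<Gamma> :: "(real ^ 'a \<Rightarrow> real ^ 'b) \<Rightarrow> ennreal" assume \<Gamma>: "\<Gamma> \<in> E0"
  let ?Q = "distr P Cspace (Bshift h)"
  have B [measurable]: "Bshift h \<in> measurable P Cspace" by measurable
  have "tilt \<alpha> P (\<lambda>f. coord f (h, k)) = tilt \<alpha> ?Q (\<lambda>f. coord f (h, k))"
  proof (rule tilt_eqI[OF assms(1) P _ fin])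
    fix J :: "((real ^ 'a) \<times> 'b) set" and y :: "(real ^ 'a) \<times> 'b \<Rightarrow> real" assume J: "finite J" and "\<And>i. 0 < y i"
    then show "(\<integral>\<^sup>+f. max_fun \<alpha> y J f \<partial>P) = (\<integral>\<^sup>+f. max_fun \<alpha> y J f \<partial>?Q)"
      using st by (simp add: nn_integral_distr max_fun_stationary_def)
  qed simp
  then have "(\<integral>\<^sup>+f. \<Gamma> f \<partial>tilt \<alpha> P (\<lambda>f. f h $ k)) = (\<integral>\<^sup>+f. \<Gamma> f \<partial>tilt \<alpha> ?Q (\<lambda>f. f h $ k))"
    by simp
  also have "(\<integral>\<^sup>+f. \<Gamma> f \<partial>tilt \<alpha> ?Q (\<lambda>f. f h $ k)) = (\<integral>\<^sup>+f. ennreal (f h $ k powr \<alpha>) * \<Gamma> f \<partial>?Q)"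
    by (intro nn_integral_tilt_E0 \<Gamma>) (auto simp: Cpaths_nonneg)
  also have "\<dots> = (\<integral>\<^sup>+f. ennreal (f 0 $ k powr \<alpha>) * \<Gamma> (Bshift h f) \<partial>P)"
    using E0_measurable[OF \<Gamma>] by (simp add: nn_integral_distr) (simp add: Bshift_def)
  also have "(\<integral>\<^sup>+f. \<Gamma> f \<partial>tilt \<alpha> P (\<lambda>f. f h $ k)) = (\<integral>\<^sup>+f. ennreal (f h $ k powr \<alpha>) * \<Gamma> f \<partial>P)"
    by (intro nn_integral_tilt_E0 \<Gamma> P) (auto simp: Cpaths_nonneg)
  finally show "(\<integral>\<^sup>+f. ennreal (f h $ k powr \<alpha>) * \<Gamma> f \<partial>P)
    = (\<integral>\<^sup>+f. ennreal (f 0 $ k powr \<alpha>) * \<Gamma> (Bshift h f) \<partial>P)" .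
qed

lemma max_fun_scale:
  assumes "0 \<le> c" "finite J" "f \<in> Cpaths" and "\<And>i. 0 < y i"
  shows "max_fun \<alpha> y J (\<lambda>t. c *\<^sub>R f t) = ennreal (c powr \<alpha>) * max_fun \<alpha> y J f"
proof -
  have "max_fun \<alpha> y J (\<lambda>t. c *\<^sub>R f t) = (SUP i\<in>J. ennreal (c powr \<alpha>) * ennreal (y i * coord f i powr \<alpha>))"
    unfolding max_fun_def
    using assms
    by (intro SUP_cong) (auto simp: powr_mult Cpaths_nonneg ennreal_mult'[symmetric] less_imp_le mult_ac)
  also have "\<dots> = ennreal (c powr \<alpha>) * max_fun \<alpha> y J f"
  proof (cases "J = {}")
    case False
    then show ?thesis unfolding max_fun_def by (simp add: SUP_mult_left_ennreal)
  qed (simp add: max_fun_def bot_ennreal)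
  finally show ?thesis .
qed

text \<open>
  Ties are split evenly, so that the shares are 0-homogeneous and sum to 1.
\<close>

definition argmax_share ::
    "real \<Rightarrow> ((real ^ 'p) \<times> 'd \<Rightarrow> real) \<Rightarrow> ((real ^ 'p) \<times> 'd) set \<Rightarrow> (real ^ 'p) \<times> 'd
      \<Rightarrow> (real ^ 'p \<Rightarrow> real ^ 'd) \<Rightarrow> ennreal" where
  "argmax_share \<alpha> y J i f =
    (if ennreal (y i * coord f i powr \<alpha>) = max_fun \<alpha> y J f
     then 1 / (\<Sum>j\<in>J. if ennreal (y j * coord f j powr \<alpha>) = max_fun \<alpha> y J f then 1 else 0) else 0)"

lemma argmax_share_E0:
  assumes J: "finite J" and y: "\<And>i. 0 < y i"
  shows "argmax_share \<alpha> y J i \<in> E0"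
proof -
  have [measurable]: "max_fun \<alpha> y J \<in> borel_measurable Cspace" using J by simp
  have "argmax_share \<alpha> y J i (\<lambda>t. c *\<^sub>R f t) = argmax_share \<alpha> y J i f"
    if c: "0 < c" and f: "f \<in> Cpaths" for c f
  proof -
    have "ennreal (y j * coord (\<lambda>t. c *\<^sub>R f t) j powr \<alpha>) = ennreal (c powr \<alpha>) * ennreal (y j * coord f j powr \<alpha>)" for j
      using c y[of j] by (simp add: powr_mult Cpaths_nonneg[OF f] ennreal_mult'[symmetric] less_imp_le mult_ac)
    then have "ennreal (y j * coord (\<lambda>t. c *\<^sub>R f t) j powr \<alpha>) = max_fun \<alpha> y J (\<lambda>t. c *\<^sub>R f t)
        \<longleftrightarrow> ennreal (y j * coord f j powr \<alpha>) = max_fun \<alpha> y J f" for j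
      using c by (simp add: max_fun_scale[OF less_imp_le[OF c] J f y] ennreal_mult_cancel_left)
    then show ?thesis by (simp add: argmax_share_def)
  qed
  moreover have "argmax_share \<alpha> y J i \<in> borel_measurable Cspace"
    unfolding argmax_share_def by measurable
  ultimately show ?thesis by (simp add: E0_def)
qed

lemma max_fun_eq_sum_argmax_share:
  assumes J: "finite J"
  shows "max_fun \<alpha> y J f = (\<Sum>i\<in>J. ennreal (y i * coord f i powr \<alpha>) * argmax_share \<alpha> y J i f)"
proof (cases "J = {}")
  case False
  let ?m = "max_fun \<alpha> y J f"
  let ?A = "{i \<in> J. ennreal (y i * coord f i powr \<alpha>) = ?m}"
  have fin: "finite ?A" using J by simp
  \<comment> \<open>The maximum over a finite nonempty set is attained, which keeps the number of
    tied indices, the divisor of the shares, positive.\<close>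
  have "?m \<in> (\<lambda>i. ennreal (y i * coord f i powr \<alpha>)) ` J"
  proof -
    have "?m = Max ((\<lambda>i. ennreal (y i * coord f i powr \<alpha>)) ` J)"
      unfolding max_fun_def using J False by (simp add: Max_Sup)
    also have "\<dots> \<in> (\<lambda>i. ennreal (y i * coord f i powr \<alpha>)) ` J"
      using J False by (intro Max_in) auto
    finally show ?thesis .
  qed
  then obtain i where "?m = ennreal (y i * coord f i powr \<alpha>)" "i \<in> J" by (rule imageE)
  then have "i \<in> ?A" by simp
  then have ne: "?A \<noteq> {}" by blast
  have count: "(\<Sum>j\<in>J. if ennreal (y j * coord f j powr \<alpha>) = ?m then 1 else 0) = (of_nat (card ?A) :: ennreal)"
    using J by (simp add: sum.If_cases Int_def)
  have "(\<Sum>i\<in>J. ennreal (y i * coord f i powr \<alpha>) * argmax_share \<alpha> y J i f)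
      = (\<Sum>i\<in>?A. ?m * (1 / of_nat (card ?A)))"
    unfolding argmax_share_def count using J
    by (intro sum.mono_neutral_cong_right) auto
  also have "\<dots> = of_nat (card ?A) * (?m * (1 / of_nat (card ?A)))" by simp
  also have "\<dots> = ?m * (of_nat (card ?A) / of_nat (card ?A))"
    by (simp add: divide_ennreal_def mult_ac)
  also have "of_nat (card ?A) / of_nat (card ?A) = (1 :: ennreal)"
    using fin ne by (intro ennreal_divide_self) (auto simp: ennreal_of_nat_eq_real_of_nat card_gt_0_iff)
  finally show ?thesis by simp
qed (simp add: max_fun_def bot_ennreal)

text \<open>In the maximum of the path shifted by g, the term i is evaluated at time
  \<open>fst i - g\<close>. The identity brings this time to 0, turning the shift by g in the share
  into a total shift by \<open>fst i\<close>. Now g has disappeared, so all shifts have the same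
  expected maximum.\<close>

lemma shift_identity_imp_max_fun_stationary:
  assumes P [measurable_cong]: "sets P = sets Cspace" and id: "shift_identity \<alpha> P"
  shows "max_fun_stationary \<alpha> P"
  unfolding max_fun_stationary_def
proof (intro allI impI)
  fix h and J :: "((real ^ 'a) \<times> 'b) set" and y :: "(real ^ 'a) \<times> 'b \<Rightarrow> real"
  assume J: "finite J" and y: "\<forall>i. 0 < y i"
  let ?\<Gamma> = "argmax_share \<alpha> y J"
  have \<Gamma>: "?\<Gamma> i \<in> E0" for i using J y by (intro argmax_share_E0) blast+
  note [measurable] = E0_measurable[OF \<Gamma>]
  have "(\<integral>\<^sup>+f. max_fun \<alpha> y J (Bshift g f) \<partial>P)
    = (\<Sum>i\<in>J. ennreal (y i) * (\<integral>\<^sup>+f. ennreal (f 0 $ snd i powr \<alpha>) * ?\<Gamma> i (Bshift (fst i) f) \<partial>P))" for g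
  proof -
    have "(\<integral>\<^sup>+f. max_fun \<alpha> y J (Bshift g f) \<partial>P)
      = (\<integral>\<^sup>+f. (\<Sum>i\<in>J. ennreal (y i) * (ennreal (f (fst i - g) $ snd i powr \<alpha>) * ?\<Gamma> i (Bshift g f))) \<partial>P)"
      by (subst max_fun_eq_sum_argmax_share[OF J])
        (simp add: Bshift_def ennreal_mult'[OF less_imp_le[OF y[rule_format]]] mult.assoc)
    also have "\<dots> = (\<Sum>i\<in>J. \<integral>\<^sup>+f. ennreal (y i) * (ennreal (f (fst i - g) $ snd i powr \<alpha>) * ?\<Gamma> i (Bshift g f)) \<partial>P)"
      by (rule nn_integral_sum) measurable
    also have "\<dots> = (\<Sum>i\<in>J. ennreal (y i) * (\<integral>\<^sup>+f. ennreal (f (fst i - g) $ snd i powr \<alpha>) * ?\<Gamma> i (Bshift g f) \<partial>P))"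
      by (intro sum.cong refl nn_integral_cmult) measurable
    also have "\<dots> = (\<Sum>i\<in>J. ennreal (y i) * (\<integral>\<^sup>+f. ennreal (f 0 $ snd i powr \<alpha>) * ?\<Gamma> i (Bshift (fst i) f) \<partial>P))"
    proof (intro sum.cong refl arg_cong2[where f = "(*)"])
      fix i
      show "(\<integral>\<^sup>+f. ennreal (f (fst i - g) $ snd i powr \<alpha>) * ?\<Gamma> i (Bshift g f) \<partial>P)
        = (\<integral>\<^sup>+f. ennreal (f 0 $ snd i powr \<alpha>) * ?\<Gamma> i (Bshift (fst i) f) \<partial>P)"
        using id[unfolded shift_identity_def, rule_format, OF E0_Bshift[OF \<Gamma>], of "fst i - g" "snd i" i g]
        by (simp add: Bshift_Bshift)
    qed
    finally show ?thesis .
  qed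
  from this[of h] this[of 0]
  show "(\<integral>\<^sup>+f. max_fun \<alpha> y J (Bshift h f) \<partial>P) = (\<integral>\<^sup>+f. max_fun \<alpha> y J f \<partial>P)" by simp
qed

section \<open>Condition (iii)\<close>

lemma is_norm_nonneg: "is_norm nrm \<Longrightarrow> 0 \<le> nrm x"
  and is_norm_eq_0_iff: "is_norm nrm \<Longrightarrow> nrm x = 0 \<longleftrightarrow> x = 0"
  and is_norm_scale: "is_norm nrm \<Longrightarrow> nrm (c *\<^sub>R x) = \<bar>c\<bar> * nrm x"
  and is_norm_triangle: "is_norm nrm \<Longrightarrow> nrm (x + y) \<le> nrm x + nrm y"
  by (auto simp: is_norm_def)

lemma is_norm_continuous:
  fixes nrm :: "real ^ 'd \<Rightarrow> real"
  assumes n: "is_norm nrm"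
  shows "continuous_on UNIV nrm"
proof -
  define B where "B = (\<Sum>k\<in>UNIV. nrm (axis k 1))"
  have B_nonneg: "0 \<le> B" unfolding B_def by (intro sum_nonneg is_norm_nonneg n)
  have sum_le: "nrm (\<Sum>k\<in>A. g k) \<le> (\<Sum>k\<in>A. nrm (g k))" if "finite A" for A and g :: "'d \<Rightarrow> real ^ 'd"
    using that
  proof (induction A rule: finite_induct)
    case empty
    then show ?case using is_norm_eq_0_iff[OF n, of 0] by simp
  next
    case (insert a A)
    then show ?case using is_norm_triangle[OF n, of "g a" "\<Sum>k\<in>A. g k"] by simp
  qed
  have bound: "nrm x \<le> B * norm x" for x
  proof -
    have "x = (\<Sum>k\<in>UNIV. x $ k *\<^sub>R axis k 1)"
      using basis_expansion[of x] by (simp add: scalar_mult_eq_scaleR)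
    then have "nrm x \<le> (\<Sum>k\<in>UNIV. nrm (x $ k *\<^sub>R axis k 1))" by (metis sum_le finite)
    also have "\<dots> \<le> (\<Sum>k\<in>UNIV. norm x * nrm (axis k 1))"
      by (intro sum_mono) (auto simp: is_norm_scale[OF n] component_le_norm_cart intro!: mult_right_mono is_norm_nonneg[OF n])
    finally show ?thesis by (simp add: B_def sum_distrib_left mult.commute)
  qed
  have "B-lipschitz_on UNIV nrm"
  proof (rule lipschitz_onI)
    fix x y
    have "nrm x \<le> nrm y + nrm (x - y)" using is_norm_triangle[OF n, of y "x - y"] by simp
    moreover have "nrm y \<le> nrm x + nrm (x - y)"
      using is_norm_triangle[OF n, of x "y - x"] is_norm_scale[OF n, of "- 1" "x - y"] by simp
    ultimately show "dist (nrm x) (nrm y) \<le> B * dist x y"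
      using bound[of "x - y"] by (simp add: dist_norm abs_le_iff)
  qed (rule B_nonneg)
  then show ?thesis by (rule lipschitz_on_continuous_on)
qed

lemma is_norm_measurable: "is_norm nrm \<Longrightarrow> nrm \<in> borel_measurable borel"
  using is_norm_continuous by (rule borel_measurable_continuous_onI)

text \<open>The norm attains a positive minimum on the Euclidean unit sphere. Together with the
  constant \<alpha>-moment of the norm this bounds the component moments uniformly in time.\<close>

lemma is_norm_component_bound:
  fixes nrm :: "real ^ 'd \<Rightarrow> real"
  assumes n: "is_norm nrm"
  obtains K where "0 < K" "\<And>x k. \<bar>x $ k\<bar> \<le> K * nrm x"
proof -
  have "(axis undefined 1 :: real ^ 'd) \<in> sphere 0 1" by (simp add: norm_axis_1)
  then have "sphere (0 :: real ^ 'd) 1 \<noteq> {}" by blast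
  then obtain u where u: "u \<in> sphere (0 :: real ^ 'd) 1" and min: "\<And>x. x \<in> sphere 0 1 \<Longrightarrow> nrm u \<le> nrm x"
    using continuous_attains_inf[OF compact_sphere _ continuous_on_subset[OF is_norm_continuous[OF n] subset_UNIV]]
    by blast
  have "u \<noteq> 0" using u by auto
  then have pos: "0 < nrm u"
    using is_norm_nonneg[OF n, of u] is_norm_eq_0_iff[OF n, of u] by linarith
  have "\<bar>x $ k\<bar> \<le> (1 / nrm u) * nrm x" for x k
  proof (cases "x = 0")
    case False
    have "nrm u \<le> nrm (x /\<^sub>R norm x)" using False by (intro min) simp
    also have "\<dots> = nrm x / norm x" by (simp add: is_norm_scale[OF n] divide_inverse mult.commute)
    finally have "norm x \<le> nrm x / nrm u" using False pos by (simp add: field_simps)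
    then show ?thesis using component_le_norm_cart[of x k] by simp
  qed (use is_norm_eq_0_iff[OF n, of 0] in simp)
  then show ?thesis using that[of "1 / nrm u"] pos by simp
qed

section \<open>Componentwise tilted laws\<close>

lemma nn_integral_tilted_comp_law:
  fixes Z :: "'b \<Rightarrow> real ^ 'p \<Rightarrow> real ^ 'd"
  assumes Z [measurable]: "Z \<in> measurable N Cspace" and g [measurable]: "g \<in> borel_measurable Cspace"
    and a: "(\<integral>\<^sup>+\<omega>. ennreal (Z \<omega> h $ k powr \<alpha>) \<partial>N) = ennreal a" "0 < a"
  shows "(\<integral>\<^sup>+f. g f \<partial>tilted_comp_law \<alpha> N Z h k)
    = (\<integral>\<^sup>+f. ennreal (f h $ k powr \<alpha>) * g (\<lambda>t. f t /\<^sub>R f h $ k) \<partial>distr N Cspace Z) / ennreal a"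
proof -
  have m: "(\<lambda>f t. f t /\<^sub>R f h $ k) \<in> measurable Cspace (Cspace :: (real ^ 'p \<Rightarrow> real ^ 'd) measure)"
    by (rule normalise_measurable) (auto simp: Cpaths_nonneg)
  have [measurable]: "(\<lambda>\<omega> t. Z \<omega> t /\<^sub>R Z \<omega> h $ k) \<in> measurable N Cspace"
    by (rule measurable_compose[OF Z m])
  have [measurable]: "(\<lambda>f. g (\<lambda>t. f t /\<^sub>R f h $ k)) \<in> borel_measurable Cspace"
    by (rule measurable_compose[OF m g])
  have "(\<integral>\<^sup>+f. g f \<partial>tilted_comp_law \<alpha> N Z h k)
      = (\<integral>\<^sup>+\<omega>. ennreal (Z \<omega> h $ k powr \<alpha>) / ennreal a * g (\<lambda>t. Z \<omega> t /\<^sub>R Z \<omega> h $ k) \<partial>N)"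
    unfolding tilted_comp_law_def a(1) using a(2) by (simp add: nn_integral_distr nn_integral_density)
  also have "\<dots> = (\<integral>\<^sup>+\<omega>. ennreal (Z \<omega> h $ k powr \<alpha>) * g (\<lambda>t. Z \<omega> t /\<^sub>R Z \<omega> h $ k) / ennreal a \<partial>N)"
    by (simp add: divide_ennreal_def mult_ac)
  also have "\<dots> = (\<integral>\<^sup>+\<omega>. ennreal (Z \<omega> h $ k powr \<alpha>) * g (\<lambda>t. Z \<omega> t /\<^sub>R Z \<omega> h $ k) \<partial>N) / ennreal a"
    by (rule nn_integral_divide) measurable
  finally show ?thesis by (simp add: nn_integral_distr)
qed

lemma sets_tilted_comp_law [simp]: "sets (tilted_comp_law \<alpha> N Z h k) = sets Cspace"
  by (simp add: tilted_comp_law_def)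

lemma nn_integral_tilted_comp_law_E0:
  fixes Z :: "'b \<Rightarrow> real ^ 'p \<Rightarrow> real ^ 'd"
  assumes Z: "Z \<in> measurable N Cspace" and \<Gamma>: "\<Gamma> \<in> E0"
    and a: "(\<integral>\<^sup>+\<omega>. ennreal (Z \<omega> h $ k powr \<alpha>) \<partial>N) = ennreal a" "0 < a"
  shows "(\<integral>\<^sup>+f. \<Gamma> f \<partial>tilted_comp_law \<alpha> N Z h k)
    = (\<integral>\<^sup>+f. ennreal (f h $ k powr \<alpha>) * \<Gamma> f \<partial>distr N Cspace Z) / ennreal a"
proof -
  have "(\<integral>\<^sup>+f. ennreal (f h $ k powr \<alpha>) * \<Gamma> (\<lambda>t. f t /\<^sub>R f h $ k) \<partial>distr N Cspace Z)
      = (\<integral>\<^sup>+f. ennreal (f h $ k powr \<alpha>) * \<Gamma> f \<partial>distr N Cspace Z)"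
    using nn_integral_tilt[of "distr N Cspace Z" "\<lambda>f. f h $ k" \<Gamma> \<alpha>]
      nn_integral_tilt_E0[of "distr N Cspace Z" "\<lambda>f. f h $ k" \<Gamma> \<alpha>] E0_measurable[OF \<Gamma>] \<Gamma>
    by (simp add: Cpaths_nonneg)
  then show ?thesis
    using nn_integral_tilted_comp_law[OF Z E0_measurable[OF \<Gamma>] a] by simp
qed

lemma E0_const: "(\<lambda>_. c) \<in> E0"
  by (simp add: E0_def)

text \<open>With the constant functional 1 the identity makes the moment of component k independent
  of time, so the normalising constants agree. The remaining functional, the indicator of A after
  division by the value at h, is 0-homogeneous.\<close>

lemma shift_identity_imp_tilted_comp_law:
  fixes Z :: "'b \<Rightarrow> real ^ 'p \<Rightarrow> real ^ 'd"
  assumes Z: "Z \<in> measurable N Cspace"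
    and a: "\<And>h k. (\<integral>\<^sup>+\<omega>. ennreal (Z \<omega> h $ k powr \<alpha>) \<partial>N) = ennreal (a h k)" "\<And>h k. 0 < a h k"
    and id: "shift_identity \<alpha> (distr N Cspace Z)"
  shows "tilted_comp_law \<alpha> N Z h k = distr (tilted_comp_law \<alpha> N Z 0 k) Cspace (Bshift h)"
proof (rule measure_eqI)
  note [measurable] = Z
  let ?P = "distr N Cspace Z"
  have "ennreal (a h k) = ennreal (a 0 k)"
    using id[unfolded shift_identity_def, rule_format, OF E0_const[of 1], of h k]
    by (simp add: a(1)[symmetric] nn_integral_distr)
  then have a_eq: "a h k = a 0 k" using a(2)[of h k] a(2)[of 0 k] by simp
  fix A assume "A \<in> sets (tilted_comp_law \<alpha> N Z h k)"
  then have A [measurable]: "A \<in> sets Cspace" by simp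
  have m: "(\<lambda>f t. f t /\<^sub>R f h $ k) \<in> measurable Cspace (Cspace :: (real ^ 'p \<Rightarrow> real ^ 'd) measure)"
    by (rule normalise_measurable) (auto simp: Cpaths_nonneg)
  have [measurable]: "Bshift h \<in> measurable (tilted_comp_law \<alpha> N Z 0 k) Cspace"
    by (simp cong: measurable_cong_sets)
  have indA: "(\<lambda>f. indicator A (\<lambda>t. f t /\<^sub>R f h $ k) :: ennreal) \<in> E0"
    using measurable_compose[OF m borel_measurable_indicator[OF A]]
    by (simp add: E0_def inverse_eq_divide)
  have "emeasure (tilted_comp_law \<alpha> N Z h k) A = (\<integral>\<^sup>+f. indicator A f \<partial>tilted_comp_law \<alpha> N Z h k)"
    by simp
  also have "\<dots> = (\<integral>\<^sup>+f. ennreal (f h $ k powr \<alpha>) * indicator A (\<lambda>t. f t /\<^sub>R f h $ k) \<partial>?P) / ennreal (a h k)"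
    by (intro nn_integral_tilted_comp_law Z a) simp
  also have "\<dots> = (\<integral>\<^sup>+f. ennreal (f 0 $ k powr \<alpha>) * indicator A (Bshift h (\<lambda>t. f t /\<^sub>R f 0 $ k)) \<partial>?P) / ennreal (a 0 k)"
    using id[unfolded shift_identity_def, rule_format, OF indA, of h k]
    by (simp add: a_eq Bshift_def)
  also have "\<dots> = (\<integral>\<^sup>+f. indicator A (Bshift h f) \<partial>tilted_comp_law \<alpha> N Z 0 k)"
    by (intro nn_integral_tilted_comp_law[symmetric] Z a) simp
  also have "\<dots> = (\<integral>\<^sup>+f. indicator A f \<partial>distr (tilted_comp_law \<alpha> N Z 0 k) Cspace (Bshift h))"
    by (rule nn_integral_distr[symmetric]) auto
  finally show "emeasure (tilted_comp_law \<alpha> N Z h k) A = emeasure (distr (tilted_comp_law \<alpha> N Z 0 k) Cspace (Bshift h)) A"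
    by simp
qed simp

section \<open>Constancy of the normalising moments\<close>

text \<open>Only the increment has to be small, so adding a small g repeatedly gives the power
  \<open>c g ^ n\<close> at n g. Boundedness forces \<open>c g \<le> 1\<close>, likewise for -g, and
  the two values multiply to 1. A general h is n times the small vector h / n.\<close>

lemma locally_multiplicative_bounded_eq_1:
  fixes c :: "'a :: real_normed_vector \<Rightarrow> real"
  assumes pos: "\<And>h. 0 < c h" and c0: "c 0 = 1" and bound: "\<And>h. c h \<le> B"
    and "0 < \<delta>" and mult: "\<And>h g. norm g < \<delta> \<Longrightarrow> c (h + g) = c h * c g"
  shows "c h = 1"
proof -
  have pow: "c (real n *\<^sub>R g) = c g ^ n" if "norm g < \<delta>" for g n
  proof (induction n)
    case (Suc n)
    then show ?case using mult[OF that, of "real n *\<^sub>R g"] by (simp add: algebra_simps)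
  qed (simp add: c0)
  have le: "c g \<le> 1" if "norm g < \<delta>" for g
  proof (rule ccontr)
    assume "\<not> c g \<le> 1"
    then obtain n where "B < c g ^ n" using real_arch_pow[of "c g" B] by auto
    then show False using pow[OF that, of n] bound[of "real n *\<^sub>R g"] by simp
  qed
  have one: "c g = 1" if "norm g < \<delta>" for g
  proof -
    have "c g * c (- g) = 1" using mult[of "- g" g] that c0 by simp
    moreover have "c g * c (- g) \<le> c g" using le[of "- g"] that pos[of g] by simp
    ultimately show ?thesis using le[OF that] by linarith
  qed
  obtain n :: nat where n: "norm h / \<delta> < real n" using reals_Archimedean2 by blast
  have "0 < real n" using n \<open>0 < \<delta>\<close> by (meson divide_nonneg_pos norm_ge_zero order_le_less_trans)
  then have "norm (h /\<^sub>R real n) < \<delta>" using n \<open>0 < \<delta>\<close> by (simp add: field_simps)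
  from pow[OF this, of n] one[OF this] show ?thesis using \<open>0 < real n\<close> by simp
qed

text \<open>The mean of Z_k(h+g)^\<alpha> on the event Z_k(h) > 0 is computed in two ways. Moving
  h+g to 0 at once gives c(h+g) D. Writing it as Z_k(h)^\<alpha> times the \<alpha>-power of the
  ratio Z_k(h+g) / Z_k(h), a homogeneous functional, and moving first h and then g to 0 gives c(h)
  c(g) D. Here D is the mean of Z_k(0)^\<alpha> on Z_k(-g) > 0, and it can be cancelled when
  positive and finite.\<close>

lemma scaled_shift_identity_cocycle:
  fixes P :: "(real ^ 'p \<Rightarrow> real ^ 'd) measure"
  assumes P [measurable_cong]: "sets P = sets Cspace" and "0 < \<alpha>"
    and id: "\<And>h \<Gamma>. \<Gamma> \<in> E0 \<Longrightarrow> (\<integral>\<^sup>+f. ennreal (f h $ k powr \<alpha>) * \<Gamma> f \<partial>P)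
      = ennreal (c h) * (\<integral>\<^sup>+f. ennreal (f 0 $ k powr \<alpha>) * \<Gamma> (Bshift h f) \<partial>P)"
    and c: "\<And>h. 0 < c h"
    and fin: "(\<integral>\<^sup>+f. ennreal (f 0 $ k powr \<alpha>) \<partial>P) < \<top>"
    and pos: "(\<integral>\<^sup>+f. ennreal (f 0 $ k powr \<alpha>) * of_bool (0 < f (- g) $ k) \<partial>P) \<noteq> 0" (is "?D \<noteq> 0")
  shows "c (h + g) = c h * c g"
proof -
  have space: "f \<in> Cpaths" if "f \<in> space P" for f using that sets_eq_imp_space_eq[OF P] by simp
  have ratio: "(\<lambda>f. ennreal ((f (s + g) $ k / f s $ k) powr \<alpha>)) \<in> E0" for s
    unfolding E0_def by simp
  have ind: "(\<lambda>f. of_bool (0 < f s $ k) :: ennreal) \<in> E0" for s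
    unfolding E0_def by (simp add: zero_less_mult_iff)
  \<comment> \<open>At a zero of the denominator both sides are 0, since
    \<open>0 powr \<alpha> = 0\<close>; this is where the indicator comes from.\<close>
  have swap: "ennreal (f s $ k powr \<alpha>) * ennreal ((f (s + g) $ k / f s $ k) powr \<alpha>)
      = ennreal (f (s + g) $ k powr \<alpha>) * of_bool (0 < f s $ k)" if "f \<in> Cpaths" for f :: "real ^ 'p \<Rightarrow> real ^ 'd" and s
    using Cpaths_nonneg[OF that, of s k] Cpaths_nonneg[OF that, of "s + g" k]
    by (cases "f s $ k = 0") (auto simp: ennreal_mult'[symmetric] powr_mult[symmetric])
  have "(\<integral>\<^sup>+f. ennreal (f (h + g) $ k powr \<alpha>) * of_bool (0 < f h $ k) \<partial>P)
      = (\<integral>\<^sup>+f. ennreal (f h $ k powr \<alpha>) * ennreal ((f (h + g) $ k / f h $ k) powr \<alpha>) \<partial>P)"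
    by (intro nn_integral_cong swap[symmetric] space)
  also have "\<dots> = ennreal (c h) * (\<integral>\<^sup>+f. ennreal (f 0 $ k powr \<alpha>) * ennreal ((f (0 + g) $ k / f 0 $ k) powr \<alpha>) \<partial>P)"
    by (subst id[OF ratio]) (simp add: Bshift_def)
  also have "(\<integral>\<^sup>+f. ennreal (f 0 $ k powr \<alpha>) * ennreal ((f (0 + g) $ k / f 0 $ k) powr \<alpha>) \<partial>P)
      = (\<integral>\<^sup>+f. ennreal (f (0 + g) $ k powr \<alpha>) * of_bool (0 < f 0 $ k) \<partial>P)"
    by (intro nn_integral_cong swap space)
  also have "\<dots> = ennreal (c g) * ?D"
    by (subst id[OF ind]) (simp add: Bshift_def)
  finally have 1: "(\<integral>\<^sup>+f. ennreal (f (h + g) $ k powr \<alpha>) * of_bool (0 < f h $ k) \<partial>P)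
      = ennreal (c h) * (ennreal (c g) * ?D)" .
  have 2: "(\<integral>\<^sup>+f. ennreal (f (h + g) $ k powr \<alpha>) * of_bool (0 < f h $ k) \<partial>P) = ennreal (c (h + g)) * ?D"
    by (subst id[OF ind]) (simp add: Bshift_def)
  have "?D \<le> (\<integral>\<^sup>+f. ennreal (f 0 $ k powr \<alpha>) \<partial>P)"
    by (intro nn_integral_mono) (simp add: of_bool_def)
  then have "?D < \<top>" using fin by (rule order_le_less_trans)
  then obtain d where d: "?D = ennreal d" "0 \<le> d" by (cases ?D) auto
  with pos have "0 < d" by (cases "d = 0") auto
  have "ennreal (c (h + g) * d) = ennreal (c h * c g * d)"
    using 1 2 c d by (simp add: ennreal_mult less_imp_le mult.assoc)
  then show ?thesis
    using c[of "h + g"] c[of h] c[of g] \<open>0 < d\<close> by (simp add: ennreal_inj)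
qed

text \<open>If it failed along a sequence g n tending to 0, then almost every path with a positive
  value at 0 would vanish at all times - g n, and by continuity at 0 as well.\<close>

lemma near_zero_mass_pos:
  fixes P :: "(real ^ 'p \<Rightarrow> real ^ 'd) measure"
  assumes P [measurable_cong]: "sets P = sets Cspace"
    and pos: "(\<integral>\<^sup>+f. ennreal (f 0 $ k powr \<alpha>) \<partial>P) \<noteq> 0"
  obtains \<delta> where "0 < \<delta>"
    "\<And>g. norm g < \<delta> \<Longrightarrow> (\<integral>\<^sup>+f. ennreal (f 0 $ k powr \<alpha>) * of_bool (0 < f (- g) $ k) \<partial>P) \<noteq> 0"
proof -
  have "\<exists>\<delta>>0. \<forall>g. norm g < \<delta> \<longrightarrow> (\<integral>\<^sup>+f. ennreal (f 0 $ k powr \<alpha>) * of_bool (0 < f (- g) $ k) \<partial>P) \<noteq> 0"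
  proof (rule ccontr)
    define Q where "Q g \<longleftrightarrow> (\<integral>\<^sup>+f. ennreal (f 0 $ k powr \<alpha>) * of_bool (0 < f (- g) $ k) \<partial>P) = 0" for g
    assume "\<not> ?thesis"
    then have *: "\<exists>g. norm g < \<delta> \<and> Q g" if "0 < \<delta>" for \<delta>
      using that unfolding Q_def by blast
    have "\<forall>n. \<exists>g. norm g < 1 / real (Suc n) \<and> Q g"
      using *[of "1 / real (Suc n)" for n] by simp
    then obtain g where "\<forall>n. norm (g n) < 1 / real (Suc n) \<and> Q (g n)"
      by (rule choice[THEN exE])
    then have g: "\<And>n. norm (g n) < 1 / real (Suc n)"
      and zero: "\<And>n. (\<integral>\<^sup>+f. ennreal (f 0 $ k powr \<alpha>) * of_bool (0 < f (- g n) $ k) \<partial>P) = 0"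
      unfolding Q_def by blast+
    have "(\<lambda>n. norm (g n)) \<longlonglongrightarrow> 0"
      by (rule tendsto_sandwich[OF _ _ tendsto_const LIMSEQ_Suc[OF lim_1_over_n]])
        (use g in \<open>auto intro!: always_eventually less_imp_le simp del: of_nat_Suc\<close>)
    then have "g \<longlonglongrightarrow> 0" by (rule tendsto_norm_zero_cancel)
    then have g0: "(\<lambda>n. - g n) \<longlonglongrightarrow> 0" using tendsto_minus by fastforce
    have "AE f in P. ennreal (f 0 $ k powr \<alpha>) * of_bool (0 < f (- g n) $ k) = 0" for n
      using zero[of n] by (subst (asm) nn_integral_0_iff_AE) auto
    then have "AE f in P. \<forall>n. ennreal (f 0 $ k powr \<alpha>) * of_bool (0 < f (- g n) $ k) = 0"
      unfolding AE_all_countable by blast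
    then have "AE f in P. ennreal (f 0 $ k powr \<alpha>) = 0"
    proof (rule AE_mp, intro AE_I2 impI)
      fix f assume f: "f \<in> space P" and z: "\<forall>n. ennreal (f 0 $ k powr \<alpha>) * of_bool (0 < f (- g n) $ k) = 0"
      have fC: "f \<in> Cpaths" using f sets_eq_imp_space_eq[OF P] by simp
      show "ennreal (f 0 $ k powr \<alpha>) = 0"
      proof (rule ccontr)
        assume "ennreal (f 0 $ k powr \<alpha>) \<noteq> 0"
        with z have "\<not> 0 < f (- g n) $ k" for n by auto
        then have "f (- g n) $ k = 0" for n
          using Cpaths_nonneg[OF fC, of "- g n" k] by (simp add: less_eq_real_def)
        moreover have "(\<lambda>n. f (- g n) $ k) \<longlonglongrightarrow> f 0 $ k"
          using Cpaths_continuous[OF fC] g0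
          by (intro tendsto_vec_nth isCont_tendsto_compose[of _ f]) (auto simp: continuous_on_eq_continuous_at)
        ultimately have "f 0 $ k = 0" by (simp add: LIMSEQ_const_iff)
        then show False using \<open>ennreal (f 0 $ k powr \<alpha>) \<noteq> 0\<close> by simp
      qed
    qed
    then have "(\<integral>\<^sup>+f. ennreal (f 0 $ k powr \<alpha>) \<partial>P) = 0"
      by (subst nn_integral_0_iff_AE) auto
    with pos show False by simp
  qed
  then show ?thesis using that by blast
qed

lemma tilted_comp_law_imp_shift_identity:
  fixes Z :: "'b \<Rightarrow> real ^ 'p \<Rightarrow> real ^ 'd"
  assumes "0 < \<alpha>" and Z [measurable]: "Z \<in> measurable N Cspace"
    and a: "\<And>h k. (\<integral>\<^sup>+\<omega>. ennreal (Z \<omega> h $ k powr \<alpha>) \<partial>N) = ennreal (a h k)" "\<And>h k. 0 < a h k"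
    and bound: "\<And>h k. a h k \<le> B"
    and eq: "\<And>h k. tilted_comp_law \<alpha> N Z h k = distr (tilted_comp_law \<alpha> N Z 0 k) Cspace (Bshift h)"
  shows "shift_identity \<alpha> (distr N Cspace Z)"
  unfolding shift_identity_def
proof (intro allI ballI)
  fix h k and \<Gamma> :: "(real ^ 'p \<Rightarrow> real ^ 'd) \<Rightarrow> ennreal" assume \<Gamma>: "\<Gamma> \<in> E0"
  let ?P = "distr N Cspace Z"
  define c where "c h = a h k / a 0 k" for h
  have c: "0 < c h" for h using a(2) by (simp add: c_def)
  \<comment> \<open>Homogeneous functionals ignore the rescaling in the tilted laws, so that (iii)
    yields (ii) up to the ratio \<open>c h\<close> of the normalising moments.\<close>
  have id: "(\<integral>\<^sup>+f. ennreal (f h $ k powr \<alpha>) * \<Gamma> f \<partial>?P)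
      = ennreal (c h) * (\<integral>\<^sup>+f. ennreal (f 0 $ k powr \<alpha>) * \<Gamma> (Bshift h f) \<partial>?P)"
    if \<Gamma>: "\<Gamma> \<in> E0" for h \<Gamma>
  proof -
    have [measurable]: "Bshift h \<in> measurable (tilted_comp_law \<alpha> N Z 0 k) Cspace"
      by (simp cong: measurable_cong_sets)
    let ?X = "\<integral>\<^sup>+f. ennreal (f h $ k powr \<alpha>) * \<Gamma> f \<partial>?P"
    let ?Y = "\<integral>\<^sup>+f. ennreal (f 0 $ k powr \<alpha>) * \<Gamma> (Bshift h f) \<partial>?P"
    have "?X / ennreal (a h k) = (\<integral>\<^sup>+f. \<Gamma> f \<partial>tilted_comp_law \<alpha> N Z h k)"
      by (intro nn_integral_tilted_comp_law_E0[symmetric] Z a \<Gamma>)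
    also have "\<dots> = (\<integral>\<^sup>+f. \<Gamma> (Bshift h f) \<partial>tilted_comp_law \<alpha> N Z 0 k)"
      unfolding eq[of h k] using E0_measurable[OF \<Gamma>] by (subst nn_integral_distr) auto
    also have "\<dots> = ?Y / ennreal (a 0 k)"
      by (intro nn_integral_tilted_comp_law_E0 Z a E0_Bshift \<Gamma>)
    finally have "ennreal (a h k) * (?X / ennreal (a h k)) = ennreal (a h k) * (?Y / ennreal (a 0 k))"
      by simp
    moreover have "ennreal (a h k) * (?X / ennreal (a h k)) = ?X"
      using a(2)[of h k] by (simp add: ennreal_times_divide ennreal_mult_divide_eq mult.commute[of "ennreal (a h k)"])
    moreover have "ennreal (a h k) * (?Y / ennreal (a 0 k)) = ennreal (c h) * ?Y"
      using a(2)[of h k] a(2)[of 0 k]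
      by (simp add: c_def divide_ennreal[symmetric] divide_ennreal_def mult_ac less_imp_le)
    ultimately show ?thesis by simp
  qed
  have P0: "(\<integral>\<^sup>+f. ennreal (f 0 $ k powr \<alpha>) \<partial>?P) = ennreal (a 0 k)"
    using a(1)[of 0 k] by (simp add: nn_integral_distr)
  obtain \<delta> where \<delta>: "0 < \<delta>"
    and near: "\<And>g. norm g < \<delta> \<Longrightarrow> (\<integral>\<^sup>+f. ennreal (f 0 $ k powr \<alpha>) * of_bool (0 < f (- g) $ k) \<partial>?P) \<noteq> 0"
    by (rule near_zero_mass_pos[of ?P k \<alpha>]) (use P0 a(2)[of 0 k] in auto)
  have "c h = 1" for h
  proof (rule locally_multiplicative_bounded_eq_1[OF c])
    show "c 0 = 1" using a(2)[of 0 k] by (simp add: c_def)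
    show "c h \<le> B / a 0 k" for h using bound a(2)[of 0 k] by (simp add: c_def divide_right_mono less_imp_le)
    show "c (h + g) = c h * c g" if "norm g < \<delta>" for h g
      by (rule scaled_shift_identity_cocycle[OF _ assms(1) id c _ near[OF that]]) (auto simp: P0)
  qed (rule \<delta>)
  then show "(\<integral>\<^sup>+f. ennreal (f h $ k powr \<alpha>) * \<Gamma> f \<partial>?P)
      = (\<integral>\<^sup>+f. ennreal (f 0 $ k powr \<alpha>) * \<Gamma> (Bshift h f) \<partial>?P)"
    using id[OF \<Gamma>, of h] by simp
qed

section \<open>Condition (i)\<close>

text \<open>The series in the denominator of Z_W, before the root, as an integral in
  [0, \<infinity>]. Divergence becomes the value \<infinity>, and Fubini applies.\<close>

definition pmf_norm ::
    "(real ^ 'd \<Rightarrow> real) \<Rightarrow> real \<Rightarrow> (real ^ 'p) pmf \<Rightarrow> (real ^ 'p \<Rightarrow> real ^ 'd) \<Rightarrow> ennreal" where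
  "pmf_norm nrm \<alpha> W f = (\<integral>\<^sup>+s. ennreal (nrm (f s) powr \<alpha>) \<partial>measure_pmf W)"

definition pmf_normalise ::
    "(real ^ 'd \<Rightarrow> real) \<Rightarrow> real \<Rightarrow> (real ^ 'p) pmf \<Rightarrow> (real ^ 'p \<Rightarrow> real ^ 'd) \<Rightarrow> (real ^ 'p \<Rightarrow> real ^ 'd)" where
  "pmf_normalise nrm \<alpha> W f = (\<lambda>t. f t /\<^sub>R (enn2real (pmf_norm nrm \<alpha> W f) powr (1 / \<alpha>)))"

text \<open>The default values fit in the divergent case: \<open>infsum\<close> is then 0, and so is
  \<open>enn2real\<close> of \<infinity>.\<close>

lemma infsum_pmf_eq_nn_integral:
  fixes u :: "'a \<Rightarrow> real"
  assumes "set_pmf W = S" and u: "\<And>s. 0 \<le> u s"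
  shows "(\<Sum>\<^sub>\<infinity>s\<in>S. u s * pmf W s) = enn2real (\<integral>\<^sup>+s. ennreal (u s) \<partial>measure_pmf W)"
proof -
  let ?F = "\<lambda>s. u s * pmf W s"
  have F: "0 \<le> ?F s" for s using u by simp
  have "(\<integral>\<^sup>+s. ennreal (u s) \<partial>measure_pmf W) = (\<integral>\<^sup>+s. ennreal (?F s) \<partial>count_space UNIV)"
    unfolding nn_integral_measure_pmf
    by (intro nn_integral_cong) (simp add: ennreal_mult' u mult.commute)
  also have "\<dots> = (\<integral>\<^sup>+s. ennreal (?F s) * indicator S s \<partial>count_space UNIV)"
    using assms(1) by (intro nn_integral_cong) (auto simp: indicator_def set_pmf_iff)
  also have "\<dots> = (\<integral>\<^sup>+s. ennreal (?F s) \<partial>count_space S)"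
    by (simp add: nn_integral_count_space_indicator)
  finally have nn: "(\<integral>\<^sup>+s. ennreal (u s) \<partial>measure_pmf W) = (\<integral>\<^sup>+s. ennreal (?F s) \<partial>count_space S)" .
  show ?thesis
  proof (cases "Infinite_Set_Sum.abs_summable_on ?F S")
    case True
    have "(\<integral>\<^sup>+s. ennreal (?F s) \<partial>count_space S) = ennreal (infsetsum ?F S)"
      by (rule nn_integral_conv_infsetsum[OF True]) (rule F)
    moreover have "infsetsum ?F S = infsum ?F S" by (rule infsetsum_infsum[OF True])
    moreover have "0 \<le> infsum ?F S" by (rule infsum_nonneg) (rule F)
    ultimately show ?thesis unfolding nn by simp
  next
    case False
    then have "(\<integral>\<^sup>+s. ennreal (?F s) \<partial>count_space S) = \<infinity>"
      using F unfolding Infinite_Set_Sum.abs_summable_on_def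
      by (subst (asm) integrable_iff_bounded) (simp add: less_top[symmetric])
    moreover have "\<not> ?F summable_on S"
    proof
      assume "?F summable_on S"
      then have "(\<lambda>s. norm (?F s)) summable_on S"
        using F by (simp cong: summable_on_cong)
      then show False using False abs_summable_equivalent by blast
    qed
    ultimately show ?thesis unfolding nn by (simp add: infsum_not_exists)
  qed
qed

text \<open>Numerator and denominator of Z_W see the path only after its shift by w, so Z_W is one
  normalisation, not depending on w, applied to the shifted path.\<close>

lemma Z_W_eq:
  assumes "set_pmf W = T0" and n: "is_norm nrm"
  shows "Z_W nrm \<alpha> W (w, \<theta>) = pmf_normalise nrm \<alpha> W (Bshift w \<theta>)"
  using infsum_pmf_eq_nn_integral[OF assms(1), of "\<lambda>s. nrm (\<theta> (s - w)) powr \<alpha>"]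
  by (simp add: Z_W_def pmf_normalise_def pmf_norm_def Bshift_def)

lemma pmf_norm_measurable [measurable]:
  assumes "is_norm nrm"
  shows "pmf_norm nrm \<alpha> W \<in> borel_measurable (Cspace :: (real ^ 'p \<Rightarrow> real ^ 'd) measure)"
proof -
  note [measurable] = is_norm_measurable[OF assms]
  have [measurable]: "(\<lambda>x. snd x) \<in> measurable ((Cspace :: (real ^ 'p \<Rightarrow> real ^ 'd) measure) \<Otimes>\<^sub>M measure_pmf W) borel"
    by (rule measurable_compose[OF measurable_snd]) simp
  show ?thesis
    unfolding pmf_norm_def
    by (rule sigma_finite_measure.borel_measurable_nn_integral)
      (simp_all add: case_prod_beta measure_pmf.sigma_finite_measure_axioms)
qed

lemma pmf_normalise_measurable:
  assumes "is_norm nrm"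
  shows "pmf_normalise nrm \<alpha> W \<in> measurable Cspace (Cspace :: (real ^ 'p \<Rightarrow> real ^ 'd) measure)"
proof -
  note [measurable] = pmf_norm_measurable[OF assms]
  show ?thesis unfolding pmf_normalise_def by (intro measurable_scale) simp_all
qed

lemma pmf_norm_scale:
  assumes n: "is_norm nrm" and "0 \<le> c" and f: "f \<in> Cpaths"
  shows "pmf_norm nrm \<alpha> W (\<lambda>t. c *\<^sub>R f t) = ennreal (c powr \<alpha>) * pmf_norm nrm \<alpha> W f"
  unfolding pmf_norm_def
  using assms
  by (subst nn_integral_cmult[symmetric])
    (simp_all add: is_norm_scale[OF n] is_norm_nonneg[OF n] powr_mult ennreal_mult')

lemma pmf_normalise_scale:
  assumes n: "is_norm nrm" and "0 < c" and f: "f \<in> Cpaths" and "0 < \<alpha>"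
  shows "pmf_normalise nrm \<alpha> W (\<lambda>t. c *\<^sub>R f t) = pmf_normalise nrm \<alpha> W f"
  using assms
  by (simp add: pmf_normalise_def pmf_norm_scale enn2real_mult powr_mult powr_powr fun_eq_iff)

text \<open>A factor c in the path multiplies the normaliser by \<open>c powr \<alpha>\<close>
  before the root and so cancels. Any functional of the normalised path may therefore be used in
  (ii).\<close>

lemma pmf_normalise_E0:
  assumes n: "is_norm nrm" and "0 < \<alpha>" and [measurable]: "F \<in> borel_measurable Cspace"
  shows "(\<lambda>f. F (pmf_normalise nrm \<alpha> W f)) \<in> E0"
proof -
  have "F (pmf_normalise nrm \<alpha> W (\<lambda>t. c *\<^sub>R f t)) = F (pmf_normalise nrm \<alpha> W f)"
    if "0 < c" "f \<in> Cpaths" for c f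
    using pmf_normalise_scale[OF n that assms(2)] by simp
  then show ?thesis
    using measurable_compose[OF pmf_normalise_measurable[OF n] assms(3)] unfolding E0_def by blast
qed

lemma tilted_law_eq_tilt:
  fixes Z :: "'b \<Rightarrow> real ^ 'p \<Rightarrow> real ^ 'd"
  assumes n: "is_norm nrm" and Z [measurable]: "Z \<in> measurable N Cspace"
    and one: "(\<integral>\<^sup>+\<omega>. ennreal (nrm (Z \<omega> h) powr \<alpha>) \<partial>N) = 1"
  shows "tilted_law nrm \<alpha> N Z h = tilt \<alpha> (distr N Cspace Z) (\<lambda>f. nrm (f h))"
proof -
  note [measurable] = is_norm_measurable[OF n]
  have [measurable]: "(\<lambda>f t. f t /\<^sub>R nrm (f h)) \<in> measurable Cspace (Cspace :: (real ^ 'p \<Rightarrow> real ^ 'd) measure)"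
    by (rule normalise_measurable) (auto simp: is_norm_nonneg[OF n])
  have "density (distr N Cspace Z) (\<lambda>f. ennreal (nrm (f h) powr \<alpha>))
      = distr (density N (\<lambda>\<omega>. ennreal (nrm (Z \<omega> h) powr \<alpha>))) Cspace Z"
    by (rule density_distr) measurable
  then show ?thesis
    unfolding tilted_law_def tilt_def one by (simp add: distr_distr comp_def divide_ennreal_def)
qed

lemma prob_space_tilt:
  assumes "sets P = sets Cspace" "r \<in> borel_measurable Cspace" "\<And>f. f \<in> Cpaths \<Longrightarrow> 0 \<le> r f"
    and "(\<integral>\<^sup>+f. ennreal (r f powr \<alpha>) \<partial>P) = 1"
  shows "prob_space (tilt \<alpha> P r)"
proof
  have "(\<integral>\<^sup>+f. 1 \<partial>tilt \<alpha> P r) = (\<integral>\<^sup>+f. ennreal (r f powr \<alpha>) * 1 \<partial>P)"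
    by (rule nn_integral_tilt_E0[OF assms(1-3) E0_const])
  then show "emeasure (tilt \<alpha> P r) (space (tilt \<alpha> P r)) = 1" using assms(4) by simp
qed

lemma Bshift_measurable_pair:
  "(\<lambda>x. Bshift (fst x) (snd x)) \<in> measurable (measure_pmf W \<Otimes>\<^sub>M Cspace) (Cspace :: (real ^ 'p \<Rightarrow> real ^ 'd) measure)"
proof (rule measurable_CspaceI)
  fix t :: "real ^ 'p"
  have [measurable]: "fst \<in> measurable (measure_pmf W \<Otimes>\<^sub>M (Cspace :: (real ^ 'p \<Rightarrow> real ^ 'd) measure)) borel"
    by (rule measurable_compose[OF measurable_fst]) simp
  show "(\<lambda>x. Bshift (fst x) (snd x) t) \<in> borel_measurable (measure_pmf W \<Otimes>\<^sub>M (Cspace :: (real ^ 'p \<Rightarrow> real ^ 'd) measure))"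
    unfolding Bshift_def by measurable
qed (auto simp: space_pair_measure Cpaths_Bshift)

lemma Z_W_measurable:
  assumes n: "is_norm nrm" and W: "set_pmf W = T0" and T: "sets T = sets Cspace"
  shows "Z_W nrm \<alpha> W \<in> measurable (measure_pmf W \<Otimes>\<^sub>M T) (Cspace :: (real ^ 'p \<Rightarrow> real ^ 'd) measure)"
proof -
  have "Z_W nrm \<alpha> W = (\<lambda>x. pmf_normalise nrm \<alpha> W (Bshift (fst x) (snd x)))"
    using Z_W_eq[OF W n] by (auto simp: fun_eq_iff)
  moreover have "(\<lambda>x. pmf_normalise nrm \<alpha> W (Bshift (fst x) (snd x))) \<in> measurable (measure_pmf W \<Otimes>\<^sub>M Cspace) Cspace"
    by (rule measurable_compose[OF Bshift_measurable_pair pmf_normalise_measurable[OF n]])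
  moreover have "sets (measure_pmf W \<Otimes>\<^sub>M T) = sets (measure_pmf W \<Otimes>\<^sub>M Cspace)"
    by (intro sets_pair_measure_cong T refl)
  ultimately show ?thesis by (simp cong: measurable_cong_sets)
qed

text \<open>By homogeneity the division by the norm at 0 in the tilted path is invisible after
  normalisation; only the density of the tilt remains. The shift identity is not assumed, so the
  formula serves both directions of (i).\<close>

lemma nn_integral_Z_W:
  fixes P :: "(real ^ 'p \<Rightarrow> real ^ 'd) measure"
  assumes n: "is_norm nrm" and W: "set_pmf W = T0" and "0 < \<alpha>" and P: "sets P = sets Cspace"
    and one: "(\<integral>\<^sup>+f. ennreal (nrm (f 0) powr \<alpha>) \<partial>P) = 1"
    and F [measurable]: "F \<in> borel_measurable Cspace"
  shows "(\<integral>\<^sup>+x. F (Z_W nrm \<alpha> W x) \<partial>(measure_pmf W \<Otimes>\<^sub>M tilt \<alpha> P (\<lambda>f. nrm (f 0))))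
    = (\<integral>\<^sup>+w. (\<integral>\<^sup>+f. ennreal (nrm (f 0) powr \<alpha>) * F (pmf_normalise nrm \<alpha> W (Bshift w f)) \<partial>P) \<partial>measure_pmf W)"
proof -
  note [measurable] = is_norm_measurable[OF n]
  have r: "(\<lambda>f. nrm (f 0)) \<in> borel_measurable (Cspace :: (real ^ 'p \<Rightarrow> real ^ 'd) measure)" by measurable
  interpret T: prob_space "tilt \<alpha> P (\<lambda>f. nrm (f 0))"
    by (rule prob_space_tilt[OF P r _ one]) (rule is_norm_nonneg[OF n])
  have "(\<integral>\<^sup>+x. F (Z_W nrm \<alpha> W x) \<partial>(measure_pmf W \<Otimes>\<^sub>M tilt \<alpha> P (\<lambda>f. nrm (f 0))))
      = (\<integral>\<^sup>+w. (\<integral>\<^sup>+f. F (Z_W nrm \<alpha> W (w, f)) \<partial>tilt \<alpha> P (\<lambda>f. nrm (f 0))) \<partial>measure_pmf W)"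
    using measurable_compose[OF Z_W_measurable[OF n W sets_tilt] F]
    by (intro T.nn_integral_fst[symmetric])
  also have "\<dots> = (\<integral>\<^sup>+w. (\<integral>\<^sup>+f. ennreal (nrm (f 0) powr \<alpha>) * F (pmf_normalise nrm \<alpha> W (Bshift w f)) \<partial>P) \<partial>measure_pmf W)"
    unfolding Z_W_eq[OF W n]
    by (intro nn_integral_cong nn_integral_tilt_E0[OF P r] is_norm_nonneg[OF n]
        E0_Bshift[OF pmf_normalise_E0[OF n assms(3) F]])
  finally show ?thesis .
qed

section \<open>Cancellation of tilt, shift and normaliser\<close>

text \<open>The \<alpha>-power of the norm is the sum of the \<alpha>-powers of the components times
  the 0-homogeneous factor \<rho>. Absorbing \<rho>, evaluated at time h, into \<Gamma> reduces the
  claim to the componentwise identity, summed over k.\<close>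

lemma shift_identity_nrm:
  fixes P :: "(real ^ 'p \<Rightarrow> real ^ 'd) measure"
  assumes n: "is_norm nrm" and "0 < \<alpha>" and P [measurable_cong]: "sets P = sets Cspace"
    and id: "shift_identity \<alpha> P" and \<Gamma>: "\<Gamma> \<in> E0"
  shows "(\<integral>\<^sup>+f. ennreal (nrm (f h) powr \<alpha>) * \<Gamma> f \<partial>P) = (\<integral>\<^sup>+f. ennreal (nrm (f 0) powr \<alpha>) * \<Gamma> (Bshift h f) \<partial>P)"
proof -
  note [measurable] = is_norm_measurable[OF n] E0_measurable[OF \<Gamma>]
  define \<rho> where "\<rho> x = nrm x powr \<alpha> / (\<Sum>k\<in>UNIV. x $ k powr \<alpha>)" for x :: "real ^ 'd"
  have [measurable]: "\<rho> \<in> borel_measurable borel" unfolding \<rho>_def by measurable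
  have \<rho>_nonneg: "0 \<le> \<rho> x" for x unfolding \<rho>_def by (intro divide_nonneg_nonneg sum_nonneg) auto
  have \<rho>_scale: "\<rho> (c *\<^sub>R x) = \<rho> x" if "0 < c" "\<And>k. 0 \<le> x $ k" for c x
    using that by (simp add: \<rho>_def is_norm_scale[OF n] is_norm_nonneg[OF n] powr_mult sum_distrib_left[symmetric])
  have shift_h: "Bshift h f h = f 0" for f :: "real ^ 'p \<Rightarrow> real ^ 'd" by (simp add: Bshift_def)
  have split: "ennreal (nrm x powr \<alpha>) = (\<Sum>k\<in>UNIV. ennreal (x $ k powr \<alpha>) * ennreal (\<rho> x))" for x
  proof (cases "x = 0")
    case False
    then obtain k where "x $ k \<noteq> 0" by (metis vec_eq_iff zero_index)
    then have "0 < x $ k powr \<alpha>" by simp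
    also have "\<dots> \<le> (\<Sum>k\<in>UNIV. x $ k powr \<alpha>)" by (rule member_le_sum) auto
    finally have "nrm x powr \<alpha> = (\<Sum>k\<in>UNIV. x $ k powr \<alpha>) * \<rho> x" by (simp add: \<rho>_def)
    then show ?thesis
      by (simp add: ennreal_mult sum_nonneg \<rho>_nonneg sum_ennreal[symmetric] sum_distrib_right)
  qed (use is_norm_eq_0_iff[OF n, of 0] in simp)
  have "\<rho> (c *\<^sub>R f h) = \<rho> (f h)" if "0 < c" "f \<in> Cpaths" for c f
    by (rule \<rho>_scale[OF that(1)]) (rule Cpaths_nonneg[OF that(2)])
  then have E: "(\<lambda>f. ennreal (\<rho> (f h)) * \<Gamma> f) \<in> E0"
    using \<Gamma> by (simp add: E0_def)
  have "(\<integral>\<^sup>+f. ennreal (nrm (f h) powr \<alpha>) * \<Gamma> f \<partial>P)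
      = (\<integral>\<^sup>+f. (\<Sum>k\<in>UNIV. ennreal (f h $ k powr \<alpha>) * (ennreal (\<rho> (f h)) * \<Gamma> f)) \<partial>P)"
    unfolding split by (simp add: sum_distrib_right mult.assoc)
  also have "\<dots> = (\<Sum>k\<in>UNIV. \<integral>\<^sup>+f. ennreal (f h $ k powr \<alpha>) * (ennreal (\<rho> (f h)) * \<Gamma> f) \<partial>P)"
    by (rule nn_integral_sum) measurable
  also have "\<dots> = (\<Sum>k\<in>UNIV. \<integral>\<^sup>+f. ennreal (f 0 $ k powr \<alpha>) * (ennreal (\<rho> (Bshift h f h)) * \<Gamma> (Bshift h f)) \<partial>P)"
    by (intro sum.cong refl id[unfolded shift_identity_def, rule_format, OF E])
  also have "\<dots> = (\<integral>\<^sup>+f. (\<Sum>k\<in>UNIV. ennreal (f 0 $ k powr \<alpha>) * (ennreal (\<rho> (f 0)) * \<Gamma> (Bshift h f))) \<partial>P)"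
    by (subst nn_integral_sum) (simp_all add: shift_h)
  also have "\<dots> = (\<integral>\<^sup>+f. ennreal (nrm (f 0) powr \<alpha>) * \<Gamma> (Bshift h f) \<partial>P)"
    unfolding split by (simp add: sum_distrib_right mult.assoc)
  finally show ?thesis .
qed

text \<open>W charges every rational time, so the path vanishes on a dense set and, being
  continuous, everywhere. Paths with a positive supremum of the norm thus have a nonzero
  normaliser.\<close>

lemma pmf_norm_eq_0_imp:
  assumes n: "is_norm nrm" and W: "set_pmf W = T0" and f: "f \<in> Cpaths" and zero: "pmf_norm nrm \<alpha> W f = 0"
  shows "f t = 0"
proof -
  have "AE s in measure_pmf W. ennreal (nrm (f s) powr \<alpha>) = 0"
    using zero unfolding pmf_norm_def by (subst (asm) nn_integral_0_iff_AE) auto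
  then have "f s = 0" if "s \<in> T0" for s
    using that is_norm_nonneg[OF n, of "f s"] is_norm_eq_0_iff[OF n, of "f s"]
    by (auto simp: AE_measure_pmf_iff W)
  then have "f (grid m t) = 0" for m using grid_in_T0 by blast
  moreover have "(\<lambda>m. f (grid m t)) \<longlonglongrightarrow> f t"
    using Cpaths_continuous[OF f] grid_tendsto
    by (intro isCont_tendsto_compose[of _ f]) (auto simp: continuous_on_eq_continuous_at)
  ultimately show ?thesis by (simp add: LIMSEQ_const_iff)
qed

text \<open>The shift identity moves the tilt from time 0 to time w while undoing the shift by w.
  Integrating over w then produces exactly \<open>pmf_norm\<close>, and the normalised maximum is
  the original maximum divided by \<open>pmf_norm\<close>. The cancellation requires the normaliser
  to be almost surely positive and finite.\<close>

lemma nn_integral_max_fun_Z_W: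
  fixes P :: "(real ^ 'p \<Rightarrow> real ^ 'd) measure"
  assumes n: "is_norm nrm" and W: "set_pmf W = T0" and "0 < \<alpha>"
    and P [measurable_cong]: "sets P = sets Cspace" and prob: "prob_space P"
    and one: "\<And>t. (\<integral>\<^sup>+f. ennreal (nrm (f t) powr \<alpha>) \<partial>P) = 1"
    and ne0: "AE f in P. pmf_norm nrm \<alpha> W f \<noteq> 0"
    and id: "shift_identity \<alpha> P"
    and J: "finite J" and y: "\<And>i. 0 < y i"
  shows "(\<integral>\<^sup>+x. max_fun \<alpha> y J (Z_W nrm \<alpha> W x) \<partial>(measure_pmf W \<Otimes>\<^sub>M tilt \<alpha> P (\<lambda>f. nrm (f 0))))
    = (\<integral>\<^sup>+f. max_fun \<alpha> y J f \<partial>P)"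
proof -
  interpret P: prob_space P by (rule prob)
  interpret PW: pair_sigma_finite "measure_pmf W" P ..
  note [measurable] = is_norm_measurable[OF n] pmf_norm_measurable[OF n] max_fun_measurable[OF J]
  let ?G = "\<lambda>f. max_fun \<alpha> y J (pmf_normalise nrm \<alpha> W f)"
  have G: "?G \<in> E0" by (rule pmf_normalise_E0[OF n assms(3)]) measurable
  have [measurable]: "?G \<in> borel_measurable Cspace" by (rule E0_measurable[OF G])
  have [measurable]: "fst \<in> measurable (measure_pmf W \<Otimes>\<^sub>M P) borel"
    by (rule measurable_compose[OF measurable_fst]) simp
  have [measurable]: "(\<lambda>x. nrm (snd x (fst x))) \<in> borel_measurable (measure_pmf W \<Otimes>\<^sub>M P)"
    by measurable
  have [measurable]: "(\<lambda>x. ?G (snd x)) \<in> borel_measurable (measure_pmf W \<Otimes>\<^sub>M P)"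
    by measurable
  \<comment> \<open>Finiteness of the normaliser comes from its mean: averaging the unit moments
    over W gives 1.\<close>
  have total: "(\<integral>\<^sup>+f. pmf_norm nrm \<alpha> W f \<partial>P) = 1"
  proof -
    have "(\<integral>\<^sup>+f. pmf_norm nrm \<alpha> W f \<partial>P) = (\<integral>\<^sup>+w. (\<integral>\<^sup>+f. ennreal (nrm (f w) powr \<alpha>) \<partial>P) \<partial>measure_pmf W)"
      unfolding pmf_norm_def by (rule PW.Fubini') (simp add: case_prod_beta)
    then show ?thesis by (simp add: one measure_pmf.emeasure_space_1[simplified])
  qed
  have fin: "AE f in P. pmf_norm nrm \<alpha> W f \<noteq> \<infinity>"
    by (rule nn_integral_PInf_AE) (simp_all add: total)
  have "(\<integral>\<^sup>+x. max_fun \<alpha> y J (Z_W nrm \<alpha> W x) \<partial>(measure_pmf W \<Otimes>\<^sub>M tilt \<alpha> P (\<lambda>f. nrm (f 0))))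
      = (\<integral>\<^sup>+w. (\<integral>\<^sup>+f. ennreal (nrm (f 0) powr \<alpha>) * ?G (Bshift w f) \<partial>P) \<partial>measure_pmf W)"
    by (rule nn_integral_Z_W[OF n W assms(3) P one]) measurable
  also have "\<dots> = (\<integral>\<^sup>+w. (\<integral>\<^sup>+f. ennreal (nrm (f w) powr \<alpha>) * ?G f \<partial>P) \<partial>measure_pmf W)"
    by (intro nn_integral_cong shift_identity_nrm[OF n assms(3) P id G, symmetric])
  also have "\<dots> = (\<integral>\<^sup>+f. (\<integral>\<^sup>+w. ennreal (nrm (f w) powr \<alpha>) * ?G f \<partial>measure_pmf W) \<partial>P)"
    by (rule PW.Fubini'[symmetric]) (simp add: case_prod_beta)
  also have "\<dots> = (\<integral>\<^sup>+f. pmf_norm nrm \<alpha> W f * ?G f \<partial>P)"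
    unfolding pmf_norm_def by (simp add: nn_integral_multc)
  also have "\<dots> = (\<integral>\<^sup>+f. max_fun \<alpha> y J f \<partial>P)"
  proof (rule nn_integral_cong_AE)
    show "AE f in P. pmf_norm nrm \<alpha> W f * ?G f = max_fun \<alpha> y J f"
      using fin ne0 AE_space
    proof eventually_elim
      case (elim f)
      then have f: "f \<in> Cpaths" using sets_eq_imp_space_eq[OF P] by simp
      obtain r where r: "pmf_norm nrm \<alpha> W f = ennreal r" "0 \<le> r"
        using elim(1) by (cases "pmf_norm nrm \<alpha> W f") auto
      with elim(2) have "0 < r" by (cases "r = 0") auto
      have "?G f = ennreal (inverse (r powr (1 / \<alpha>)) powr \<alpha>) * max_fun \<alpha> y J f"
        unfolding pmf_normalise_def using r by (simp add: max_fun_scale J f y)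
      also have "inverse (r powr (1 / \<alpha>)) powr \<alpha> = inverse r"
        using \<open>0 < r\<close> \<open>0 < \<alpha>\<close> by (simp add: inverse_powr powr_powr)
      finally show ?case
        using \<open>0 < r\<close> unfolding r(1)
        by (simp add: mult.assoc[symmetric] ennreal_mult'[symmetric])
    qed
  qed
  finally show ?thesis .
qed

section \<open>Rational translations of W and passage to real shifts\<close>

lemma max_fun_Bshift:
  "max_fun \<alpha> y J (Bshift h f)
    = max_fun \<alpha> (\<lambda>i. y (fst i + h, snd i)) ((\<lambda>i. (fst i - h, snd i)) ` J) f"
  by (simp add: max_fun_def Bshift_def image_image)

lemma T0_add: "s \<in> T0 \<Longrightarrow> t \<in> T0 \<Longrightarrow> s + t \<in> T0"
  and T0_uminus: "s \<in> T0 \<Longrightarrow> - s \<in> T0"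
  by (auto simp: T0_def)

text \<open>Without an admissible W condition (i) would be vacuous and could not imply stationarity.
  A geometric variable pushed through an enumeration of the rational points has full
  support.\<close>

lemma exists_pmf_T0: "\<exists>W. set_pmf W = (T0 :: (real ^ 'p) set)"
proof -
  have "(0 :: real ^ 'p) \<in> T0" by (simp add: T0_def)
  then have "range (from_nat_into (T0 :: (real ^ 'p) set)) = T0"
    by (intro range_from_nat_into countable_T0) auto
  then have "set_pmf (map_pmf (from_nat_into T0) (geometric_pmf (1 / 2))) = (T0 :: (real ^ 'p) set)"
    by (simp add: set_pmf_geometric)
  then show ?thesis ..
qed

lemma pmf_normalise_translate:
  "pmf_normalise nrm \<alpha> (map_pmf (\<lambda>w. w + h) W) (Bshift h f) = Bshift h (pmf_normalise nrm \<alpha> W f)"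
  by (simp add: pmf_normalise_def pmf_norm_def Bshift_def)

text \<open>Shifting the path and the mass function together leaves the normaliser unchanged, so
  replacing W by W + h shifts Z_W by h. Rationality of h keeps the support equal to
  \<open>T0\<close>.\<close>

lemma nn_integral_Z_W_translate:
  fixes P :: "(real ^ 'p \<Rightarrow> real ^ 'd) measure"
  assumes n: "is_norm nrm" and W: "set_pmf W = T0" and h: "h \<in> T0" and "0 < \<alpha>" and P: "sets P = sets Cspace"
    and one: "(\<integral>\<^sup>+f. ennreal (nrm (f 0) powr \<alpha>) \<partial>P) = 1"
    and F [measurable]: "F \<in> borel_measurable Cspace"
  defines "W' \<equiv> map_pmf (\<lambda>w. w + h) W"
  shows "(\<integral>\<^sup>+x. F (Z_W nrm \<alpha> W' x) \<partial>(measure_pmf W' \<Otimes>\<^sub>M tilt \<alpha> P (\<lambda>f. nrm (f 0))))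
    = (\<integral>\<^sup>+x. F (Bshift h (Z_W nrm \<alpha> W x)) \<partial>(measure_pmf W \<Otimes>\<^sub>M tilt \<alpha> P (\<lambda>f. nrm (f 0))))"
    and "set_pmf W' = T0"
proof -
  show W': "set_pmf W' = T0"
  proof -
    have "t \<in> (\<lambda>w. w + h) ` T0" if "t \<in> T0" for t
      using T0_add[OF that T0_uminus[OF h]] by (intro image_eqI[of _ _ "t - h"]) auto
    then show ?thesis using T0_add[OF _ h] by (auto simp: W'_def W)
  qed
  have "(\<integral>\<^sup>+x. F (Z_W nrm \<alpha> W' x) \<partial>(measure_pmf W' \<Otimes>\<^sub>M tilt \<alpha> P (\<lambda>f. nrm (f 0))))
      = (\<integral>\<^sup>+w. (\<integral>\<^sup>+f. ennreal (nrm (f 0) powr \<alpha>) * F (pmf_normalise nrm \<alpha> W' (Bshift (h + w) f)) \<partial>P) \<partial>measure_pmf W)"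
    unfolding nn_integral_Z_W[OF n W' assms(4) P one F] by (simp add: W'_def add.commute)
  also have "\<dots> = (\<integral>\<^sup>+w. (\<integral>\<^sup>+f. ennreal (nrm (f 0) powr \<alpha>) * F (Bshift h (pmf_normalise nrm \<alpha> W (Bshift w f))) \<partial>P) \<partial>measure_pmf W)"
    by (simp add: Bshift_Bshift[symmetric] W'_def pmf_normalise_translate)
  also have "\<dots> = (\<integral>\<^sup>+x. F (Bshift h (Z_W nrm \<alpha> W x)) \<partial>(measure_pmf W \<Otimes>\<^sub>M tilt \<alpha> P (\<lambda>f. nrm (f 0))))"
    by (rule nn_integral_Z_W[OF n W assms(4) P one, symmetric]) measurable
  finally show "(\<integral>\<^sup>+x. F (Z_W nrm \<alpha> W' x) \<partial>(measure_pmf W' \<Otimes>\<^sub>M tilt \<alpha> P (\<lambda>f. nrm (f 0))))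
    = (\<integral>\<^sup>+x. F (Bshift h (Z_W nrm \<alpha> W x)) \<partial>(measure_pmf W \<Otimes>\<^sub>M tilt \<alpha> P (\<lambda>f. nrm (f 0))))" .
qed

text \<open>Each of the finitely many terms is continuous in the shift and lies below the maximum,
  so the maximum at h is at most the lower limit; Fatou transfers this to integrals without any
  majorant.\<close>

lemma nn_integral_max_fun_Bshift_lsc:
  fixes P :: "(real ^ 'p \<Rightarrow> real ^ 'd) measure"
  assumes P [measurable_cong]: "sets P = sets Cspace" and J: "finite J" and s: "s \<longlonglongrightarrow> h"
    and "0 < \<alpha>"
    and const: "\<And>n. (\<integral>\<^sup>+f. max_fun \<alpha> y J (Bshift (s n) f) \<partial>P) = L"
  shows "(\<integral>\<^sup>+f. max_fun \<alpha> y J (Bshift h f) \<partial>P) \<le> L"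
proof -
  note [measurable] = max_fun_measurable[OF J]
  have "(\<integral>\<^sup>+f. max_fun \<alpha> y J (Bshift h f) \<partial>P) \<le> (\<integral>\<^sup>+f. liminf (\<lambda>n. max_fun \<alpha> y J (Bshift (s n) f)) \<partial>P)"
  proof (rule nn_integral_mono)
    fix f assume "f \<in> space P"
    then have f: "f \<in> Cpaths" using sets_eq_imp_space_eq[OF P] by simp
    have "ennreal (y i * coord (Bshift h f) i powr \<alpha>) \<le> liminf (\<lambda>n. max_fun \<alpha> y J (Bshift (s n) f))"
      if "i \<in> J" for i
    proof -
      have "(\<lambda>n. f (fst i - s n)) \<longlonglongrightarrow> f (fst i - h)"
        using Cpaths_continuous[OF f]
        by (intro isCont_tendsto_compose[of _ f] tendsto_intros s) (auto simp: continuous_on_eq_continuous_at)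
      then have "(\<lambda>n. ennreal (y i * coord (Bshift (s n) f) i powr \<alpha>)) \<longlonglongrightarrow> ennreal (y i * coord (Bshift h f) i powr \<alpha>)"
        unfolding Bshift_def
        using \<open>0 < \<alpha>\<close> Cpaths_nonneg[OF f]
        by (intro tendsto_ennrealI tendsto_mult tendsto_const tendsto_powr2 tendsto_vec_nth) auto
      then have "ennreal (y i * coord (Bshift h f) i powr \<alpha>) = liminf (\<lambda>n. ennreal (y i * coord (Bshift (s n) f) i powr \<alpha>))"
        by (intro lim_imp_Liminf[symmetric]) auto
      also have "\<dots> \<le> liminf (\<lambda>n. max_fun \<alpha> y J (Bshift (s n) f))"
        unfolding max_fun_def by (intro Liminf_mono always_eventually allI SUP_upper that)
      finally show ?thesis .
    qed
    then show "max_fun \<alpha> y J (Bshift h f) \<le> liminf (\<lambda>n. max_fun \<alpha> y J (Bshift (s n) f))"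
      unfolding max_fun_def[of \<alpha> y J "Bshift h f"] by (rule SUP_least)
  qed
  also have "\<dots> \<le> liminf (\<lambda>n. \<integral>\<^sup>+f. max_fun \<alpha> y J (Bshift (s n) f) \<partial>P)"
    by (rule nn_integral_liminf) measurable
  also have "\<dots> = L" by (simp add: const Liminf_const)
  finally show ?thesis .
qed

lemma max_fun_stationary_if_T0:
  fixes P :: "(real ^ 'p \<Rightarrow> real ^ 'd) measure"
  assumes "0 < \<alpha>" and P: "sets P = sets Cspace"
    and rat: "\<And>q J y. q \<in> T0 \<Longrightarrow> finite J \<Longrightarrow> (\<And>i. 0 < y i) \<Longrightarrow>
      (\<integral>\<^sup>+f. max_fun \<alpha> y J (Bshift q f) \<partial>P) = (\<integral>\<^sup>+f. max_fun \<alpha> y J f \<partial>P)"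
  shows "max_fun_stationary \<alpha> P"
  unfolding max_fun_stationary_def
proof (intro allI impI)
  fix h :: "real ^ 'p" and J :: "((real ^ 'p) \<times> 'd) set" and y :: "(real ^ 'p) \<times> 'd \<Rightarrow> real"
  assume J: "finite J" and y: "\<forall>i. 0 < y i"
  \<comment> \<open>Rational invariance is assumed for all index sets and weights. Hence it also
    holds for those translated by s, that is, from an arbitrary starting shift.\<close>
  have per: "(\<integral>\<^sup>+f. max_fun \<alpha> y J (Bshift (s + q) f) \<partial>P) = (\<integral>\<^sup>+f. max_fun \<alpha> y J (Bshift s f) \<partial>P)"
    if "q \<in> T0" for s q
    unfolding Bshift_Bshift[symmetric] max_fun_Bshift[of \<alpha> y J s]
    using J y by (intro rat that) auto
  show "(\<integral>\<^sup>+f. max_fun \<alpha> y J (Bshift h f) \<partial>P) = (\<integral>\<^sup>+f. max_fun \<alpha> y J f \<partial>P)"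
  proof (rule antisym)
    show "(\<integral>\<^sup>+f. max_fun \<alpha> y J (Bshift h f) \<partial>P) \<le> (\<integral>\<^sup>+f. max_fun \<alpha> y J f \<partial>P)"
      using per[OF grid_in_T0, of 0]
      by (intro nn_integral_max_fun_Bshift_lsc[OF P J grid_tendsto assms(1)]) simp
    \<comment> \<open>The reverse inequality: the shifts \<open>h - grid n h\<close> tend to 0, and
      they differ from h by rational vectors, so their integrals all equal the one at h.\<close>
    have "(\<lambda>n. h + - grid n h) \<longlonglongrightarrow> h + - h"
      by (intro tendsto_add tendsto_const tendsto_minus grid_tendsto)
    then have lim: "(\<lambda>n. h + - grid n h) \<longlonglongrightarrow> 0" by simp
    have "(\<integral>\<^sup>+f. max_fun \<alpha> y J (Bshift 0 f) \<partial>P) \<le> (\<integral>\<^sup>+f. max_fun \<alpha> y J (Bshift h f) \<partial>P)"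
      by (rule nn_integral_max_fun_Bshift_lsc[OF P J lim assms(1)]) (rule per[OF T0_uminus[OF grid_in_T0]])
    then show "(\<integral>\<^sup>+f. max_fun \<alpha> y J f \<partial>P) \<le> (\<integral>\<^sup>+f. max_fun \<alpha> y J (Bshift h f) \<partial>P)" by simp
  qed
qed

section \<open>The characterisation of stationarity\<close>

theorem corollary2p3:
  fixes nrm :: "real ^ 'd \<Rightarrow> real"
    and \<alpha> :: real
    and M :: "'a measure" and X :: "'a \<Rightarrow> real ^ 'p \<Rightarrow> real ^ 'd"
    and N :: "'b measure" and Z :: "'b \<Rightarrow> real ^ 'p \<Rightarrow> real ^ 'd"
  assumes "is_norm nrm"
    and "\<alpha> > 0"
    and "prob_space M" and "X \<in> measurable M Cspace"
    and "prob_space N" and "Z \<in> measurable N Cspace"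
    and "spectral_process \<alpha> M X N Z"
    and "frechet_marginals \<alpha> M X N Z"
    and "AE \<omega> in N. (SUP t. ennreal (nrm (Z \<omega> t))) > 0"
    and "\<And>t. (\<integral>\<^sup>+\<omega>. ennreal (nrm (Z \<omega> t) powr \<alpha>) \<partial>N) = 1"
  shows
    "(stationary M X \<longleftrightarrow>
        (\<forall>W :: (real ^ 'p) pmf. set_pmf W = T0 \<longrightarrow>
           spectral_process \<alpha> M X
             (measure_pmf W \<Otimes>\<^sub>M tilted_law nrm \<alpha> N Z 0) (Z_W nrm \<alpha> W)))
     \<and>
     (stationary M X \<longleftrightarrow>
        (\<forall>h. \<forall>\<Gamma>\<in>E0. \<forall>k.
           (\<integral>\<^sup>+\<omega>. ennreal ((Z \<omega> h $ k) powr \<alpha>) * \<Gamma> (Z \<omega>) \<partial>N) =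
           (\<integral>\<^sup>+\<omega>. ennreal ((Z \<omega> 0 $ k) powr \<alpha>) * \<Gamma> (Bshift h (Z \<omega>)) \<partial>N)))
     \<and>
     (stationary M X \<longleftrightarrow>
        (\<forall>h k. tilted_comp_law \<alpha> N Z h k =
               distr (tilted_comp_law \<alpha> N Z 0 k) Cspace (Bshift h)))"

proof -
  note n = assms(1) and \<alpha> = assms(2) and M = assms(3) and X = assms(4) and N = assms(5)
    and Z [measurable] = assms(6) and sp = assms(7)
  let ?P = "distr N Cspace Z"
  note [measurable] = is_norm_measurable[OF n]
  interpret N: prob_space N by (rule N)
  interpret P: prob_space ?P by (rule N.prob_space_distr[OF Z])
  have one: "(\<integral>\<^sup>+f. ennreal (nrm (f t) powr \<alpha>) \<partial>?P) = 1" for t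
    using assms(10)[of t] by (simp add: nn_integral_distr)
  have "\<forall>h. \<exists>b. \<forall>k. 0 < b k \<and> (\<integral>\<^sup>+\<omega>. ennreal (Z \<omega> h $ k powr \<alpha>) \<partial>N) = ennreal (b k)"
    using assms(8) unfolding frechet_marginals_def by metis
  then obtain a where a: "\<And>h k. (\<integral>\<^sup>+\<omega>. ennreal (Z \<omega> h $ k powr \<alpha>) \<partial>N) = ennreal (a h k)" "\<And>h k. 0 < a h k"
    by metis
  have fin: "(\<integral>\<^sup>+f. ennreal (coord f i powr \<alpha>) \<partial>?P) < \<top>" for i
    by (simp add: nn_integral_distr a(1))
  obtain K where K: "0 < K" "\<And>x k. \<bar>x $ k\<bar> \<le> K * nrm x"
    using is_norm_component_bound[OF n] by blast
  \<comment> \<open>The bound is uniform in h because the norm has \<alpha>-moment 1 at every time;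
    it is the boundedness needed for (iii).\<close>
  have bound: "a h k \<le> K powr \<alpha>" for h k
  proof -
    have "ennreal (a h k) \<le> (\<integral>\<^sup>+\<omega>. ennreal (K powr \<alpha>) * ennreal (nrm (Z \<omega> h) powr \<alpha>) \<partial>N)"
      unfolding a(1)[symmetric]
    proof (rule nn_integral_mono)
      fix \<omega> assume "\<omega> \<in> space N"
      then have "0 \<le> Z \<omega> h $ k" using measurable_space[OF Z] by (simp add: Cpaths_nonneg)
      then have "(Z \<omega> h $ k) powr \<alpha> \<le> (K * nrm (Z \<omega> h)) powr \<alpha>"
        using K(2)[of "Z \<omega> h" k] \<alpha> by (intro powr_mono2) auto
      then show "ennreal (Z \<omega> h $ k powr \<alpha>) \<le> ennreal (K powr \<alpha>) * ennreal (nrm (Z \<omega> h) powr \<alpha>)"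
        using K(1) by (simp add: powr_mult is_norm_nonneg[OF n] ennreal_mult'[symmetric] ennreal_leI)
    qed
    also have "\<dots> = ennreal (K powr \<alpha>)"
      by (simp add: nn_integral_cmult assms(10))
    finally show ?thesis by (simp add: ennreal_le_iff)
  qed
  have st_max: "stationary M X \<longleftrightarrow> max_fun_stationary \<alpha> ?P"
  proof -
    have "(\<integral>\<^sup>+f. max_fun \<alpha> y J (Bshift h f) \<partial>?P) = (\<integral>\<^sup>+\<omega>. max_fun \<alpha> y J (Bshift h (Z \<omega>)) \<partial>N)"
      "(\<integral>\<^sup>+f. max_fun \<alpha> y J f \<partial>?P) = (\<integral>\<^sup>+\<omega>. max_fun \<alpha> y J (Z \<omega>) \<partial>N)"
      if "finite J" for h :: "real ^ 'p" and J :: "((real ^ 'p) \<times> 'd) set" and y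
      using max_fun_measurable[OF that, of \<alpha> y] by (simp_all add: nn_integral_distr)
    then show ?thesis
      unfolding stationary_iff_max_fun[OF \<alpha> M X sp] max_fun_stationary_def by simp
  qed
  have st_shift: "stationary M X \<longleftrightarrow> shift_identity \<alpha> ?P"
    unfolding st_max
    using max_fun_stationary_imp_shift_identity[OF \<alpha> _ fin] shift_identity_imp_max_fun_stationary[of ?P \<alpha>] by auto
  \<comment> \<open>Condition (i) for one W says that Z_W and Z have the same expected
    maxima.\<close>
  have spectral_Z_W_iff: "spectral_process \<alpha> M X (measure_pmf W \<Otimes>\<^sub>M tilted_law nrm \<alpha> N Z 0) (Z_W nrm \<alpha> W) \<longleftrightarrow>
      (\<forall>J y. finite J \<longrightarrow> (\<forall>i. 0 < y i) \<longrightarrow>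
        (\<integral>\<^sup>+x. max_fun \<alpha> y J (Z_W nrm \<alpha> W x) \<partial>(measure_pmf W \<Otimes>\<^sub>M tilt \<alpha> ?P (\<lambda>f. nrm (f 0))))
        = (\<integral>\<^sup>+f. max_fun \<alpha> y J f \<partial>?P))" if W: "set_pmf W = T0" for W :: "(real ^ 'p) pmf"
  proof -
    interpret T: prob_space "tilt \<alpha> ?P (\<lambda>f. nrm (f 0))"
      by (rule prob_space_tilt) (auto simp: is_norm_nonneg[OF n] one)
    interpret WT: pair_prob_space "measure_pmf W" "tilt \<alpha> ?P (\<lambda>f. nrm (f 0))" ..
    have "(\<integral>\<^sup>+f. max_fun \<alpha> y J f \<partial>?P) = (\<integral>\<^sup>+\<omega>. max_fun \<alpha> y J (Z \<omega>) \<partial>N)"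
      if "finite J" for J :: "((real ^ 'p) \<times> 'd) set" and y
      using max_fun_measurable[OF that, of \<alpha> y] by (simp add: nn_integral_distr)
    then show ?thesis
      unfolding spectral_process_iff_max_fun[OF \<alpha> M X sp] tilted_law_eq_tilt[OF n Z assms(10)]
      using WT.prob_space_axioms Z_W_measurable[OF n W sets_tilt] by simp
  qed
  have ne0: "AE f in ?P. pmf_norm nrm \<alpha> W f \<noteq> 0" if W: "set_pmf W = T0" for W
  proof (subst AE_distr_iff)
    show "AE \<omega> in N. pmf_norm nrm \<alpha> W (Z \<omega>) \<noteq> 0"
      using assms(9) AE_space
    proof eventually_elim
      case (elim \<omega>)
      then have "Z \<omega> \<in> Cpaths" using measurable_space[OF Z] by simp
      from pmf_norm_eq_0_imp[OF n W this] show ?case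
        using elim(1) is_norm_eq_0_iff[OF n, of 0] by (auto simp: less_SUP_iff)
    qed
    have [measurable]: "pmf_norm nrm \<alpha> W \<in> borel_measurable Cspace" by (rule pmf_norm_measurable[OF n])
    show "{f \<in> space Cspace. pmf_norm nrm \<alpha> W f \<noteq> 0} \<in> sets Cspace" by measurable
  qed simp
  have i: "stationary M X \<longleftrightarrow> (\<forall>W :: (real ^ 'p) pmf. set_pmf W = T0 \<longrightarrow>
      spectral_process \<alpha> M X (measure_pmf W \<Otimes>\<^sub>M tilted_law nrm \<alpha> N Z 0) (Z_W nrm \<alpha> W))"
  proof (intro iffI allI impI)
    fix W :: "(real ^ 'p) pmf" assume "stationary M X" and W: "set_pmf W = T0"
    then have id: "shift_identity \<alpha> ?P" using st_shift by simp
    show "spectral_process \<alpha> M X (measure_pmf W \<Otimes>\<^sub>M tilted_law nrm \<alpha> N Z 0) (Z_W nrm \<alpha> W)"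
      unfolding spectral_Z_W_iff[OF W]
      using nn_integral_max_fun_Z_W[OF n W \<alpha> sets_distr P.prob_space_axioms one ne0[OF W] id] by blast
  next
    assume all: "\<forall>W :: (real ^ 'p) pmf. set_pmf W = T0 \<longrightarrow>
      spectral_process \<alpha> M X (measure_pmf W \<Otimes>\<^sub>M tilted_law nrm \<alpha> N Z 0) (Z_W nrm \<alpha> W)"
    have "max_fun_stationary \<alpha> ?P"
    proof (rule max_fun_stationary_if_T0[OF \<alpha>])
      fix q :: "real ^ 'p" and J :: "((real ^ 'p) \<times> 'd) set" and y :: "(real ^ 'p) \<times> 'd \<Rightarrow> real"
      assume q: "q \<in> T0" and J: "finite J" and y: "\<And>i. 0 < y i"
      obtain W :: "(real ^ 'p) pmf" where W: "set_pmf W = T0" using exists_pmf_T0 by blast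
      let ?W' = "map_pmf (\<lambda>w. w + q) W"
      have W': "set_pmf ?W' = T0"
        by (rule nn_integral_Z_W_translate(2)[OF n W q \<alpha> sets_distr one borel_measurable_const])
      have eq: "(\<integral>\<^sup>+x. max_fun \<alpha> y J (Z_W nrm \<alpha> V x) \<partial>(measure_pmf V \<Otimes>\<^sub>M tilt \<alpha> ?P (\<lambda>f. nrm (f 0))))
          = (\<integral>\<^sup>+f. max_fun \<alpha> y J f \<partial>?P)"
        if "set_pmf V = T0" "finite J" "\<And>i. 0 < y i" for V :: "(real ^ 'p) pmf" and J y
        using all that spectral_Z_W_iff[OF that(1)] by blast
      \<comment> \<open>Condition (i) is used twice: for W with the maximum over translated indices,
        and for W + q with the original maximum. The translation formula links the two.\<close>
      have "(\<integral>\<^sup>+f. max_fun \<alpha> y J (Bshift q f) \<partial>?P)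
          = (\<integral>\<^sup>+x. max_fun \<alpha> y J (Bshift q (Z_W nrm \<alpha> W x)) \<partial>(measure_pmf W \<Otimes>\<^sub>M tilt \<alpha> ?P (\<lambda>f. nrm (f 0))))"
        unfolding max_fun_Bshift using J y by (intro eq[symmetric] W) auto
      also have "\<dots> = (\<integral>\<^sup>+x. max_fun \<alpha> y J (Z_W nrm \<alpha> ?W' x) \<partial>(measure_pmf ?W' \<Otimes>\<^sub>M tilt \<alpha> ?P (\<lambda>f. nrm (f 0))))"
        by (rule nn_integral_Z_W_translate(1)[OF n W q \<alpha> sets_distr one max_fun_measurable[OF J], symmetric])
      also have "\<dots> = (\<integral>\<^sup>+f. max_fun \<alpha> y J f \<partial>?P)" by (rule eq[OF W' J y])
      finally show "(\<integral>\<^sup>+f. max_fun \<alpha> y J (Bshift q f) \<partial>?P) = (\<integral>\<^sup>+f. max_fun \<alpha> y J f \<partial>?P)" .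
    qed simp
    then show "stationary M X" unfolding st_max .
  qed
  have ii: "stationary M X \<longleftrightarrow>
        (\<forall>h. \<forall>\<Gamma>\<in>E0. \<forall>k.
           (\<integral>\<^sup>+\<omega>. ennreal ((Z \<omega> h $ k) powr \<alpha>) * \<Gamma> (Z \<omega>) \<partial>N) =
           (\<integral>\<^sup>+\<omega>. ennreal ((Z \<omega> 0 $ k) powr \<alpha>) * \<Gamma> (Bshift h (Z \<omega>)) \<partial>N))"
  proof -
    have "(\<integral>\<^sup>+f. ennreal (f h $ k powr \<alpha>) * \<Gamma> f \<partial>?P) = (\<integral>\<^sup>+\<omega>. ennreal ((Z \<omega> h $ k) powr \<alpha>) * \<Gamma> (Z \<omega>) \<partial>N)"
      "(\<integral>\<^sup>+f. ennreal (f 0 $ k powr \<alpha>) * \<Gamma> (Bshift h f) \<partial>?P)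
        = (\<integral>\<^sup>+\<omega>. ennreal ((Z \<omega> 0 $ k) powr \<alpha>) * \<Gamma> (Bshift h (Z \<omega>)) \<partial>N)"
      if "\<Gamma> \<in> E0" for h k and \<Gamma> :: "(real ^ 'p \<Rightarrow> real ^ 'd) \<Rightarrow> ennreal"
      using E0_measurable[OF that] by (simp_all add: nn_integral_distr)
    then show ?thesis
      unfolding st_shift shift_identity_def by auto
  qed
  have iii: "stationary M X \<longleftrightarrow>
        (\<forall>h k. tilted_comp_law \<alpha> N Z h k = distr (tilted_comp_law \<alpha> N Z 0 k) Cspace (Bshift h))"
    unfolding st_shift
    using shift_identity_imp_tilted_comp_law[OF Z a] tilted_comp_law_imp_shift_identity[OF \<alpha> Z a bound] by blast
  show ?thesis using i ii iii by blast
qed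

end
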